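(* Let $X\in\mathcal{M}_{g,n}$ with $n\ge 1$. There exists a constant $D_X>0$ (depending only on $X$) such that for all $0<\xi\le 1$ and all $0<\varepsilon\le\min\{2\log\frac{1}{\xi},2\}$ there exists a doubly truncated orthogeodesic $o_\varepsilon$ on $X^\xi$ that is $\varepsilon$-dense on $X^\xi$ and whose length satisfies $$\ell(o_\varepsilon)\le D_X\,\frac{1}{\varepsilon}\left(\log\frac{1}{\varepsilon}+\log\frac{1}{\xi}\right).$$
   Context: $\mathcal{M}_{g,n}$ denotes the moduli space of complete connected orientable finite-area hyperbolic surfaces of genus $g$ with $n$ cusps, where $2g+n\ge 3$. A cusp region of area $\xi$ is a portion of the surface isometric to $\{z\in\mathbb{H}:\operatorname{Im} z\ge 1\}/(z\mapsto z+\xi)$. For $X\in\mathcal{M}_{g,n}$ and $0<\xi\le 2$, $X^\xi$ is the closure of the complement in $X$ of all cusp regions of area $\xi$; thus $X^\xi$ is a surface of genus $g$ with $n$ boundary components, each a horocycle of length $\xi$. A geodesic arc on $X$ is called a doubly truncated orthogeodesic on $X^\xi$ if it is perpendicular to the horocyclic boundary of $X^\xi$ at its endpoints (in particular its endpoints lie on that boundary). A geodesic arc is $\varepsilon$-dense on a subset $Y\subset X$ if every point of $Y$ is at distance at most $\varepsilon$ from it. $\ell$ denotes hyperbolic length. *)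

theory Defs
  imports "HOL-Analysis.Analysis"
begin

definition upper_half_plane :: "complex set" where
  "upper_half_plane = {z. 0 < Im z}"

definition hdist :: "complex \<Rightarrow> complex \<Rightarrow> real" where
  "hdist z w = arcosh (1 + (cmod (z - w))\<^sup>2 / (2 * Im z * Im w))"

definition harea :: "complex measure" where
  "harea = density lborel (\<lambda>z. ennreal (1 / (Im z)\<^sup>2))"

text \<open>
  A surface is a set \<open>X\<close> in a metric space, where \<open>dist\<close> restricted to \<open>X\<close> is the Riemannian
  distance of the surface. As the ambient type is arbitrary, every metric space arises like this.
\<close>

definition curve_length :: "real \<Rightarrow> real \<Rightarrow> (real \<Rightarrow> 'a::metric_space) \<Rightarrow> ennreal" where
  "curve_length a b \<gamma> =
     (SUP ts \<in> {ts. sorted ts \<and> set ts \<subseteq> {a..b}}.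
        \<Sum>i<length ts - 1. ennreal (dist (\<gamma> (ts ! i)) (\<gamma> (ts ! Suc i))))"

definition length_metric_on :: "'a::metric_space set \<Rightarrow> bool" where
  "length_metric_on X \<longleftrightarrow>
     (\<forall>x\<in>X. \<forall>y\<in>X. ennreal (dist x y) =
        (INF \<gamma> \<in> {\<gamma>. path \<gamma> \<and> path_image \<gamma> \<subseteq> X \<and> pathstart \<gamma> = x \<and> pathfinish \<gamma> = y}.
           curve_length 0 1 \<gamma>))"

definition hyperbolic_chart ::
    "'a::metric_space set \<Rightarrow> 'a set \<Rightarrow> ('a \<Rightarrow> complex) \<Rightarrow> bool" where
  "hyperbolic_chart X U \<phi> \<longleftrightarrow>
     openin (top_of_set X) U \<and> \<phi> ` U \<subseteq> upper_half_plane \<and> open (\<phi> ` U) \<and>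
     (\<forall>x\<in>U. \<forall>y\<in>U. hdist (\<phi> x) (\<phi> y) = dist x y)"

definition hyperbolic_surface :: "'a::metric_space set \<Rightarrow> bool" where
  "hyperbolic_surface X \<longleftrightarrow>
     X \<noteq> {} \<and> length_metric_on X \<and> (\<forall>x\<in>X. \<exists>U \<phi>. hyperbolic_chart X U \<phi> \<and> x \<in> U)"

text \<open>
  \<open>Im (cnj (D 1) * D \<i>)\<close> is the determinant of the real-linear map \<open>D\<close> on the complex plane,
  so the transition maps are required to have positive Jacobian.
\<close>

definition orientation_preserving_on :: "complex set \<Rightarrow> (complex \<Rightarrow> complex) \<Rightarrow> bool" where
  "orientation_preserving_on V T \<longleftrightarrow>
     (\<forall>z\<in>V. \<exists>D. (T has_derivative D) (at z) \<and> 0 < Im (cnj (D 1) * D \<i>))"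

definition orientable_surface :: "'a::metric_space set \<Rightarrow> bool" where
  "orientable_surface X \<longleftrightarrow>
     (\<exists>\<A>. (\<forall>(U, \<phi>)\<in>\<A>. hyperbolic_chart X U \<phi>) \<and> (\<forall>x\<in>X. \<exists>(U, \<phi>)\<in>\<A>. x \<in> U) \<and>
        (\<forall>(U, \<phi>)\<in>\<A>. \<forall>(V, \<psi>)\<in>\<A>.
           orientation_preserving_on (\<phi> ` (U \<inter> V)) (\<psi> \<circ> inv_into U \<phi>)))"

definition area_measure :: "'a::metric_space set \<Rightarrow> 'a measure \<Rightarrow> bool" where
  "area_measure X \<mu> \<longleftrightarrow>
     sets \<mu> = sets (restrict_space borel X) \<and>
     (\<forall>U \<phi> A. hyperbolic_chart X U \<phi> \<longrightarrow> A \<in> sets \<mu> \<longrightarrow> A \<subseteq> U \<longrightarrow>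
        emeasure \<mu> A = emeasure harea (\<phi> ` A))"

definition finite_area :: "'a::metric_space set \<Rightarrow> bool" where
  "finite_area X \<longleftrightarrow> (\<exists>\<mu>. area_measure X \<mu> \<and> emeasure \<mu> X < \<infinity>)"

text \<open>
  The genus of an orientable surface, compact or not, is the largest number of pairwise disjoint
  simple closed curves along which it can be cut without becoming disconnected.
\<close>

definition cut_system :: "'a::topological_space set \<Rightarrow> 'a set set \<Rightarrow> bool" where
  "cut_system X \<C> \<longleftrightarrow>
     finite \<C> \<and> pairwise disjnt \<C> \<and>
     (\<forall>C\<in>\<C>. C \<subseteq> X \<and> (\<exists>c. simple_path c \<and> pathfinish c = pathstart c \<and> path_image c = C)) \<and>
     connected (X - \<Union>\<C>)"

definition has_genus :: "'a::topological_space set \<Rightarrow> nat \<Rightarrow> bool" where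
  "has_genus X g \<longleftrightarrow>
     (\<exists>\<C>. cut_system X \<C> \<and> card \<C> = g) \<and> (\<forall>\<C>. cut_system X \<C> \<longrightarrow> card \<C> \<le> g)"

text \<open>
  \<open>cusp_param X \<xi> \<psi>\<close> says that \<open>\<psi>\<close> descends to an isometry, in the Riemannian sense, from the
  quotient of \<open>{z. 1 \<le> Im z}\<close> by \<open>z \<mapsto> z + \<xi>\<close> onto its image: it is injective on the quotient
  and preserves distances locally. Global distances in \<open>X\<close> may be realised by paths that leave
  the image, so they are not compared.
\<close>

definition cusp_param :: "'a::metric_space set \<Rightarrow> real \<Rightarrow> (complex \<Rightarrow> 'a) \<Rightarrow> bool" where
  "cusp_param X \<xi> \<psi> \<longleftrightarrow>
     \<psi> ` {z. 1 \<le> Im z} \<subseteq> X \<and>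
     (\<forall>z w. 1 \<le> Im z \<longrightarrow> 1 \<le> Im w \<longrightarrow>
        (\<psi> z = \<psi> w \<longleftrightarrow> (\<exists>k::int. z - w = of_int k * of_real \<xi>))) \<and>
     (\<forall>z. 1 \<le> Im z \<longrightarrow> (\<exists>r>0. \<forall>u \<in> ball z r. \<forall>v \<in> ball z r.
        1 \<le> Im u \<longrightarrow> 1 \<le> Im v \<longrightarrow> dist (\<psi> u) (\<psi> v) = hdist u v))"

definition cusp_region :: "'a::metric_space set \<Rightarrow> real \<Rightarrow> 'a set \<Rightarrow> bool" where
  "cusp_region X \<xi> C \<longleftrightarrow> 0 < \<xi> \<and> (\<exists>\<psi>. cusp_param X \<xi> \<psi> \<and> C = \<psi> ` {z. 1 \<le> Im z})"

text \<open>
  The surface has \<open>n\<close> cusps if it is the union of a relatively compact set and \<open>n\<close> disjoint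
  cusp regions, of arbitrary areas.
\<close>

definition has_cusps :: "'a::metric_space set \<Rightarrow> nat \<Rightarrow> bool" where
  "has_cusps X n \<longleftrightarrow>
     (\<exists>\<C>. finite \<C> \<and> card \<C> = n \<and> pairwise disjnt \<C> \<and>
        (\<forall>C\<in>\<C>. \<exists>\<xi>. cusp_region X \<xi> C) \<and> compact (closure (X - \<Union>\<C>)))"

text \<open>
  The points of the moduli space are isometry classes. Here they are given by their
  representatives, and only properties that are invariant under isometry are used.
\<close>

definition moduli_space :: "nat \<Rightarrow> nat \<Rightarrow> 'a::metric_space set set" where
  "moduli_space g n =
     {X. hyperbolic_surface X \<and> complete X \<and> connected X \<and> orientable_surface X \<and>
         finite_area X \<and> has_genus X g \<and> has_cusps X n}"

definition truncated_surface :: "'a::metric_space set \<Rightarrow> real \<Rightarrow> 'a set" where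
  "truncated_surface X \<xi> = closure (X - \<Union>{C. cusp_region X \<xi> C})"

text \<open>
  Geodesic arcs are parametrised by arc length and may intersect themselves.
\<close>

definition geodesic_arc :: "'a::metric_space set \<Rightarrow> real \<Rightarrow> (real \<Rightarrow> 'a) \<Rightarrow> bool" where
  "geodesic_arc X L \<gamma> \<longleftrightarrow>
     0 < L \<and> \<gamma> ` {0..L} \<subseteq> X \<and>
     (\<forall>t\<in>{0..L}. \<exists>\<delta>>0. \<forall>s\<in>{0..L} \<inter> ball t \<delta>. \<forall>s'\<in>{0..L} \<inter> ball t \<delta>.
        dist (\<gamma> s) (\<gamma> s') = \<bar>s - s'\<bar>)"

text \<open>
  The upper half-plane metric is conformal to the Euclidean one, so the Euclidean inner product
  of the velocities in a chart decides orthogonality, independently of the chart.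
\<close>

definition perpendicular_at ::
    "'a::metric_space set \<Rightarrow> (real \<Rightarrow> 'a) \<Rightarrow> real set \<Rightarrow> real \<Rightarrow> (real \<Rightarrow> 'a) \<Rightarrow> real set \<Rightarrow> real \<Rightarrow> bool"
  where
  "perpendicular_at X \<alpha> I s \<beta> J t \<longleftrightarrow>
     \<alpha> s = \<beta> t \<and>
     (\<exists>U \<phi> v w. hyperbolic_chart X U \<phi> \<and> \<alpha> s \<in> U \<and>
        ((\<phi> \<circ> \<alpha>) has_vector_derivative v) (at s within I) \<and>
        ((\<phi> \<circ> \<beta>) has_vector_derivative w) (at t within J) \<and>
        v \<noteq> 0 \<and> w \<noteq> 0 \<and> v \<bullet> w = 0)"

text \<open>
  The boundary of the truncated surface consists of the horocycles \<open>x \<mapsto> \<psi> (x + \<i>)\<close>.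
  Only the endpoints of the arc are constrained: in between, it may enter the cusp regions.
\<close>

definition doubly_truncated_orthogeodesic ::
    "'a::metric_space set \<Rightarrow> real \<Rightarrow> real \<Rightarrow> (real \<Rightarrow> 'a) \<Rightarrow> bool" where
  "doubly_truncated_orthogeodesic X \<xi> L \<gamma> \<longleftrightarrow>
     geodesic_arc X L \<gamma> \<and>
     (\<forall>s\<in>{0, L}. \<exists>\<psi> t. cusp_param X \<xi> \<psi> \<and>
        perpendicular_at X \<gamma> {0..L} s (\<lambda>x. \<psi> (Complex x 1)) UNIV t)"

definition dense_within :: "real \<Rightarrow> 'a::metric_space set \<Rightarrow> 'a set \<Rightarrow> bool" where
  "dense_within \<epsilon> A Y \<longleftrightarrow> (\<forall>y\<in>Y. infdist y A \<le> \<epsilon>)"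

end

theory Submission
  imports Defs
begin

text \<open>
  Developing the surface from a cusp gives a locally isometric map from the upper half-plane
  onto it, for which the cusp sits at infinity. Two such maps, for the same or for different cusps,
  differ by an isometry of the half-plane. If this isometry exchanges infinity with real points
  \<open>r\<close> and \<open>b\<close> (a transition from the first cusp to the second one), then the vertical line above
  \<open>r\<close> runs from the first cusp into the second one. A transition may be composed with a translation
  by many periods of a cusp. A geodesic that follows a chain of transitions, with a translation of
  size about \<open>M\<close> at every cusp, stays at distance about \<open>1 / M\<close> from all their vertical lines, as
  in a continued fraction with large partial quotients, and every cusp costs the length \<open>2 ln M\<close>.

  As the complement of the cusps is compact, every interval of length \<open>\<epsilon>\<close> contains the
  point \<open>r\<close> of a transition of length at most \<open>2 ln (1 / \<epsilon>) + C\<close>. Hence about \<open>1 / \<epsilon>\<close> transitions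
  have vertical lines that are \<open>\<epsilon>\<close>-dense down to a fixed height, and it suffices to chain them
  with \<open>M\<close> polynomial in \<open>1 / \<epsilon>\<close> and \<open>1 / \<xi>\<close>.
\<close>

section \<open>The upper half-plane and its isometries\<close>

text \<open>Charts are only assumed to preserve distances, and no covering group is given. Rigidity
  takes its place: a distance-preserving map on a ball is the restriction of an isometry of the
  half-plane, so local isometries continue uniquely and two developing maps with a common value
  differ by an isometry.

  All arcs start and end at one cusp \<open>j0\<close>: every transition to be visited runs from
  some cusp \<open>i\<close> to \<open>j0\<close> and is preceded by its own inverse, which about
  doubles the cost. The length is read off a single number: composing transitions multiplies their
  \<open>a\<close> and divides by the square of each partial quotient, and the arc between the
  horocycles at height \<open>h\<close> has length \<open>ln (h\<^sup>2 / A)\<close> for the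
  composite \<open>A\<close>.

  For \<open>\<epsilon> > 1\<close> the term \<open>ln (1 / \<epsilon>)\<close> is negative. The
  hypothesis \<open>\<epsilon> \<le> 2 * ln (1 / \<xi>)\<close> keeps
  \<open>ln (1 / \<epsilon>) + ln (1 / \<xi>)\<close> at least \<open>1 - ln 2\<close>, so that
  additive constants can be absorbed into the factor \<open>D\<close>.\<close>

text \<open>This is \<open>2 * (cosh (hdist z w) - 1)\<close>. Being rational in the coordinates, it
  turns questions about distances into polynomial identities.\<close>

definition hq :: "complex \<Rightarrow> complex \<Rightarrow> real" where
  "hq z w = ((Re z - Re w)\<^sup>2 + (Im z - Im w)\<^sup>2) / (Im z * Im w)"

lemma hq_nonneg: "0 < Im z \<Longrightarrow> 0 < Im w \<Longrightarrow> 0 \<le> hq z w"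
  by (simp add: hq_def)

lemma hq_commute: "hq z w = hq w z"
  by (simp add: hq_def power2_commute mult.commute)

lemma hdist_eq_arcosh: "hdist z w = arcosh (1 + hq z w / 2)"
  by (simp add: hdist_def hq_def cmod_power2 mult.commute mult.left_commute)

lemma cosh_hdist: "0 < Im z \<Longrightarrow> 0 < Im w \<Longrightarrow> cosh (hdist z w) = 1 + hq z w / 2"
  using hq_nonneg[of z w] by (simp add: hdist_eq_arcosh)

lemma hdist_eq_iff:
  assumes "0 < Im z" "0 < Im w" "0 < Im z'" "0 < Im w'"
  shows "hdist z w = hdist z' w' \<longleftrightarrow> hq z w = hq z' w'"
proof
  assume "hdist z w = hdist z' w'"
  then have "1 + hq z w / 2 = 1 + hq z' w' / 2"
    using cosh_hdist[OF assms(1,2)] cosh_hdist[OF assms(3,4)] by metis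
  then show "hq z w = hq z' w'" by simp
next
  assume "hq z w = hq z' w'"
  then show "hdist z w = hdist z' w'" by (simp only: hdist_eq_arcosh)
qed

lemma hdist_nonneg: "0 < Im z \<Longrightarrow> 0 < Im w \<Longrightarrow> 0 \<le> hdist z w"
  using hq_nonneg[of z w] by (simp add: hdist_eq_arcosh)

lemma hdist_commute: "hdist z w = hdist w z"
  by (simp add: hdist_eq_arcosh hq_commute)

lemma hdist_eq_0_iff:
  assumes "0 < Im z" "0 < Im w"
  shows "hdist z w = 0 \<longleftrightarrow> z = w"
proof -
  have "hdist z w = 0 \<longleftrightarrow> hq z w = 0"
    using hq_nonneg[OF assms] by (simp add: hdist_eq_arcosh)
  also have "\<dots> \<longleftrightarrow> z = w"
    using assms by (auto simp: hq_def complex_eq_iff)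
  finally show ?thesis .
qed

lemma hdist_self [simp]: "hdist z z = 0"
  by (simp add: hdist_eq_arcosh hq_def)

text \<open>
  In the hyperboloid model this says that the Gram determinant of three vectors has the sign
  prescribed by the signature of the Lorentz form.
\<close>

lemma hq_gram_nonneg:
  assumes "0 < Im u" "0 < Im v" "0 < Im w"
  defines "A \<equiv> 1 + hq u v / 2" and "B \<equiv> 1 + hq v w / 2" and "C \<equiv> 1 + hq u w / 2"
  shows "(A * B - C)\<^sup>2 \<le> (A\<^sup>2 - 1) * (B\<^sup>2 - 1)"
proof -
  define x where "x z = Re z - Re v" for z
  define n where "n z = (x z)\<^sup>2 + (Im z)\<^sup>2" for z
  define p q where "p = n u - n v" and "q = n w - n v"
  define a where "a = n u + n v"
  define b where "b = n v + n w"
  define c where "c = n u + n w - 2 * x u * x w"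
  have nv: "n v = (Im v)\<^sup>2" by (simp add: n_def x_def)
  have A: "A = a / (2 * Im u * Im v)"
    using assms(1,2) by (simp add: A_def hq_def a_def n_def x_def field_simps power2_eq_square)
  have B: "B = b / (2 * Im v * Im w)"
    using assms(2,3) by (simp add: B_def hq_def b_def n_def x_def field_simps power2_eq_square)
  have C: "C = c / (2 * Im u * Im w)"
    using assms(1,3) by (simp add: C_def hq_def c_def n_def x_def field_simps power2_eq_square)
  have a2: "a\<^sup>2 - 4 * (Im u)\<^sup>2 * (Im v)\<^sup>2 = p\<^sup>2 + (2 * x u * Im v)\<^sup>2"
  proof -
    have "(Im u)\<^sup>2 = n u - (x u)\<^sup>2" by (simp add: n_def)
    then show ?thesis unfolding a_def p_def nv by algebra
  qed
  have b2: "b\<^sup>2 - 4 * (Im v)\<^sup>2 * (Im w)\<^sup>2 = q\<^sup>2 + (2 * x w * Im v)\<^sup>2"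
  proof -
    have "(Im w)\<^sup>2 = n w - (x w)\<^sup>2" by (simp add: n_def)
    then show ?thesis unfolding b_def q_def nv by algebra
  qed
  have c2: "a * b - 2 * (Im v)\<^sup>2 * c = p * q + (2 * x u * Im v) * (2 * x w * Im v)"
    unfolding a_def b_def c_def p_def q_def nv by algebra
  define y k where "y = 2 * x u * Im v" and "k = 2 * x w * Im v"
  have A2: "A\<^sup>2 - 1 = (p\<^sup>2 + y\<^sup>2) / (2 * Im u * Im v)\<^sup>2"
    using assms(1-3) unfolding A y_def a2[symmetric]
    by (simp add: power_divide diff_divide_distrib power_mult_distrib)
  have B2: "B\<^sup>2 - 1 = (q\<^sup>2 + k\<^sup>2) / (2 * Im v * Im w)\<^sup>2"
    using assms(1-3) unfolding B k_def b2[symmetric]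
    by (simp add: power_divide diff_divide_distrib power_mult_distrib)
  have C2: "A * B - C = (p * q + y * k) / ((2 * Im u * Im v) * (2 * Im v * Im w))"
    using assms(1-3) unfolding A B C y_def k_def c2[symmetric]
    by (simp add: diff_divide_distrib power2_eq_square)
  have "(p * q + y * k)\<^sup>2 \<le> (p\<^sup>2 + y\<^sup>2) * (q\<^sup>2 + k\<^sup>2)"
  proof -
    \<comment> \<open>Lagrange's identity: the bound is Cauchy-Schwarz for the pairs
      \<open>p, y\<close> and \<open>q, k\<close>.\<close>
    have "(p\<^sup>2 + y\<^sup>2) * (q\<^sup>2 + k\<^sup>2) - (p * q + y * k)\<^sup>2 = (p * k - y * q)\<^sup>2" by algebra
    then show ?thesis by (metis diff_ge_0_iff_ge zero_le_power2)
  qed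
  then show ?thesis
    unfolding A2 B2 C2 power_divide times_divide_times_eq power_mult_distrib[symmetric]
    by (rule divide_right_mono) simp
qed

text \<open>With \<open>A\<close>, \<open>B\<close>, \<open>C\<close> the hyperbolic cosines of the
  sides, the Gram inequality bounds \<open>C - A * B\<close> by the product of two
  \<open>sinh\<close>, and the addition theorem finishes.\<close>

lemma hdist_triangle:
  assumes "0 < Im u" "0 < Im v" "0 < Im w"
  shows "hdist u w \<le> hdist u v + hdist v w"
proof -
  define A where "A = 1 + hq u v / 2"
  define B where "B = 1 + hq v w / 2"
  define C where "C = 1 + hq u w / 2"
  have ge: "1 \<le> A" "1 \<le> B" "1 \<le> C"
    using assms hq_nonneg by (auto simp: A_def B_def C_def)
  have "C - A * B \<le> \<bar>A * B - C\<bar>" by simp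
  also have "\<dots> \<le> sqrt ((A\<^sup>2 - 1) * (B\<^sup>2 - 1))"
    using hq_gram_nonneg[OF assms] by (intro real_le_rsqrt) (simp add: A_def B_def C_def)
  also have "\<dots> = sinh (arcosh A) * sinh (arcosh B)"
    using ge by (simp add: sinh_arcosh_real real_sqrt_mult)
  finally have "C \<le> cosh (arcosh A + arcosh B)"
    using ge by (simp add: cosh_add)
  then have "cosh (arcosh C) \<le> cosh (arcosh A + arcosh B)"
    using ge by simp
  then have "arcosh C \<le> arcosh A + arcosh B"
    using ge by (subst (asm) cosh_real_nonneg_le_iff) auto
  then show ?thesis by (simp add: hdist_eq_arcosh A_def B_def C_def)
qed

lemma hdist_le_horizontal:
  assumes "0 < y"
  shows "hdist (Complex x y) (Complex x' y) \<le> \<bar>x - x'\<bar> / y"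
proof -
  define t where "t = \<bar>x - x'\<bar> / y"
  have t: "0 \<le> t" using assms by (simp add: t_def)
  have "1 + hq (Complex x y) (Complex x' y) / 2 = 1 + t\<^sup>2 / 2"
    using assms by (simp add: hq_def t_def power_divide power2_eq_square)
  also have "\<dots> \<le> cosh t"
  proof -
    have "cosh t - 1 = 2 * (sinh (t/2))\<^sup>2"
      using cosh_double[of "t/2"] cosh_square_eq[of "t/2"] by simp
    moreover have "t/2 \<le> sinh (t/2)" using t real_le_x_sinh[of "t/2"] by (simp add: sinh_def exp_minus)
    then have "(t/2)\<^sup>2 \<le> (sinh (t/2))\<^sup>2" using t by (intro power_mono) auto
    ultimately show ?thesis by (simp add: power_divide)
  qed
  finally have "cosh (hdist (Complex x y) (Complex x' y)) \<le> cosh t"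
    using assms by (simp add: cosh_hdist)
  then show ?thesis
    using t assms by (subst (asm) cosh_real_nonneg_le_iff) (auto simp: t_def hdist_nonneg)
qed

lemma hdist_vertical:
  assumes "0 < y" "0 < y'"
  shows "hdist (Complex x y) (Complex x y') = \<bar>ln y - ln y'\<bar>"
proof -
  define t where "t = \<bar>ln y - ln y'\<bar>"
  have "cosh t = cosh (ln y - ln y')" by (simp add: t_def abs_if minus_diff_eq flip: cosh_minus[of "ln y - ln y'"])
  also have "\<dots> = (y / y' + y' / y) / 2"
    using assms by (simp add: cosh_def exp_diff exp_minus flip: exp_minus)
  also have "\<dots> = 1 + hq (Complex x y) (Complex x y') / 2"
    using assms by (simp add: hq_def field_simps power2_eq_square)
  finally have "arcosh (cosh t) = hdist (Complex x y) (Complex x y')"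
    by (simp only: hdist_eq_arcosh)
  moreover have "arcosh (cosh t) = t" by (rule arcosh_cosh_real) (simp add: t_def)
  ultimately show ?thesis by (simp add: t_def)
qed

lemma continuous_on_hdist:
  assumes "continuous_on S f" "continuous_on S g" "\<And>x. x \<in> S \<Longrightarrow> 0 < Im (f x)" "\<And>x. x \<in> S \<Longrightarrow> 0 < Im (g x)"
  shows "continuous_on S (\<lambda>x. hdist (f x) (g x))"
proof -
  have "continuous_on S (\<lambda>x. 1 + hq (f x) (g x) / 2)"
    unfolding hq_def using assms(1,2) less_imp_neq[OF assms(3)] less_imp_neq[OF assms(4)]
    by (intro continuous_intros) auto
  then show ?thesis
    unfolding hdist_eq_arcosh
    by (rule continuous_on_compose2[OF continuous_on_arcosh[OF order.refl]]) (use hq_nonneg assms(3,4) in auto)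
qed

lemma hdist_small_imp_near:
  assumes u: "0 < Im u" and e: "0 < e"
  obtains d where "0 < d" "\<And>v. 0 < Im v \<Longrightarrow> hdist u v < d \<Longrightarrow> dist u v < e"
proof -
  define y where "y = Im u"
  \<comment> \<open>At Euclidean distance \<open>D\<close> from \<open>u\<close> the height is at
    most \<open>y + D\<close>, so \<open>hq\<close> is at least
    \<open>D\<^sup>2 / (y * (y + D))\<close>. This increases in \<open>D\<close>; the threshold uses
    its value at \<open>D = e\<close>.\<close>
  define d where "d = arcosh (1 + min 1 (e\<^sup>2 / (y * (y + e)))/ 2)"
  have y: "0 < y" using u by (simp add: y_def)
  have pos: "0 < min 1 (e\<^sup>2 / (y * (y + e)))" using y e by simp
  have "0 < d" unfolding d_def using pos by (simp add: less_imp_le add_pos_pos)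
  moreover have "dist u v < e" if v: "0 < Im v" and less: "hdist u v < d" for v
  proof (rule ccontr)
    assume "\<not> dist u v < e"
    then have ge: "e \<le> dist u v" by simp
    define D where "D = dist u v"
    have D: "0 < D" "e \<le> D" using ge e by (auto simp: D_def)
    have "Im v - y \<le> D" unfolding D_def y_def dist_norm
      using abs_Im_le_cmod[of "u - v"] by auto
    then have le: "Im v \<le> y + D" by simp
    have "hq u v = D\<^sup>2 / (y * Im v)"
      by (simp add: hq_def D_def y_def dist_norm cmod_power2)
    also have "\<dots> \<ge> D\<^sup>2 / (y * (y + D))"
      using le y v D by (intro divide_left_mono) auto
    finally have 1: "D\<^sup>2 / (y * (y + D)) \<le> hq u v" .
    have "e\<^sup>2 * (y + D) \<le> D\<^sup>2 * (y + e)"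
    proof -
      have "e * e * D \<le> D * e * D" using D e by (intro mult_right_mono) auto
      moreover have "e * e * y \<le> D * D * y" using D e y by (intro mult_right_mono mult_mono) auto
      ultimately show ?thesis by (simp add: power2_eq_square algebra_simps)
    qed
    then have "e\<^sup>2 / (y + e) \<le> D\<^sup>2 / (y + D)"
      using y e D by (simp add: divide_le_eq le_divide_eq mult.commute)
    then have "e\<^sup>2 / (y + e) / y \<le> D\<^sup>2 / (y + D) / y"
      using y by (intro divide_right_mono) auto
    then have "e\<^sup>2 / (y * (y + e)) \<le> D\<^sup>2 / (y * (y + D))"
      by (simp add: mult.commute)
    with 1 have "min 1 (e\<^sup>2 / (y * (y + e))) \<le> hq u v" by linarith
    moreover have "hq u v < min 1 (e\<^sup>2 / (y * (y + e)))"
    proof -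
      have "1 + hq u v / 2 < 1 + min 1 (e\<^sup>2 / (y * (y + e))) / 2"
        using less hq_nonneg[OF u v] pos unfolding d_def hdist_eq_arcosh
        by (subst (asm) arcosh_less_iff_real) auto
      then show ?thesis by simp
    qed
    ultimately show False by simp
  qed
  ultimately show ?thesis by (rule that)
qed

lemma near_imp_hdist_small:
  assumes u: "0 < Im u" and e: "0 < e"
  obtains d where "0 < d" "\<And>v. dist u v < d \<Longrightarrow> 0 < Im v \<and> hdist u v < e"
proof -
  have "continuous_on {v. 0 < Im v} (\<lambda>v. hdist u v)"
    using u by (intro continuous_on_hdist continuous_intros) auto
  moreover have "open {v. 0 < Im v}" by (simp add: open_halfspace_Im_gt)
  ultimately have "isCont (\<lambda>v. hdist u v) u"
    using u by (simp add: continuous_on_eq_continuous_at)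
  then obtain d1 where d1: "0 < d1" "\<And>v. dist v u < d1 \<Longrightarrow> \<bar>hdist u v\<bar> < e"
    using e unfolding continuous_at_eps_delta by (auto simp: dist_real_def)
  define d where "d = min d1 (Im u)"
  have "0 < d" using d1 u by (simp add: d_def)
  moreover have "0 < Im v \<and> hdist u v < e" if "dist u v < d" for v
  proof
    have "\<bar>Im u - Im v\<bar> \<le> dist u v" using abs_Im_le_cmod[of "u - v"] by (simp add: dist_norm)
    then show "0 < Im v" using that by (auto simp: d_def)
    show "hdist u v < e" using d1(2)[of v] that by (auto simp: d_def dist_commute)
  qed
  ultimately show ?thesis by (rule that)
qed

section \<open>Isometries of the half-plane in normal form, and their composition\<close>

definition hsim :: "real \<Rightarrow> real \<Rightarrow> real \<Rightarrow> complex \<Rightarrow> complex" where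
  "hsim s \<alpha> \<beta> z = Complex (\<beta> + s * \<alpha> * Re z) (\<alpha> * Im z)"

text \<open>
  \<open>hinv s a b r\<close> sends \<open>r\<close> to infinity and infinity to \<open>b\<close>, and the preimage of the horoball
  \<open>1 \<le> Im z\<close> is the horoball of Euclidean diameter \<open>a\<close> at \<open>r\<close>. It preserves the orientation for
  \<open>s = -1\<close> and reverses it for \<open>s = 1\<close>, while \<open>hsim s \<alpha> \<beta>\<close> preserves it for \<open>s = 1\<close>.
\<close>

definition hinv :: "real \<Rightarrow> real \<Rightarrow> real \<Rightarrow> real \<Rightarrow> complex \<Rightarrow> complex" where
  "hinv s a b r z =
     Complex (b + s * a * (Re z - r) / ((Re z - r)\<^sup>2 + (Im z)\<^sup>2)) (a * Im z / ((Re z - r)\<^sup>2 + (Im z)\<^sup>2))"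

text \<open>Isometries are sorted by whether they fix infinity, since this decides whether two
  coordinates see the same cusp there. Both signs \<open>s\<close> are kept, because a
  distance-preserving map may reverse the orientation.\<close>

definition hyp_iso :: "(complex \<Rightarrow> complex) set" where
  "hyp_iso = {hsim s \<alpha> \<beta> | s \<alpha> \<beta>. s\<^sup>2 = 1 \<and> 0 < \<alpha>} \<union> {hinv s a b r | s a b r. s\<^sup>2 = 1 \<and> 0 < a}"

lemma hsim_in_hyp_iso: "s\<^sup>2 = 1 \<Longrightarrow> 0 < \<alpha> \<Longrightarrow> hsim s \<alpha> \<beta> \<in> hyp_iso"
  unfolding hyp_iso_def by blast

lemma hinv_in_hyp_iso: "s\<^sup>2 = 1 \<Longrightarrow> 0 < a \<Longrightarrow> hinv s a b r \<in> hyp_iso"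
  unfolding hyp_iso_def by blast

lemma hyp_iso_cases [consumes 1, case_names sim inv]:
  assumes "m \<in> hyp_iso"
  obtains s \<alpha> \<beta> where "m = hsim s \<alpha> \<beta>" "s\<^sup>2 = 1" "0 < \<alpha>"
    | s a b r where "m = hinv s a b r" "s\<^sup>2 = 1" "0 < a"
  using assms unfolding hyp_iso_def by blast

lemma sq_sum_pos: "0 < (y::real) \<Longrightarrow> 0 < x\<^sup>2 + y\<^sup>2"
  by (simp add: add_nonneg_pos)

lemma Im_hsim [simp]: "Im (hsim s \<alpha> \<beta> z) = \<alpha> * Im z"
  and Re_hsim [simp]: "Re (hsim s \<alpha> \<beta> z) = \<beta> + s * \<alpha> * Re z"
  by (simp_all add: hsim_def)

lemma Im_hinv: "Im (hinv s a b r z) = a * Im z / ((Re z - r)\<^sup>2 + (Im z)\<^sup>2)"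
  and Re_hinv: "Re (hinv s a b r z) = b + s * a * (Re z - r) / ((Re z - r)\<^sup>2 + (Im z)\<^sup>2)"
  by (simp_all add: hinv_def)

lemma hyp_iso_Im_pos: "m \<in> hyp_iso \<Longrightarrow> 0 < Im z \<Longrightarrow> 0 < Im (m z)"
  by (cases m rule: hyp_iso_cases) (auto simp: Im_hinv sq_sum_pos)

lemma hq_hsim:
  assumes "s\<^sup>2 = 1" "0 < \<alpha>" "0 < Im z" "0 < Im w"
  shows "hq (hsim s \<alpha> \<beta> z) (hsim s \<alpha> \<beta> w) = hq z w"
proof -
  have "(s * \<alpha> * Re z - s * \<alpha> * Re w)\<^sup>2 = s\<^sup>2 * (\<alpha>\<^sup>2 * (Re z - Re w)\<^sup>2)" by algebra
  moreover have "(\<alpha> * Im z - \<alpha> * Im w)\<^sup>2 = \<alpha>\<^sup>2 * (Im z - Im w)\<^sup>2" by algebra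
  ultimately have "hq (hsim s \<alpha> \<beta> z) (hsim s \<alpha> \<beta> w) =
    (\<alpha>\<^sup>2 * ((Re z - Re w)\<^sup>2 + (Im z - Im w)\<^sup>2)) / (\<alpha>\<^sup>2 * (Im z * Im w))"
    by (simp add: hq_def assms(1) power2_eq_square[of \<alpha>] distrib_left mult.commute mult.left_commute)
  then show ?thesis using assms by (simp add: hq_def)
qed

lemma hq_hinv:
  assumes s: "s\<^sup>2 = 1" and a: "0 < a" and z: "0 < Im z" and w: "0 < Im w"
  shows "hq (hinv s a b r z) (hinv s a b r w) = hq z w"
proof -
  define x y x' y' where "x = Re z - r" and "y = Im z" and "x' = Re w - r" and "y' = Im w"
  define p q where "p = x\<^sup>2 + y\<^sup>2" and "q = x'\<^sup>2 + y'\<^sup>2"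
  have pq: "0 < p" "0 < q" "0 < y" "0 < y'"
    using z w by (auto simp: p_def q_def y_def y'_def sq_sum_pos)
  have 1: "(s * a * x / p - s * a * x' / q)\<^sup>2 + (a * y / p - a * y' / q)\<^sup>2
    = a\<^sup>2 / (p * q)\<^sup>2 * (s\<^sup>2 * (x * q - x' * p)\<^sup>2 + (y * q - y' * p)\<^sup>2)"
    using pq by (simp add: field_simps power2_eq_square)
  have 2: "(x * q - x' * p)\<^sup>2 + (y * q - y' * p)\<^sup>2 = p * q * ((x - x')\<^sup>2 + (y - y')\<^sup>2)"
    unfolding p_def q_def by algebra
  have "hq (hinv s a b r z) (hinv s a b r w) =
     ((s * a * x / p - s * a * x' / q)\<^sup>2 + (a * y / p - a * y' / q)\<^sup>2) / ((a * y / p) * (a * y' / q))"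
    by (simp add: hq_def Re_hinv Im_hinv x_def y_def x'_def y'_def p_def q_def)
  also have "\<dots> = ((x - x')\<^sup>2 + (y - y')\<^sup>2) / (y * y')"
    unfolding 1 s mult_1 2 using pq a by (simp add: field_simps power2_eq_square)
  also have "\<dots> = hq z w" by (simp add: hq_def x_def x'_def y_def y'_def)
  finally show ?thesis .
qed

lemma hdist_hyp_iso:
  assumes "m \<in> hyp_iso" "0 < Im z" "0 < Im w"
  shows "hdist (m z) (m w) = hdist z w"
  using assms by (cases m rule: hyp_iso_cases) (auto simp: hdist_eq_arcosh hq_hsim hq_hinv)

lemma hsim_hsim: "hsim s \<alpha> \<beta> (hsim s' \<alpha>' \<beta>' z) = hsim (s * s') (\<alpha> * \<alpha>') (\<beta> + s * \<alpha> * \<beta>') z"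
  by (simp add: hsim_def complex_eq_iff algebra_simps)

lemma hsim_hinv: "hsim s \<alpha> \<beta> (hinv s' a b r z) = hinv (s * s') (\<alpha> * a) (\<beta> + s * \<alpha> * b) r z"
  by (simp add: hsim_def hinv_def complex_eq_iff algebra_simps)

lemma hinv_hsim:
  assumes s': "s'\<^sup>2 = 1" and \<alpha>: "0 < \<alpha>" and z: "0 < Im z"
  shows "hinv s a b r (hsim s' \<alpha> \<beta> z) = hinv (s * s') (a / \<alpha>) b (s' * (r - \<beta>) / \<alpha>) z"
proof -
  define r' where "r' = s' * (r - \<beta>) / \<alpha>"
  define x where "x = Re z - r'"
  have "s' * s' = 1" using s' by (simp add: power2_eq_square)
  then have "\<beta> + s' * \<alpha> * Re z - r = s' * \<alpha> * (Re z - r')"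
    using \<alpha> unfolding r'_def by (simp add: field_simps)
  then have e: "\<beta> + s' * \<alpha> * Re z - r = s' * \<alpha> * x" by (simp add: x_def)
  have "(s' * \<alpha> * x)\<^sup>2 + (\<alpha> * Im z)\<^sup>2 = \<alpha>\<^sup>2 * (x\<^sup>2 + (Im z)\<^sup>2)"
    using s' by (simp add: power_mult_distrib algebra_simps)
  moreover have "0 < x\<^sup>2 + (Im z)\<^sup>2" using z by (rule sq_sum_pos)
  ultimately show ?thesis using \<alpha>
    by (simp add: complex_eq_iff Re_hinv Im_hinv e power2_eq_square flip: r'_def x_def)
qed

lemma hinv_hinv_same:
  assumes s: "s\<^sup>2 = 1" and z: "0 < Im z" and a: "0 < a"
  shows "hinv s' a' b' b (hinv s a b r z) = hsim (s * s') (a' / a) (b' - s * s' * (a' / a) * r) z"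
proof -
  define p where "p = (Re z - r)\<^sup>2 + (Im z)\<^sup>2"
  have p: "0 < p" using z by (simp add: p_def sq_sum_pos)
  have "(s * a * (Re z - r) / p)\<^sup>2 + (a * Im z / p)\<^sup>2 = a\<^sup>2 * (s\<^sup>2 * (Re z - r)\<^sup>2 + (Im z)\<^sup>2) / p\<^sup>2"
    using p by (simp add: field_simps power2_eq_square)
  also have "\<dots> = a\<^sup>2 * p / p\<^sup>2" unfolding s by (simp add: p_def)
  also have "\<dots> = a\<^sup>2 / p" using p by (simp add: power2_eq_square)
  finally have den: "(s * a * (Re z - r) / p)\<^sup>2 + (a * Im z / p)\<^sup>2 = a\<^sup>2 / p" .
  have Re: "Re (hinv s a b r z) - b = s * a * (Re z - r) / p"
    and Im: "Im (hinv s a b r z) = a * Im z / p"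
    by (simp_all add: Re_hinv Im_hinv p_def)
  show ?thesis
    unfolding complex_eq_iff Re_hinv[of s'] Im_hinv[of s'] Re Im den Re_hsim Im_hsim
    using p a by (simp add: field_simps power2_eq_square)
qed

text \<open>One step of a continued fraction with partial quotient \<open>b - r'\<close>: the new
  pole differs from \<open>r\<close> by \<open>s * a / (b - r')\<close>, and the factor
  \<open>1 / (b - r')\<^sup>2\<close> is what a large translation costs.\<close>

lemma hinv_hinv:
  assumes s: "s\<^sup>2 = 1" and s': "s'\<^sup>2 = 1" and z: "0 < Im z" and a: "0 < a" and ne: "b \<noteq> r'"
  shows "hinv s' a' b' r' (hinv s a b r z) =
    hinv (- s * s') (a * a' / (b - r')\<^sup>2) (b' + s' * a' / (b - r')) (r - s * a / (b - r')) z"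
proof -
  define D where "D = b - r'"
  define x y where "x = Re z - r" and "y = Im z"
  define p where "p = x\<^sup>2 + y\<^sup>2"
  define q where "q = (x + s * a / D)\<^sup>2 + y\<^sup>2"
  have D: "D \<noteq> 0" using ne by (simp add: D_def)
  have p: "0 < p" using z by (simp add: p_def y_def sq_sum_pos)
  have q: "0 < q" using z by (simp add: q_def y_def sq_sum_pos)
  have ss: "s * s = 1" using s by (simp add: power2_eq_square)
  have ss': "s' * s' = 1" using s' by (simp add: power2_eq_square)
  have q': "q = p + 2 * s * a * x / D + a\<^sup>2 / D\<^sup>2"
  proof -
    have "q = p + 2 * s * a * x / D + (s * s) * a\<^sup>2 / D\<^sup>2"
      unfolding q_def p_def using D by (simp add: field_simps power2_eq_square)
    then show ?thesis using ss by simp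
  qed
  \<comment> \<open>The squared distance of the image from the pole \<open>r'\<close> is a quotient
    of two such distances, so denominators of composed inversions multiply (the cocycle
    rule).\<close>
  have "(D + s * a * x / p)\<^sup>2 + (a * y / p)\<^sup>2 = D\<^sup>2 + 2 * D * s * a * x / p + a\<^sup>2 * ((s * s) * x\<^sup>2 + y\<^sup>2) / p\<^sup>2"
    using p by (simp add: field_simps power2_eq_square)
  also have "\<dots> = D\<^sup>2 + 2 * D * s * a * x / p + a\<^sup>2 * p / p\<^sup>2"
    unfolding ss by (simp add: p_def)
  also have "\<dots> = D\<^sup>2 + 2 * D * s * a * x / p + a\<^sup>2 / p"
    using p by (simp add: power2_eq_square)
  also have "\<dots> = D\<^sup>2 * q / p"
    unfolding q' using D p by (simp add: field_simps power2_eq_square)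
  finally have den: "(D + s * a * x / p)\<^sup>2 + (a * y / p)\<^sup>2 = D\<^sup>2 * q / p" .
  have e1: "Re (hinv s a b r z) - r' = D + s * a * x / p" "Im (hinv s a b r z) = a * y / p"
    by (auto simp: Re_hinv Im_hinv D_def x_def y_def p_def)
  have e2: "Re z - (r - s * a / (b - r')) = x + s * a / D" by (simp add: x_def D_def)
  have Im: "a' * (a * y / p) / (D\<^sup>2 * q / p) = a * a' / D\<^sup>2 * y / q"
    using D p q by (simp add: field_simps)
  have Re: "s' * a' * (D + s * a * x / p) / (D\<^sup>2 * q / p) =
     s' * a' / D + (- s * s') * (a * a' / D\<^sup>2) * (x + s * a / D) / q"
  proof -
    have "s' * a' * (D + s * a * x / p) / (D\<^sup>2 * q / p) = s' * a' * (D * p + s * a * x) / (D\<^sup>2 * q)"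
      using D p q by (simp add: field_simps)
    moreover have "s' * a' / D + (- s * s') * (a * a' / D\<^sup>2) * (x + s * a / D) / q =
      s' * a' * (D * q - s * a * x - (s * s) * a\<^sup>2 / D) / (D\<^sup>2 * q)"
      using D q by (simp add: field_simps power2_eq_square)
    moreover have "D * q - s * a * x - (s * s) * a\<^sup>2 / D = D * p + s * a * x"
      unfolding q' ss using D by (simp add: field_simps power2_eq_square)
    ultimately show ?thesis by simp
  qed
  show ?thesis
    unfolding complex_eq_iff Re_hinv[of s'] Im_hinv[of s'] Re_hinv[of "- s * s'"] Im_hinv[of "- s * s'"] e1 e2 den
    using Im Re by (simp add: D_def[symmetric] y_def[symmetric] q_def[symmetric])
qed

lemma hinv_inverse:
  assumes "s\<^sup>2 = 1" "0 < a" "0 < Im z"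
  shows "hinv s a r b (hinv s a b r z) = z"
  using assms(1,2)
  by (subst hinv_hinv_same[OF assms(1,3,2)]) (simp add: complex_eq_iff flip: power2_eq_square)



lemma hyp_iso_comp:
  assumes "m \<in> hyp_iso" "m' \<in> hyp_iso"
  obtains n where "n \<in> hyp_iso" "\<And>z. 0 < Im z \<Longrightarrow> n z = m (m' z)"
  using assms(1)
proof (cases rule: hyp_iso_cases)
  case 1: (sim s \<alpha> \<beta>)
  from assms(2) show ?thesis
  proof (cases rule: hyp_iso_cases)
    case (sim s' \<alpha>' \<beta>')
    show ?thesis
      by (rule that[of "hsim (s * s') (\<alpha> * \<alpha>') (\<beta> + s * \<alpha> * \<beta>')"])
        (use 1 sim in \<open>auto simp: hsim_hsim power_mult_distrib intro!: hsim_in_hyp_iso\<close>)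
  next
    case (inv s' a b r)
    show ?thesis
      by (rule that[of "hinv (s * s') (\<alpha> * a) (\<beta> + s * \<alpha> * b) r"])
        (use 1 inv in \<open>auto simp: hsim_hinv power_mult_distrib intro!: hinv_in_hyp_iso\<close>)
  qed
next
  case 1: (inv s' a' b' r')
  from assms(2) show ?thesis
  proof (cases rule: hyp_iso_cases)
    case (sim s \<alpha> \<beta>)
    show ?thesis
      by (rule that[of "hinv (s' * s) (a' / \<alpha>) b' (s * (r' - \<beta>) / \<alpha>)"])
        (use 1 sim in \<open>auto simp: hinv_hsim power_mult_distrib intro!: hinv_in_hyp_iso\<close>)
  next
    case (inv s a b r)
    show ?thesis
    proof (cases "b = r'")
      case True
      show ?thesis
        by (rule that[of "hsim (s * s') (a' / a) (b' - s * s' * (a' / a) * r)"])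
          (use 1 inv True in \<open>auto simp: hinv_hinv_same power_mult_distrib intro!: hsim_in_hyp_iso\<close>)
    next
      case False
      show ?thesis
        by (rule that[of "hinv (- s * s') (a * a' / (b - r')\<^sup>2) (b' + s' * a' / (b - r')) (r - s * a / (b - r'))"])
          (use 1 inv False in \<open>auto simp: hinv_hinv power_mult_distrib intro!: hinv_in_hyp_iso\<close>)
    qed
  qed
qed

lemma hyp_iso_inverse:
  assumes "m \<in> hyp_iso"
  obtains n where "n \<in> hyp_iso" "\<And>z. 0 < Im z \<Longrightarrow> n (m z) = z" "\<And>z. 0 < Im z \<Longrightarrow> m (n z) = z"
  using assms
proof (cases rule: hyp_iso_cases)
  case (sim s \<alpha> \<beta>)
  have ss: "s * s = 1" using sim(2) by (simp add: power2_eq_square)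
  have ss': "s * (s * x) = x" for x using ss by (metis mult.assoc mult_1)
  show ?thesis
    by (rule that[of "hsim s (1 / \<alpha>) (- s * \<beta> / \<alpha>)"])
      (use sim ss ss' in \<open>auto simp: hsim_hsim complex_eq_iff algebra_simps intro!: hsim_in_hyp_iso\<close>)
next
  case (inv s a b r)
  show ?thesis
    by (rule that[of "hinv s a r b"])
      (use inv in \<open>auto simp: hinv_inverse intro!: hinv_in_hyp_iso\<close>)
qed

section \<open>Rigidity: distance-preserving maps are restrictions of isometries\<close>

lemma hq_vertical_expand:
  assumes "0 < Im z" "0 < y"
  shows "hq z (Complex x y) = ((Re z - x)\<^sup>2 + (Im z)\<^sup>2) / Im z / y + y * (1 / Im z) - 2"
  using assms by (simp add: hq_def field_simps power2_eq_square)

text \<open>In the expansion \<open>A / y + y * B - 2\<close> the values at two heights determine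
  \<open>A\<close> and \<open>B\<close>, hence the height of the point and the square of its
  horizontal offset; only a reflection in the line remains.\<close>

lemma hq_vertical_pair:
  assumes y: "0 < y" "0 < y'" "y \<noteq> y'" and pos: "0 < Im z" "0 < Im w"
    and eq: "hq w (Complex x y) = hq z (Complex x y)" "hq w (Complex x y') = hq z (Complex x y')"
  shows "w = z \<or> w = Complex (2 * x - Re z) (Im z)"
proof -
  define A B where "A u = ((Re u - x)\<^sup>2 + (Im u)\<^sup>2) / Im u" and "B u = 1 / Im u" for u
  have 1: "A w / y + y * B w = A z / y + y * B z"
    using eq(1) y pos by (simp add: hq_vertical_expand A_def B_def)
  have 2: "A w / y' + y' * B w = A z / y' + y' * B z"
    using eq(2) y pos by (simp add: hq_vertical_expand A_def B_def)
  have "A w - A z + y\<^sup>2 * (B w - B z) = 0" "A w - A z + y'\<^sup>2 * (B w - B z) = 0"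
    using 1 2 y by (simp_all add: field_simps power2_eq_square)
  then have "(y\<^sup>2 - y'\<^sup>2) * (B w - B z) = 0" by (simp add: algebra_simps)
  moreover have "y\<^sup>2 - y'\<^sup>2 \<noteq> 0" using y by (simp add: power2_eq_iff)
  ultimately have B: "B w = B z" by simp
  then have A: "A w = A z" using 1 y by simp
  have Im: "Im w = Im z" using B pos by (simp add: B_def)
  then have "(Re w - x)\<^sup>2 = (Re z - x)\<^sup>2" using A pos by (simp add: A_def)
  then have "Re w = Re z \<or> Re w = 2 * x - Re z" by (auto simp: power2_eq_iff)
  with Im show ?thesis by (auto simp: complex_eq_iff)
qed

text \<open>The reflection that two points of a line leave open changes the distance to a point off
  the line, unless it fixes the given point.\<close>

lemma hq_three_points:
  assumes y: "0 < y" "0 < y'" "y \<noteq> y'" and pos: "0 < Im z" "0 < Im w" "0 < Im c" and c: "Re c \<noteq> x"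
    and eq: "hq w (Complex x y) = hq z (Complex x y)" "hq w (Complex x y') = hq z (Complex x y')"
      "hq w c = hq z c"
  shows "w = z"
proof (rule ccontr)
  assume ne: "w \<noteq> z"
  then have w: "w = Complex (2 * x - Re z) (Im z)"
    using hq_vertical_pair[OF y pos(1,2) eq(1,2)] by blast
  then have "(2 * x - Re z - Re c)\<^sup>2 = (Re z - Re c)\<^sup>2"
    using eq(3) pos by (simp add: hq_def)
  then have "2 * x - Re z = Re z"
    using c by (auto simp: power2_eq_iff)
  with w ne show False by (simp add: complex_eq_iff)
qed

lemma hyp_iso_to_vertical:
  assumes "0 < Im v" "0 < Im w"
  obtains n where "n \<in> hyp_iso" "Re (n v) = Re (n w)"
proof (cases "Re v = Re w")
  case True
  then show ?thesis by (intro that[of "hsim 1 1 0"]) (auto simp: hsim_in_hyp_iso)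
next
  case False
  \<comment> \<open>\<open>c\<close> and \<open>R\<close> are centre and radius of the half-circle
    through both points that is orthogonal to the real line. Inverting at its left end
    \<open>e\<close> opens it to a vertical line.\<close>
  define c where "c = ((Re w)\<^sup>2 + (Im w)\<^sup>2 - (Re v)\<^sup>2 - (Im v)\<^sup>2) / (2 * (Re w - Re v))"
  define R where "R = sqrt ((Re v - c)\<^sup>2 + (Im v)\<^sup>2)"
  define e where "e = c - R"
  have "2 * (Re w - Re v) * c = (Re w)\<^sup>2 + (Im w)\<^sup>2 - (Re v)\<^sup>2 - (Im v)\<^sup>2"
    using False by (simp add: c_def)
  then have eq: "(Re w - c)\<^sup>2 + (Im w)\<^sup>2 = (Re v - c)\<^sup>2 + (Im v)\<^sup>2"
    by (simp add: power2_eq_square algebra_simps)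
  have R2: "R\<^sup>2 = (Re v - c)\<^sup>2 + (Im v)\<^sup>2" by (simp add: R_def)
  have R: "0 < R" using assms(1) by (simp add: R_def sq_sum_pos)
  have "Re (hinv 1 1 0 e u) = 1 / (2 * R)" if "(Re u - c)\<^sup>2 + (Im u)\<^sup>2 = R\<^sup>2" "0 < Im u" for u
  proof -
    have den: "(Re u - e)\<^sup>2 + (Im u)\<^sup>2 = 2 * R * (Re u - e)"
      using that(1) by (simp add: e_def power2_eq_square algebra_simps)
    then have "0 < 2 * R * (Re u - e)" using sq_sum_pos[OF that(2), of "Re u - e"] by linarith
    then have "Re u - e \<noteq> 0" by auto
    then show ?thesis using R unfolding Re_hinv den by (simp add: field_simps)
  qed
  then show ?thesis
    using eq R2 assms by (intro that[of "hinv 1 1 0 e"]) (auto intro: hinv_in_hyp_iso)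
qed

text \<open>The logarithms of the heights differ by the same amount up to sign: equal signs call for
  a dilation, opposite signs for an inversion that swaps top and bottom.\<close>

lemma hyp_iso_vertical_pair:
  assumes y: "0 < y" "0 < y'" and v: "0 < v" "0 < v'"
    and eq: "hdist (Complex t v) (Complex t v') = hdist (Complex x y) (Complex x y')"
  obtains m where "m \<in> hyp_iso" "m (Complex x y) = Complex t v" "m (Complex x y') = Complex t v'"
proof -
  have "\<bar>ln v - ln v'\<bar> = \<bar>ln y - ln y'\<bar>"
    using eq y v by (simp add: hdist_vertical)
  then consider "ln v - ln v' = ln y - ln y'" | "ln v - ln v' = ln y' - ln y"
    by linarith
  then show ?thesis
  proof cases
    case 1
    then have "ln (v * y') = ln (v' * y)" using y v by (simp add: ln_mult)
    then have "v * y' = v' * y" using y v by simp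
    then show ?thesis
      using y v by (intro that[of "hsim 1 (v / y) (t - v / y * x)"])
        (auto simp: complex_eq_iff field_simps intro: hsim_in_hyp_iso)
  next
    case 2
    then have "ln (v * y) = ln (v' * y')" using y v by (simp add: ln_mult)
    then have "v * y = v' * y'" using y v by simp
    then show ?thesis
      using y v by (intro that[of "hinv 1 (v * y) t x"])
        (auto simp: complex_eq_iff Re_hinv Im_hinv field_simps power2_eq_square intro: hinv_in_hyp_iso)
  qed
qed

text \<open>Isometries of the half-plane move the images of two points on a vertical line back to
  where they were, a reflection repairs a third point off the line, and the distances to these three
  points then pin down every other point of the ball.\<close>

theorem hyp_rigidity:
  assumes r: "0 < r" and ball: "ball z0 r \<subseteq> {z. 0 < Im z}"
    and f: "\<And>u. u \<in> ball z0 r \<Longrightarrow> 0 < Im (f u)"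
    and iso: "\<And>u v. u \<in> ball z0 r \<Longrightarrow> v \<in> ball z0 r \<Longrightarrow> hdist (f u) (f v) = hdist u v"
  obtains m where "m \<in> hyp_iso" "\<And>u. u \<in> ball z0 r \<Longrightarrow> f u = m u"
proof -
  define x y where "x = Re z0" and "y = Im z0"
  define y' where "y' = y + r / 2"
  define z1 where "z1 = Complex x y'"
  define z2 where "z2 = Complex (x + r / 2) y"
  have z0: "z0 = Complex x y" by (simp add: x_def y_def)
  have in0: "z0 \<in> ball z0 r" using r by simp
  have in1: "z1 \<in> ball z0 r"
    using r by (simp add: z1_def z0 y'_def dist_norm cmod_def)
  have in2: "z2 \<in> ball z0 r"
    using r by (simp add: z2_def z0 dist_norm cmod_def)
  have pos: "0 < Im u" if "u \<in> ball z0 r" for u using that ball by auto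
  have y: "0 < y" "0 < y'" "y \<noteq> y'" using pos[OF in0] r by (auto simp: y_def y'_def)
  obtain n where n: "n \<in> hyp_iso" "Re (n (f z0)) = Re (n (f z1))"
    using hyp_iso_to_vertical f in0 in1 by metis
  define t v v' where "t = Re (n (f z0))" and "v = Im (n (f z0))" and "v' = Im (n (f z1))"
  have v: "0 < v" "0 < v'" using n(1) f in0 in1 by (auto simp: v_def v'_def hyp_iso_Im_pos)
  have nf0: "n (f z0) = Complex t v" by (simp add: t_def v_def)
  have nf1: "n (f z1) = Complex t v'" by (simp add: t_def v'_def n(2))
  have "hdist (Complex t v) (Complex t v') = hdist (Complex x y) (Complex x y')"
    using iso[OF in0 in1] hdist_hyp_iso[OF n(1) f[OF in0] f[OF in1]] nf0 nf1 z0 z1_def by simp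
  then obtain m where m: "m \<in> hyp_iso" "m z0 = n (f z0)" "m z1 = n (f z1)"
    using hyp_iso_vertical_pair[OF y(1,2) v] nf0 nf1 z0 z1_def by metis
  obtain m' where m': "m' \<in> hyp_iso" "\<And>z. 0 < Im z \<Longrightarrow> m' (m z) = z" "\<And>z. 0 < Im z \<Longrightarrow> m (m' z) = z"
    using hyp_iso_inverse[OF m(1)] by blast
  obtain n' where n': "n' \<in> hyp_iso" "\<And>z. 0 < Im z \<Longrightarrow> n' (n z) = z"
    using hyp_iso_inverse[OF n(1)] by metis
  define k where "k u = m' (n (f u))" for u
  have k_pos: "0 < Im (k u)" if "u \<in> ball z0 r" for u
    using that n(1) m'(1) f by (simp add: k_def hyp_iso_Im_pos)
  have k_iso: "hdist (k u) (k w) = hdist u w" if "u \<in> ball z0 r" "w \<in> ball z0 r" for u w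
    using that iso n(1) m'(1) f by (simp add: k_def hdist_hyp_iso hyp_iso_Im_pos)
  have k_hq: "hq (k u) (k w) = hq u w" if "u \<in> ball z0 r" "w \<in> ball z0 r" for u w
    using k_iso[OF that] that k_pos pos by (subst (asm) hdist_eq_iff) auto
  have k0: "k z0 = z0" and k1: "k z1 = z1"
    using m'(2) m(2,3) in0 in1 pos by (metis k_def)+
  have "k z2 = z2 \<or> k z2 = Complex (2 * x - Re z2) (Im z2)"
    using k_hq[OF in2 in0] k_hq[OF in2 in1] k0 k1 in2 k_pos pos
    by (intro hq_vertical_pair[OF y]) (auto simp: z0 z1_def)
  \<comment> \<open>The composite \<open>k\<close> fixes \<open>z0\<close> and \<open>z1\<close>, so
    it can only fix \<open>z2\<close> or reflect it in their line; \<open>\<rho>\<close> undoes the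
    latter.\<close>
  define \<rho> where "\<rho> = (if k z2 = z2 then hsim 1 1 0 else hsim (-1) 1 (2 * x))"
  have \<rho>: "\<rho> \<in> hyp_iso" "\<And>z. \<rho> (\<rho> z) = z" "\<rho> z0 = z0" "\<rho> z1 = z1"
    by (auto simp: \<rho>_def z0 z1_def complex_eq_iff hsim_in_hyp_iso)
  have \<rho>2: "\<rho> (k z2) = z2"
    using \<open>k z2 = z2 \<or> _\<close> by (auto simp: \<rho>_def complex_eq_iff)
  have k_\<rho>: "\<rho> (k u) = u" if u: "u \<in> ball z0 r" for u
  proof -
    have *: "hq (\<rho> (k u)) (\<rho> (k w)) = hq u w" if "w \<in> ball z0 r" for w
    proof -
      have "hdist (\<rho> (k u)) (\<rho> (k w)) = hdist u w"
        using that u k_iso k_pos \<rho>(1) by (simp add: hdist_hyp_iso)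
      then show ?thesis
        using that u k_pos pos \<rho>(1) by (subst (asm) hdist_eq_iff) (auto intro: hyp_iso_Im_pos)
    qed
    show ?thesis
    proof (rule hq_three_points[OF y])
      show "hq (\<rho> (k u)) (Complex x y) = hq u (Complex x y)" using *[OF in0] k0 \<rho>(3) z0 by simp
      show "hq (\<rho> (k u)) (Complex x y') = hq u (Complex x y')" using *[OF in1] k1 \<rho>(4) z1_def by simp
      show "hq (\<rho> (k u)) z2 = hq u z2" using *[OF in2] \<rho>2 by simp
      show "0 < Im (\<rho> (k u))" using k_pos[OF u] \<rho>(1) by (simp add: hyp_iso_Im_pos)
      show "0 < Im u" using pos u by simp
      show "0 < Im z2" using pos in2 by simp
      show "Re z2 \<noteq> x" using r by (simp add: z2_def)
    qed
  qed
  have f_eq: "f u = n' (m (\<rho> u))" if u: "u \<in> ball z0 r" for u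
  proof -
    have "k u = \<rho> u" using \<rho>(2) k_\<rho>[OF u] by metis
    then have "m (\<rho> u) = n (f u)" unfolding k_def using m'(3) n(1) f u by (metis hyp_iso_Im_pos)
    then show ?thesis using n'(2) f u by simp
  qed
  obtain g where g: "g \<in> hyp_iso" "\<And>z. 0 < Im z \<Longrightarrow> g z = m (\<rho> z)"
    using hyp_iso_comp[OF m(1) \<rho>(1)] by blast
  obtain h where h: "h \<in> hyp_iso" "\<And>z. 0 < Im z \<Longrightarrow> h z = n' (g z)"
    using hyp_iso_comp[OF n'(1) g(1)] by blast
  show ?thesis using h g f_eq pos by (intro that[of h]) auto
qed

text \<open>An inverse of \<open>m\<close> after \<open>m'\<close> fixes three points of the open
  set, two on a vertical line and one beside it, which is enough to fix everything.\<close>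

lemma hyp_iso_unique:
  assumes m: "m \<in> hyp_iso" and m': "m' \<in> hyp_iso" and O: "open A" "z0 \<in> A" "0 < Im z0"
    and eq: "\<And>u. u \<in> A \<Longrightarrow> 0 < Im u \<Longrightarrow> m u = m' u" and z: "0 < Im z"
  shows "m z = m' z"
proof -
  obtain r where r: "0 < r" "ball z0 r \<subseteq> A" using O openE by blast
  obtain n where n: "n \<in> hyp_iso" "\<And>z. 0 < Im z \<Longrightarrow> n (m z) = z" "\<And>z. 0 < Im z \<Longrightarrow> m (n z) = z"
    using hyp_iso_inverse[OF m] by blast
  define k where "k u = n (m' u)" for u
  have k_pos: "0 < Im (k u)" if "0 < Im u" for u
    using that n(1) m' by (simp add: k_def hyp_iso_Im_pos)
  have k_hq: "hq (k u) (k w) = hq u w" if "0 < Im u" "0 < Im w" for u w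
  proof -
    have "hdist (k u) (k w) = hdist u w" using that n(1) m' by (simp add: k_def hdist_hyp_iso hyp_iso_Im_pos)
    then show ?thesis using that k_pos by (subst (asm) hdist_eq_iff) auto
  qed
  have k_id: "k u = u" if "u \<in> ball z0 r" "0 < Im u" for u
    using that r eq[of u] n(2)[OF that(2)] by (auto simp: k_def subset_iff)
  define y where "y = Im z0"
  define z1 where "z1 = Complex (Re z0) (y + r / 2)"
  define z2 where "z2 = Complex (Re z0 + r / 2) y"
  have z0: "z0 = Complex (Re z0) y" by (simp add: y_def)
  have kz: "k z0 = z0" "k z1 = z1" "k z2 = z2"
    using r O(3) by (auto intro!: k_id simp: z1_def z2_def y_def dist_norm cmod_def)
  have "k z = z"
  proof (rule hq_three_points[of y "y + r / 2"])
    show "hq (k z) (Complex (Re z0) y) = hq z (Complex (Re z0) y)"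
      using k_hq[OF z, of z0] kz(1) O(3) z0 by simp
    show "hq (k z) (Complex (Re z0) (y + r / 2)) = hq z (Complex (Re z0) (y + r / 2))"
      using k_hq[OF z, of z1] kz(2) O(3) r(1) by (simp add: z1_def y_def)
    show "hq (k z) z2 = hq z z2"
      using k_hq[OF z, of z2] kz(3) O(3) by (simp add: z2_def y_def)
  qed (use O(3) r z k_pos in \<open>auto simp: z2_def y_def\<close>)
  then show ?thesis using n(3) m' z unfolding k_def by (metis hyp_iso_Im_pos)
qed

lemma continuous_on_hyp_iso:
  assumes "m \<in> hyp_iso"
  shows "continuous_on {z. 0 < Im z} m"
  using assms
proof (cases rule: hyp_iso_cases)
  case (sim s \<alpha> \<beta>)
  have "continuous_on {z. 0 < Im z} (\<lambda>z. Complex (\<beta> + s * \<alpha> * Re z) (\<alpha> * Im z))"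
    by (intro continuous_intros)
  then show ?thesis by (simp add: sim(1) hsim_def[abs_def])
next
  case (inv s a b r)
  have "(Re z - r)\<^sup>2 + (Im z)\<^sup>2 \<noteq> 0" if "0 < Im z" for z
    using sq_sum_pos[OF that, of "Re z - r"] by linarith
  then have "continuous_on {z. 0 < Im z} (\<lambda>z. Complex (b + s * a * (Re z - r) / ((Re z - r)\<^sup>2 + (Im z)\<^sup>2))
     (a * Im z / ((Re z - r)\<^sup>2 + (Im z)\<^sup>2)))"
    by (intro continuous_intros) auto
  then show ?thesis by (simp add: inv(1) hinv_def[abs_def])
qed

lemma open_hyp_iso_vimage:
  assumes "m \<in> hyp_iso" "open A"
  shows "open {z. 0 < Im z \<and> m z \<in> A}"
proof -
  have "open ({z. 0 < Im z} \<inter> m -` A)"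
    using continuous_on_hyp_iso[OF assms(1)] assms(2)
    by (intro continuous_open_preimage) (auto simp: open_halfspace_Im_gt)
  then show ?thesis by (simp add: vimage_def Int_def)
qed

lemma open_hyp_iso_image:
  assumes "m \<in> hyp_iso" "open A" "A \<subseteq> {z. 0 < Im z}"
  shows "open (m ` A)"
proof -
  obtain n where n: "n \<in> hyp_iso" "\<And>z. 0 < Im z \<Longrightarrow> n (m z) = z" "\<And>z. 0 < Im z \<Longrightarrow> m (n z) = z"
    using hyp_iso_inverse[OF assms(1)] by blast
  have "m ` A = {z. 0 < Im z \<and> n z \<in> A}"
  proof (intro set_eqI iffI)
    fix w assume "w \<in> m ` A"
    then show "w \<in> {z. 0 < Im z \<and> n z \<in> A}"
      using assms(1,3) n(2) by (auto intro: hyp_iso_Im_pos)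
  next
    fix w assume "w \<in> {z. 0 < Im z \<and> n z \<in> A}"
    then show "w \<in> m ` A" using n(3)[of w] by (auto intro!: image_eqI[of _ _ "n w"])
  qed
  then show ?thesis using open_hyp_iso_vimage[OF n(1) assms(2)] by simp
qed

section \<open>Local isometries into a hyperbolic surface\<close>

abbreviation above :: "real \<Rightarrow> complex set" where
  "above t \<equiv> {z. t < Im z}"

text \<open>Distances are compared only in small balls, because in the surface a long segment may be
  bypassed by a shortcut. Asking for \<open>ball z r \<subseteq> A\<close> makes \<open>A\<close>
  open.\<close>

definition local_isometry_on :: "complex set \<Rightarrow> (complex \<Rightarrow> 'a::metric_space) \<Rightarrow> bool" where
  "local_isometry_on A f \<longleftrightarrow>
     (\<forall>z\<in>A. \<exists>r>0. ball z r \<subseteq> A \<and> (\<forall>u\<in>ball z r. \<forall>v\<in>ball z r. dist (f u) (f v) = hdist u v))"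

lemma open_above: "open (above t)"
  by (simp add: open_halfspace_Im_gt)

lemma convex_above: "convex (above t)"
  by (simp add: convex_halfspace_Im_gt)

lemma local_isometry_onE:
  assumes "local_isometry_on A f" "z \<in> A"
  obtains r where "0 < r" "ball z r \<subseteq> A" "\<And>u v. u \<in> ball z r \<Longrightarrow> v \<in> ball z r \<Longrightarrow> dist (f u) (f v) = hdist u v"
  using assms unfolding local_isometry_on_def by blast



lemma local_isometry_on_subset:
  assumes f: "local_isometry_on A f" and B: "open B" "B \<subseteq> A"
  shows "local_isometry_on B f"
  unfolding local_isometry_on_def
proof
  fix z assume z: "z \<in> B"
  obtain r where r: "0 < r" "ball z r \<subseteq> A" "\<And>u v. u \<in> ball z r \<Longrightarrow> v \<in> ball z r \<Longrightarrow> dist (f u) (f v) = hdist u v"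
    using local_isometry_onE[OF f] z B by blast
  obtain r' where "0 < r'" "ball z r' \<subseteq> B" using B z openE by blast
  then show "\<exists>r>0. ball z r \<subseteq> B \<and> (\<forall>u\<in>ball z r. \<forall>v\<in>ball z r. dist (f u) (f v) = hdist u v)"
    using r by (intro exI[of _ "min r r'"]) auto
qed

lemma local_isometry_on_cong:
  assumes f: "local_isometry_on A f" and eq: "\<And>z. z \<in> A \<Longrightarrow> g z = f z"
  shows "local_isometry_on A g"
  unfolding local_isometry_on_def
proof
  fix z assume z: "z \<in> A"
  obtain r where r: "0 < r" "ball z r \<subseteq> A" "\<And>u v. u \<in> ball z r \<Longrightarrow> v \<in> ball z r \<Longrightarrow> dist (f u) (f v) = hdist u v"
    using local_isometry_onE[OF f z] by blast
  then show "\<exists>r>0. ball z r \<subseteq> A \<and> (\<forall>u\<in>ball z r. \<forall>v\<in>ball z r. dist (g u) (g v) = hdist u v)"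
    using eq by (intro exI[of _ r]) (auto simp: subset_iff)
qed

lemma continuous_on_local_isometry:
  assumes f: "local_isometry_on A f" and A: "A \<subseteq> above 0"
  shows "continuous_on A f"
  unfolding continuous_on_iff
proof (intro ballI allI impI)
  fix z e :: real and z0 assume z: "z0 \<in> A" and e: "0 < e"
  obtain r where r: "0 < r" "ball z0 r \<subseteq> A" "\<And>u v. u \<in> ball z0 r \<Longrightarrow> v \<in> ball z0 r \<Longrightarrow> dist (f u) (f v) = hdist u v"
    using local_isometry_onE[OF f z] by blast
  obtain d where d: "0 < d" "\<And>v. dist z0 v < d \<Longrightarrow> 0 < Im v \<and> hdist z0 v < e"
    using near_imp_hdist_small[of z0 e] z A e by auto
  show "\<exists>d>0. \<forall>x'\<in>A. dist x' z0 < d \<longrightarrow> dist (f x') (f z0) < e"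
  proof (intro exI[of _ "min r d"] conjI ballI impI)
    fix x assume x: "x \<in> A" "dist x z0 < min r d"
    then have "dist (f x) (f z0) = hdist x z0" using r by (simp add: dist_commute)
    also have "\<dots> < e" using d(2)[of x] x by (simp add: dist_commute hdist_commute[of x])
    finally show "dist (f x) (f z0) < e" .
  qed (use r d in simp)
qed

lemma local_isometry_on_comp:
  assumes f: "local_isometry_on B f" and m: "m \<in> hyp_iso"
  shows "local_isometry_on {z. 0 < Im z \<and> m z \<in> B} (\<lambda>z. f (m z))"
  unfolding local_isometry_on_def
proof
  let ?A = "{z. 0 < Im z \<and> m z \<in> B}"
  fix z assume z: "z \<in> ?A"
  obtain r where r: "0 < r" "ball (m z) r \<subseteq> B"
      "\<And>u v. u \<in> ball (m z) r \<Longrightarrow> v \<in> ball (m z) r \<Longrightarrow> dist (f u) (f v) = hdist u v"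
    using local_isometry_onE[OF f] z by blast
  have "open {w. 0 < Im w \<and> m w \<in> ball (m z) r}"
    by (rule open_hyp_iso_vimage[OF m]) simp
  moreover have "z \<in> {w. 0 < Im w \<and> m w \<in> ball (m z) r}" using z r(1) by simp
  ultimately obtain d where d: "0 < d" "ball z d \<subseteq> {w. 0 < Im w \<and> m w \<in> ball (m z) r}"
    using openE by blast
  have "dist (f (m u)) (f (m v)) = hdist u v" if "u \<in> ball z d" "v \<in> ball z d" for u v
  proof -
    have "0 < Im u" "m u \<in> ball (m z) r" "0 < Im v" "m v \<in> ball (m z) r"
      using that d(2) by auto
    then show ?thesis using r(3) hdist_hyp_iso[OF m] by simp
  qed
  moreover have "ball z d \<subseteq> ?A"
  proof
    fix u assume "u \<in> ball z d"
    then have "0 < Im u" "m u \<in> ball (m z) r" using d(2) by auto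
    then show "u \<in> ?A" using r(2) by blast
  qed
  ultimately show "\<exists>r>0. ball z r \<subseteq> ?A \<and> (\<forall>u\<in>ball z r. \<forall>v\<in>ball z r. dist (f (m u)) (f (m v)) = hdist u v)"
    using d(1) by blast
qed

lemma local_isometry_on_above_comp:
  assumes f: "local_isometry_on (above 0) f" and m: "m \<in> hyp_iso"
  shows "local_isometry_on (above 0) (\<lambda>z. f (m z))"
proof -
  have "{z. 0 < Im z \<and> m z \<in> above 0} = above 0"
    using hyp_iso_Im_pos[OF m] by auto
  then show ?thesis using local_isometry_on_comp[OF f m] by simp
qed

section \<open>Unique continuation and lifting of local isometries\<close>

text \<open>The inverse of a chart. The closed ball gives compactness later, and the radius
  \<open>e\<close> belongs to \<open>v\<close> alone, so it serves every local isometry whose values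
  come near \<open>v\<close>.\<close>

lemma surface_param:
  assumes X: "hyperbolic_surface X" and v: "v \<in> X"
  obtains w0 \<eta> \<tau> e where "0 < \<eta>" "0 < e" "cball w0 \<eta> \<subseteq> above 0" "\<tau> w0 = v" "\<tau> ` ball w0 \<eta> \<subseteq> X"
    "\<And>a b. a \<in> ball w0 \<eta> \<Longrightarrow> b \<in> ball w0 \<eta> \<Longrightarrow> dist (\<tau> a) (\<tau> b) = hdist a b"
    "X \<inter> ball v e \<subseteq> \<tau> ` ball w0 \<eta>"
proof -
  obtain U \<phi> where U: "hyperbolic_chart X U \<phi>" "v \<in> U"
    using X v unfolding hyperbolic_surface_def by blast
  have UX: "openin (top_of_set X) U" and im: "\<phi> ` U \<subseteq> above 0" "open (\<phi> ` U)"
    and iso: "\<And>x y. x \<in> U \<Longrightarrow> y \<in> U \<Longrightarrow> hdist (\<phi> x) (\<phi> y) = dist x y"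
    using U(1) by (auto simp: hyperbolic_chart_def upper_half_plane_def)
  have inj: "inj_on \<phi> U"
    by (rule inj_onI) (metis iso hdist_self dist_eq_0_iff)
  obtain \<eta> where \<eta>: "0 < \<eta>" "cball (\<phi> v) \<eta> \<subseteq> \<phi> ` U"
    using im(2) U(2) open_contains_cball by blast
  define \<tau> where "\<tau> = inv_into U \<phi>"
  have \<tau>: "\<tau> a \<in> U" "\<phi> (\<tau> a) = a" if "a \<in> ball (\<phi> v) \<eta>" for a
  proof -
    have "a \<in> \<phi> ` U" using that \<eta>(2) by (auto simp: subset_iff)
    then show "\<tau> a \<in> U" "\<phi> (\<tau> a) = a" by (auto simp: \<tau>_def inv_into_into f_inv_into_f)
  qed
  obtain d where d: "0 < d" "\<And>w. 0 < Im w \<Longrightarrow> hdist (\<phi> v) w < d \<Longrightarrow> dist (\<phi> v) w < \<eta>"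
    using hdist_small_imp_near[of "\<phi> v" \<eta>] \<eta>(1) im(1) U(2) by auto
  obtain e1 where e1: "0 < e1" "ball v e1 \<inter> X \<subseteq> U"
    using UX U(2) by (auto simp: openin_contains_ball)
  show ?thesis
  proof (rule that[of \<eta> "min e1 d" "\<phi> v" \<tau>])
    show "cball (\<phi> v) \<eta> \<subseteq> above 0" using \<eta> im by blast
    show "\<tau> (\<phi> v) = v" using inj U(2) by (simp add: \<tau>_def)
    show "\<tau> ` ball (\<phi> v) \<eta> \<subseteq> X" using \<tau>(1) openin_imp_subset[OF UX] by blast
    show "dist (\<tau> a) (\<tau> b) = hdist a b" if "a \<in> ball (\<phi> v) \<eta>" "b \<in> ball (\<phi> v) \<eta>" for a b
      using iso[of "\<tau> a" "\<tau> b"] \<tau> that by simp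
    show "X \<inter> ball v (min e1 d) \<subseteq> \<tau> ` ball (\<phi> v) \<eta>"
    proof
      fix x assume x: "x \<in> X \<inter> ball v (min e1 d)"
      then have xU: "x \<in> U" using e1 by auto
      then have "hdist (\<phi> v) (\<phi> x) < d" using x U(2) iso by simp
      then have "\<phi> x \<in> ball (\<phi> v) \<eta>" using d(2) im(1) xU by auto
      moreover have "\<tau> (\<phi> x) = x" using inj xU by (simp add: \<tau>_def)
      ultimately show "x \<in> \<tau> ` ball (\<phi> v) \<eta>" by (metis image_eqI)
    qed
  qed (use \<eta> d e1 in auto)
qed

text \<open>Following \<open>f\<close> by an inverse of the parametrisation gives a
  distance-preserving map between parts of the half-plane, to which rigidity applies. Only
  \<open>r\<close>, not \<open>e\<close>, depends on \<open>z\<close>.\<close>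

lemma local_isometry_factor:
  assumes W: "ball w0 \<eta> \<subseteq> above 0"
    and \<tau>: "\<And>a b. a \<in> ball w0 \<eta> \<Longrightarrow> b \<in> ball w0 \<eta> \<Longrightarrow> dist (\<tau> a) (\<tau> b) = hdist a b"
    and sub: "X \<inter> ball v e \<subseteq> \<tau> ` ball w0 \<eta>"
    and f: "local_isometry_on A f" "A \<subseteq> above 0" "f ` A \<subseteq> X" and z: "z \<in> A" "f z \<in> ball v e"
  obtains m r where "m \<in> hyp_iso" "0 < r" "ball z r \<subseteq> A"
    "\<And>u. u \<in> ball z r \<Longrightarrow> m u \<in> ball w0 \<eta>" "\<And>u. u \<in> ball z r \<Longrightarrow> f u = \<tau> (m u)"
proof -
  obtain r1 where r1: "0 < r1" "ball z r1 \<subseteq> A"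
      "\<And>u v. u \<in> ball z r1 \<Longrightarrow> v \<in> ball z r1 \<Longrightarrow> dist (f u) (f v) = hdist u v"
    using local_isometry_onE[OF f(1) z(1)] by blast
  have "0 < e - dist v (f z)" using z(2) by simp
  then obtain d where d: "0 < d" "\<And>u. dist z u < d \<Longrightarrow> 0 < Im u \<and> hdist z u < e - dist v (f z)"
    using near_imp_hdist_small[of z "e - dist v (f z)"] z(1) f(2) by auto
  define r where "r = min r1 d"
  have r: "0 < r" "ball z r \<subseteq> A" "ball z r \<subseteq> ball z r1" using r1 d by (auto simp: r_def)
  have near: "f u \<in> \<tau> ` ball w0 \<eta>" if u: "u \<in> ball z r" for u
  proof -
    have "dist (f z) (f u) = hdist z u" using u r r1 by auto
    then have "dist (f z) (f u) < e - dist v (f z)" using d(2)[of u] u by (simp add: r_def)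
    then have "f u \<in> ball v e" using dist_triangle[of v "f u" "f z"] by simp
    moreover have "f u \<in> X" using f(3) r(2) u by blast
    ultimately show ?thesis using sub by auto
  qed
  define g where "g u = inv_into (ball w0 \<eta>) \<tau> (f u)" for u
  have g: "g u \<in> ball w0 \<eta>" "\<tau> (g u) = f u" if "u \<in> ball z r" for u
    using near[OF that] by (auto simp: g_def inv_into_into f_inv_into_f simp del: mem_ball)
  obtain m where "m \<in> hyp_iso" "\<And>u. u \<in> ball z r \<Longrightarrow> g u = m u"
  proof (rule hyp_rigidity[OF r(1), of z g])
    show "ball z r \<subseteq> {z. 0 < Im z}" using r(2) f(2) by blast
    show "0 < Im (g u)" if "u \<in> ball z r" for u using g(1)[OF that] W by blast
    show "hdist (g u) (g u') = hdist u u'" if "u \<in> ball z r" "u' \<in> ball z r" for u u'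
    proof -
      have "hdist (g u) (g u') = dist (f u) (f u')" using g[OF that(1)] g[OF that(2)] \<tau> by metis
      then show ?thesis using r1(3) subsetD[OF r(3) that(1)] subsetD[OF r(3) that(2)] by simp
    qed
  qed blast
  then show ?thesis using g r by (intro that[of m r]) (metis+)
qed

text \<open>An open and closed argument: at a boundary point of the set of agreement both maps
  factor through the same parametrisation, and their two isometries coincide once they agree on some
  open set.\<close>

lemma local_isometry_unique:
  assumes X: "hyperbolic_surface X" and A: "open A" "connected A" "A \<subseteq> above 0"
    and f: "local_isometry_on A f" "f ` A \<subseteq> X" and g: "local_isometry_on A g" "g ` A \<subseteq> X"
    and B: "open B" "b \<in> B" "B \<subseteq> A" "\<And>z. z \<in> B \<Longrightarrow> f z = g z" and z: "z \<in> A"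
  shows "f z = g z"
proof -
  define S where "S = {z\<in>A. \<exists>r>0. ball z r \<subseteq> A \<and> (\<forall>u\<in>ball z r. f u = g u)}"
  have S_eq: "f u = g u" if "u \<in> S" for u
    using that by (auto simp: S_def)
  have "open S"
    unfolding open_contains_ball
  proof
    fix x assume "x \<in> S"
    then obtain r where r: "r > 0" "ball x r \<subseteq> A" "\<forall>u\<in>ball x r. f u = g u" by (auto simp: S_def)
    have "u \<in> S" if u: "u \<in> ball x r" for u
    proof -
      obtain d where "0 < d" "ball u d \<subseteq> ball x r" using u openE[OF open_ball] by blast
      then show ?thesis using r u unfolding S_def by blast
    qed
    then show "\<exists>e>0. ball x e \<subseteq> S" using r(1) by blast
  qed
  moreover have "open (A - S)"
    unfolding open_contains_ball
  proof
    fix x assume x: "x \<in> A - S"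
    show "\<exists>e>0. ball x e \<subseteq> A - S"
    proof (cases "f x = g x")
      case False
      have c: "continuous_on A (\<lambda>u. dist (f u) (g u))"
        using f(1) g(1) A(3) by (intro continuous_intros continuous_on_local_isometry)
      have "open (A \<inter> (\<lambda>u. dist (f u) (g u)) -` {0<..})"
        using c A(1) by (rule continuous_open_preimage) simp
      moreover have "x \<in> A \<inter> (\<lambda>u. dist (f u) (g u)) -` {0<..}" using x False by simp
      ultimately obtain e where "0 < e" "ball x e \<subseteq> A \<inter> (\<lambda>u. dist (f u) (g u)) -` {0<..}"
        by (meson openE)
      moreover have "A \<inter> (\<lambda>u. dist (f u) (g u)) -` {0<..} \<subseteq> A - S" using S_eq by auto
      ultimately show ?thesis by blast
    next
      case True
      have "f x \<in> X" using x f(2) by auto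
      then obtain w0 \<eta> \<tau> e where W: "0 < \<eta>" "0 < e" "cball w0 \<eta> \<subseteq> above 0" "\<tau> w0 = f x" "\<tau> ` ball w0 \<eta> \<subseteq> X"
        "\<And>a b. a \<in> ball w0 \<eta> \<Longrightarrow> b \<in> ball w0 \<eta> \<Longrightarrow> dist (\<tau> a) (\<tau> b) = hdist a b"
        "X \<inter> ball (f x) e \<subseteq> \<tau> ` ball w0 \<eta>"
        using surface_param[OF X] by metis
      have W': "ball w0 \<eta> \<subseteq> above 0" using W(3) ball_subset_cball by blast
      obtain m r where m: "m \<in> hyp_iso" "0 < r" "ball x r \<subseteq> A"
          "\<And>u. u \<in> ball x r \<Longrightarrow> m u \<in> ball w0 \<eta>" "\<And>u. u \<in> ball x r \<Longrightarrow> f u = \<tau> (m u)"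
        by (rule local_isometry_factor[OF W' W(6,7) f(1) A(3) f(2)]) (use x W in auto)
      obtain m' r' where m': "m' \<in> hyp_iso" "0 < r'" "ball x r' \<subseteq> A"
          "\<And>u. u \<in> ball x r' \<Longrightarrow> m' u \<in> ball w0 \<eta>" "\<And>u. u \<in> ball x r' \<Longrightarrow> g u = \<tau> (m' u)"
        by (rule local_isometry_factor[OF W' W(6,7) g(1) A(3) g(2)]) (use x W True in auto)
      define d where "d = min r r'"
      have d: "0 < d" "ball x d \<subseteq> ball x r" "ball x d \<subseteq> ball x r'" using m m' by (auto simp: d_def)
      have "ball x d \<inter> S = {}"
      proof (rule ccontr)
        assume "ball x d \<inter> S \<noteq> {}"
        then obtain s where s: "s \<in> ball x d" "s \<in> S" by blast
        have meq: "m u = m' u" if u: "u \<in> ball x d \<inter> S" for u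
        proof -
          have ur: "u \<in> ball x r" "u \<in> ball x r'" using u d by auto
          have "\<tau> (m u) = \<tau> (m' u)" using S_eq u m(5)[OF ur(1)] m'(5)[OF ur(2)] by auto
          then have "hdist (m u) (m' u) = 0" using W(6) m(4)[OF ur(1)] m'(4)[OF ur(2)] by (metis dist_self)
          moreover have "0 < Im (m u)" "0 < Im (m' u)" using m(4)[OF ur(1)] m'(4)[OF ur(2)] W' by auto
          ultimately show ?thesis by (simp add: hdist_eq_0_iff)
        qed
        have A0: "0 < Im s" using s(2) A(3) by (auto simp: S_def)
        have "f u = g u" if u: "u \<in> ball x d" for u
        proof -
          have ur: "u \<in> ball x r" "u \<in> ball x r'" using u d by auto
          have "m u = m' u"
            by (rule hyp_iso_unique[OF m(1) m'(1), of "ball x d \<inter> S" s])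
              (use s A0 \<open>open S\<close> meq ur(1) m(3) A(3) in auto)
          then show ?thesis using m(5)[OF ur(1)] m'(5)[OF ur(2)] by simp
        qed
        then have "x \<in> S" using x d m(3) unfolding S_def by blast
        then show False using x by simp
      qed
      then show ?thesis using d m(3) by blast
    qed
  qed
  moreover have "b \<in> S"
  proof -
    obtain r where "0 < r" "ball b r \<subseteq> B" using B openE by blast
    then show ?thesis using B unfolding S_def by blast
  qed
  ultimately have "A - S = {}"
    using connectedD[OF A(2), of S "A - S"] B(2,3) by (auto simp: S_def)
  then show ?thesis using z S_eq by blast
qed

text \<open>The substitute for deck transformations. Near \<open>z\<close> and \<open>w\<close> both
  maps factor through one parametrisation, which matches them by an isometry; unique continuation
  spreads the equation over the half-plane.\<close>

lemma local_isometry_lift: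
  assumes X: "hyperbolic_surface X"
    and p: "local_isometry_on (above 0) p" "p ` above 0 \<subseteq> X"
    and q: "local_isometry_on (above 0) q" "q ` above 0 \<subseteq> X"
    and z: "0 < Im z" "0 < Im w" "p z = q w"
  obtains m where "m \<in> hyp_iso" "m z = w" "\<And>u. 0 < Im u \<Longrightarrow> p u = q (m u)"
proof -
  have "p z \<in> X" using p(2) z(1) by auto
  then obtain w0 \<eta> \<tau> e where W: "0 < \<eta>" "0 < e" "cball w0 \<eta> \<subseteq> above 0" "\<tau> w0 = p z" "\<tau> ` ball w0 \<eta> \<subseteq> X"
    "\<And>a b. a \<in> ball w0 \<eta> \<Longrightarrow> b \<in> ball w0 \<eta> \<Longrightarrow> dist (\<tau> a) (\<tau> b) = hdist a b"
    "X \<inter> ball (p z) e \<subseteq> \<tau> ` ball w0 \<eta>"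
    using surface_param[OF X] by metis
  have W': "ball w0 \<eta> \<subseteq> above 0" using W(3) ball_subset_cball by blast
  have inj: "a = b" if "a \<in> ball w0 \<eta>" "b \<in> ball w0 \<eta>" "\<tau> a = \<tau> b" for a b
  proof -
    have "hdist a b = 0" using W(6)[OF that(1,2)] that(3) by simp
    then show ?thesis using that W' hdist_eq_0_iff[of a b] by blast
  qed
  obtain m r where m: "m \<in> hyp_iso" "0 < r" "ball z r \<subseteq> above 0"
      "\<And>u. u \<in> ball z r \<Longrightarrow> m u \<in> ball w0 \<eta>" "\<And>u. u \<in> ball z r \<Longrightarrow> p u = \<tau> (m u)"
    by (rule local_isometry_factor[OF W' W(6,7) p(1) _ p(2)]) (use z W in auto)
  obtain m' r' where m': "m' \<in> hyp_iso" "0 < r'" "ball w r' \<subseteq> above 0"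
      "\<And>u. u \<in> ball w r' \<Longrightarrow> m' u \<in> ball w0 \<eta>" "\<And>u. u \<in> ball w r' \<Longrightarrow> q u = \<tau> (m' u)"
    by (rule local_isometry_factor[OF W' W(6,7) q(1) _ q(2), of w]) (use z W in auto)
  obtain n where n: "n \<in> hyp_iso" "\<And>z. 0 < Im z \<Longrightarrow> n (m' z) = z" "\<And>z. 0 < Im z \<Longrightarrow> m' (n z) = z"
    using hyp_iso_inverse[OF m'(1)] by blast
  obtain k where k: "k \<in> hyp_iso" "\<And>z. 0 < Im z \<Longrightarrow> k z = n (m z)"
    using hyp_iso_comp[OF n(1) m(1)] by blast
  have "m z = m' w"
    using inj m(2,4,5) m'(2,4,5) z(3) centre_in_ball by metis
  then have kz: "k z = w" using k n z by simp
  define B where "B = {u. 0 < Im u \<and> k u \<in> ball w r'} \<inter> ball z r"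
  have "p u = q (k u)" if "0 < Im u" for u
  proof (rule local_isometry_unique[OF X open_above _ _ p local_isometry_on_above_comp[OF q(1) k(1)], of B z])
    show "connected (above 0)" using convex_above convex_connected by blast
    show "(\<lambda>z. q (k z)) ` above 0 \<subseteq> X" using q(2) hyp_iso_Im_pos[OF k(1)] by auto
    show "open B" unfolding B_def using open_hyp_iso_vimage[OF k(1)] by blast
    show "z \<in> B" using z kz m'(2) m(2) by (simp add: B_def)
    fix u assume u: "u \<in> B"
    then have *: "0 < Im u" "k u \<in> ball w r'" "u \<in> ball z r" by (auto simp: B_def)
    have "q (k u) = \<tau> (m' (n (m u)))" using m'(5)[OF *(2)] k(2)[OF *(1)] by simp
    also have "\<dots> = p u" using n(3) m(1,5) * by (simp add: hyp_iso_Im_pos)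
    finally show "p u = q (k u)" by simp
  qed (use that in \<open>auto simp: B_def\<close>)
  then show ?thesis using k kz that by blast
qed

section \<open>The covering property\<close>

text \<open>A single point over \<open>ball v e\<close> already yields a full sheet
  \<open>A\<close>, an isometric copy of the ball of the parametrisation, because the local equation
  \<open>p u = \<tau> (m u)\<close> continues over it. The closed ball bounds the heights on this
  sheet.\<close>

lemma local_isometry_cover:
  assumes X: "hyperbolic_surface X"
    and p: "local_isometry_on (above 0) p" "p ` above 0 \<subseteq> X" and v: "v \<in> X"
  obtains e where "0 < e"
    "\<And>z. 0 < Im z \<Longrightarrow> p z \<in> ball v e \<Longrightarrow> \<exists>y Y. 0 < y \<and> X \<inter> ball v e \<subseteq> p ` {u. y \<le> Im u \<and> Im u \<le> Y}"
proof -
  obtain w0 \<eta> \<tau> e where W: "0 < \<eta>" "0 < e" "cball w0 \<eta> \<subseteq> above 0" "\<tau> w0 = v" "\<tau> ` ball w0 \<eta> \<subseteq> X"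
    "\<And>a b. a \<in> ball w0 \<eta> \<Longrightarrow> b \<in> ball w0 \<eta> \<Longrightarrow> dist (\<tau> a) (\<tau> b) = hdist a b"
    "X \<inter> ball v e \<subseteq> \<tau> ` ball w0 \<eta>"
    using surface_param[OF X v] by metis
  have W': "ball w0 \<eta> \<subseteq> above 0" using W(3) ball_subset_cball by blast
  have "\<exists>y Y. 0 < y \<and> X \<inter> ball v e \<subseteq> p ` {u. y \<le> Im u \<and> Im u \<le> Y}" if z: "0 < Im z" "p z \<in> ball v e" for z
  proof -
    obtain m r where m: "m \<in> hyp_iso" "0 < r" "ball z r \<subseteq> above 0"
        "\<And>u. u \<in> ball z r \<Longrightarrow> m u \<in> ball w0 \<eta>" "\<And>u. u \<in> ball z r \<Longrightarrow> p u = \<tau> (m u)"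
      by (rule local_isometry_factor[OF W' W(6,7) p(1) _ p(2)]) (use z W in auto)
    obtain n where n: "n \<in> hyp_iso" "\<And>z. 0 < Im z \<Longrightarrow> n (m z) = z" "\<And>z. 0 < Im z \<Longrightarrow> m (n z) = z"
      using hyp_iso_inverse[OF m(1)] by blast
    define A where "A = {z. 0 < Im z \<and> m z \<in> ball w0 \<eta>}"
    have A: "A = n ` ball w0 \<eta>"
    proof (intro set_eqI iffI)
      fix u assume "u \<in> A"
      then show "u \<in> n ` ball w0 \<eta>" using n(2)[of u] by (auto simp: A_def intro!: image_eqI[of _ _ "m u"])
    next
      fix u assume "u \<in> n ` ball w0 \<eta>"
      then obtain b where "b \<in> ball w0 \<eta>" "u = n b" by blast
      then show "u \<in> A" using W' n by (auto simp: A_def hyp_iso_Im_pos subset_iff)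
    qed
    have cont: "continuous_on (cball w0 \<eta>) n"
      using continuous_on_hyp_iso[OF n(1)] W(3) continuous_on_subset by blast
    have conn: "connected A" unfolding A
      by (rule connected_continuous_image[OF continuous_on_subset[OF cont ball_subset_cball]])
        (simp add: convex_connected)
    have \<tau>l: "local_isometry_on (ball w0 \<eta>) \<tau>"
      unfolding local_isometry_on_def using W(6) by (metis openE open_ball subsetD)
    have peq: "p u = \<tau> (m u)" if "u \<in> A" for u
    proof (rule local_isometry_unique[OF X _ conn, of p "\<lambda>u. \<tau> (m u)" "ball z r" z])
      show "open A" unfolding A_def by (rule open_hyp_iso_vimage[OF m(1)]) simp
      then show "local_isometry_on A p" using local_isometry_on_subset[OF p(1)] by (auto simp: A_def)
      show "local_isometry_on A (\<lambda>u. \<tau> (m u))" unfolding A_def by (rule local_isometry_on_comp[OF \<tau>l m(1)])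
      show "ball z r \<subseteq> A" using m(3,4) by (auto simp: A_def)
    qed (use that m p W in \<open>auto simp: A_def\<close>)
    have "compact (Im ` n ` cball w0 \<eta>)" and ne: "Im ` n ` cball w0 \<eta> \<noteq> {}"
      using cont W(1) by (auto intro!: compact_continuous_image continuous_intros)
    then obtain y Y where y: "y \<in> Im ` n ` cball w0 \<eta>" "\<forall>t\<in>Im ` n ` cball w0 \<eta>. y \<le> t"
        "\<forall>t\<in>Im ` n ` cball w0 \<eta>. t \<le> Y"
      by (metis compact_attains_inf compact_attains_sup)
    have "0 < y" using y(1) W(3) hyp_iso_Im_pos[OF n(1)] by blast
    moreover have "X \<inter> ball v e \<subseteq> p ` {u. y \<le> Im u \<and> Im u \<le> Y}"
    proof
      fix x assume "x \<in> X \<inter> ball v e"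
      then obtain b where b: "b \<in> ball w0 \<eta>" "x = \<tau> b" using W(7) by blast
      have "n b \<in> A" using b A by blast
      moreover have "m (n b) = b" using n(3) b W' by auto
      ultimately have "p (n b) = x" using peq b by simp
      moreover have "b \<in> cball w0 \<eta>" using b ball_subset_cball by blast
      ultimately show "x \<in> p ` {u. y \<le> Im u \<and> Im u \<le> Y}" using y(2,3) by blast
    qed
    ultimately show ?thesis by blast
  qed
  then show ?thesis using W(2) that by blast
qed

text \<open>A suitable neighbourhood that meets the image lies in it, so the image and its
  complement are both open in \<open>X\<close>.\<close>

lemma local_isometry_surj:
  assumes X: "hyperbolic_surface X" "connected X"
    and p: "local_isometry_on (above 0) p" "p ` above 0 \<subseteq> X"
  shows "p ` above 0 = X"
proof -
  have "\<forall>v\<in>X. \<exists>e>0. (\<exists>z\<in>above 0. p z \<in> ball v e) \<longrightarrow> X \<inter> ball v e \<subseteq> p ` above 0"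
  proof
    fix v assume "v \<in> X"
    then obtain e where e: "0 < e"
      "\<And>z. 0 < Im z \<Longrightarrow> p z \<in> ball v e \<Longrightarrow> \<exists>y Y. 0 < y \<and> X \<inter> ball v e \<subseteq> p ` {u. y \<le> Im u \<and> Im u \<le> Y}"
      using local_isometry_cover[OF X(1) p] by metis
    have "X \<inter> ball v e \<subseteq> p ` above 0" if z: "z \<in> above 0" "p z \<in> ball v e" for z
    proof -
      obtain y Y where y: "0 < y" "X \<inter> ball v e \<subseteq> p ` {u. y \<le> Im u \<and> Im u \<le> Y}"
        using e(2) z by blast
      moreover have "{u. y \<le> Im u \<and> Im u \<le> Y} \<subseteq> above 0" using y(1) by auto
      ultimately show ?thesis by blast
    qed
    then show "\<exists>e>0. (\<exists>z\<in>above 0. p z \<in> ball v e) \<longrightarrow> X \<inter> ball v e \<subseteq> p ` above 0"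
      using e(1) by blast
  qed
  then obtain e where e: "\<And>v. v \<in> X \<Longrightarrow> 0 < e v"
    "\<And>v z. v \<in> X \<Longrightarrow> z \<in> above 0 \<Longrightarrow> p z \<in> ball v (e v) \<Longrightarrow> X \<inter> ball v (e v) \<subseteq> p ` above 0"
    by metis
  define S where "S = p ` above 0"
  define U V where "U = (\<Union>v\<in>S. ball v (e v))" and "V = (\<Union>v\<in>X - S. ball v (e v))"
  have SX: "S \<subseteq> X" using p(2) by (simp add: S_def)
  have U: "X \<inter> U \<subseteq> S"
  proof
    fix x assume "x \<in> X \<inter> U"
    then obtain z where z: "x \<in> X" "z \<in> above 0" "x \<in> ball (p z) (e (p z))"
      unfolding U_def S_def by blast
    then have "p z \<in> X" using p(2) by blast
    then have "X \<inter> ball (p z) (e (p z)) \<subseteq> S" using e(1)[of "p z"] e(2)[of "p z" z] z(2) by (simp add: S_def)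
    then show "x \<in> S" using z by blast
  qed
  have V: "S \<inter> V = {}"
  proof (rule ccontr)
    assume "S \<inter> V \<noteq> {}"
    then obtain z v where "z \<in> above 0" "v \<in> X - S" "p z \<in> ball v (e v)"
      unfolding V_def S_def by blast
    then have "X \<inter> ball v (e v) \<subseteq> S" "v \<in> X \<inter> ball v (e v)" using e by (auto simp: S_def)
    then show False using \<open>v \<in> X - S\<close> by blast
  qed
  have cov: "X \<subseteq> U \<union> V"
  proof
    fix x assume "x \<in> X"
    then have "x \<in> ball x (e x)" using e by simp
    then show "x \<in> U \<union> V" using \<open>x \<in> X\<close> unfolding U_def V_def by blast
  qed
  have "open U" "open V" by (auto simp: U_def V_def)
  then have "U \<inter> X = {} \<or> V \<inter> X = {}"
    using connectedD[OF X(2)] U V cov by blast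
  moreover have "p \<i> \<in> U \<inter> X"
  proof -
    have "p \<i> \<in> S" by (simp add: S_def)
    moreover from this have "p \<i> \<in> X" "p \<i> \<in> ball (p \<i>) (e (p \<i>))" using e(1) SX by auto
    ultimately show ?thesis unfolding U_def by blast
  qed
  ultimately have "V \<inter> X = {}" by blast
  then have "X \<subseteq> S" using U cov by blast
  then show ?thesis using SX by (simp add: S_def)
qed

lemma local_isometry_compact_cover:
  assumes X: "hyperbolic_surface X" "connected X"
    and p: "local_isometry_on (above 0) p" "p ` above 0 \<subseteq> X" and K: "compact K" "K \<subseteq> X"
  obtains y Y where "0 < y" "K \<subseteq> p ` {u. y \<le> Im u \<and> Im u \<le> Y}"
proof -
  have "\<forall>v\<in>X. \<exists>e y Y. 0 < e \<and> 0 < y \<and> X \<inter> ball v e \<subseteq> p ` {u. y \<le> Im u \<and> Im u \<le> Y}"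
  proof
    fix v assume v: "v \<in> X"
    then obtain e where e: "0 < e"
      "\<And>z. 0 < Im z \<Longrightarrow> p z \<in> ball v e \<Longrightarrow> \<exists>y Y. 0 < y \<and> X \<inter> ball v e \<subseteq> p ` {u. y \<le> Im u \<and> Im u \<le> Y}"
      using local_isometry_cover[OF X(1) p] by metis
    obtain z where "0 < Im z" "p z = v" using local_isometry_surj[OF X p] v by auto
    then have "\<exists>y Y. 0 < y \<and> X \<inter> ball v e \<subseteq> p ` {u. y \<le> Im u \<and> Im u \<le> Y}"
      using e(1) by (intro e(2)) auto
    then show "\<exists>e y Y. 0 < e \<and> 0 < y \<and> X \<inter> ball v e \<subseteq> p ` {u. y \<le> Im u \<and> Im u \<le> Y}"
      using e(1) by blast
  qed
  from bchoice[OF this] obtain e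
    where "\<forall>v\<in>X. \<exists>y Y. 0 < e v \<and> 0 < y \<and> X \<inter> ball v (e v) \<subseteq> p ` {u. y \<le> Im u \<and> Im u \<le> Y}" ..
  from bchoice[OF this] obtain y
    where "\<forall>v\<in>X. \<exists>Y. 0 < e v \<and> 0 < y v \<and> X \<inter> ball v (e v) \<subseteq> p ` {u. y v \<le> Im u \<and> Im u \<le> Y}" ..
  from bchoice[OF this] obtain Y
    where "\<forall>v\<in>X. 0 < e v \<and> 0 < y v \<and> X \<inter> ball v (e v) \<subseteq> p ` {u. y v \<le> Im u \<and> Im u \<le> Y v}" ..
  then have e: "\<And>v. v \<in> X \<Longrightarrow> 0 < e v" "\<And>v. v \<in> X \<Longrightarrow> 0 < y v"
    "\<And>v. v \<in> X \<Longrightarrow> X \<inter> ball v (e v) \<subseteq> p ` {u. y v \<le> Im u \<and> Im u \<le> Y v}"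
    by blast+
  obtain F where F: "F \<subseteq> K" "finite F" "K \<subseteq> (\<Union>v\<in>F. ball v (e v))"
  proof (rule compactE_image[OF K(1), of K "\<lambda>v. ball v (e v)"])
    show "K \<subseteq> (\<Union>c\<in>K. ball c (e c))" using K(2) e(1) by force
  qed auto
  define y0 Y0 where "y0 = Min (insert 1 (y ` F))" and "Y0 = Max (insert 1 (Y ` F))"
  have "0 < y0" unfolding y0_def using F K e(2) by (subst Min_gr_iff) auto
  moreover have "K \<subseteq> p ` {u. y0 \<le> Im u \<and> Im u \<le> Y0}"
  proof
    fix x assume x: "x \<in> K"
    then obtain v where v: "v \<in> F" "x \<in> ball v (e v)" using F by blast
    then obtain u where u: "x = p u" "y v \<le> Im u" "Im u \<le> Y v" using e(3)[of v] F K x by blast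
    have "y0 \<le> y v" "Y v \<le> Y0" unfolding y0_def Y0_def using F(2) v(1) by auto
    then show "x \<in> p ` {u. y0 \<le> Im u \<and> Im u \<le> Y0}" using u by auto
  qed
  ultimately show ?thesis using that by blast
qed

section \<open>Distances between the images of the ends of a segment\<close>

lemma locally_nonexpanding_imp_nonexpanding:
  fixes F :: "real \<Rightarrow> 'a::metric_space"
  assumes loc: "\<And>s. s \<in> {a..b} \<Longrightarrow> \<exists>d>0. \<forall>s'\<in>{a..b}. \<bar>s' - s\<bar> < d \<longrightarrow> dist (F s) (F s') \<le> C * \<bar>s - s'\<bar>"
    and C: "0 \<le> C" and ab: "a \<le> b"
  shows "dist (F a) (F b) \<le> C * (b - a)"
proof -
  have "C-lipschitz_on {a..b} F"
  proof (rule locally_lipschitz_imp_lipschitz)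
    have "continuous_on {a..b} F"
      unfolding continuous_on_iff
    proof (intro ballI allI impI)
      fix s e :: real assume s: "s \<in> {a..b}" and e: "0 < e"
      obtain d where d: "d > 0" "\<And>s'. s' \<in> {a..b} \<Longrightarrow> \<bar>s' - s\<bar> < d \<Longrightarrow> dist (F s) (F s') \<le> C * \<bar>s - s'\<bar>"
        using loc[OF s] by blast
      show "\<exists>d>0. \<forall>x'\<in>{a..b}. dist x' s < d \<longrightarrow> dist (F x') (F s) < e"
      proof (intro exI[of _ "min d (e / (C + 1))"] conjI ballI impI)
        fix s' assume s': "s' \<in> {a..b}" "dist s' s < min d (e / (C + 1))"
        then have "dist (F s') (F s) \<le> C * \<bar>s - s'\<bar>" using d(2)[of s'] by (simp add: dist_real_def dist_commute)
        also have "\<dots> \<le> C * (e / (C + 1))" using s' C by (intro mult_left_mono) (auto simp: dist_real_def)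
        also have "\<dots> < e" using C e by (simp add: field_simps)
        finally show "dist (F s') (F s) < e" .
      qed (use d e C in auto)
    qed
    then show "continuous_on {a..b} F" .
    fix x b' assume x: "x \<in> {a..<b}" and b': "x < b'"
    show "\<exists>y\<in>{x<..b'}. dist (F y) (F x) \<le> C * (y - x)"
    proof -
      obtain d where d: "d > 0" "\<And>s'. s' \<in> {a..b} \<Longrightarrow> \<bar>s' - x\<bar> < d \<Longrightarrow> dist (F x) (F s') \<le> C * \<bar>x - s'\<bar>"
        using loc[of x] x by auto
      define y where "y = min (min b b') (x + d / 2)"
      have "y \<in> {x<..b'}" "\<bar>y - x\<bar> < d" "y \<in> {a..b}" using x b' d(1) by (auto simp: y_def)
      then show ?thesis using d(2)[of y] by (intro bexI[of _ y]) (auto simp: dist_commute)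
    qed
  qed (use C in simp)
  then have "dist (F a) (F b) \<le> C * dist a b"
    using ab by (intro lipschitz_onD) auto
  then show ?thesis using ab by (simp add: dist_real_def)
qed

lemma dist_le_horizontal:
  assumes f: "local_isometry_on A f" and A: "A \<subseteq> above 0" and y: "0 < y" and xx: "x \<le> x'"
    and seg: "\<And>t. x \<le> t \<Longrightarrow> t \<le> x' \<Longrightarrow> Complex t y \<in> A"
  shows "dist (f (Complex x y)) (f (Complex x' y)) \<le> (x' - x) / y"
proof -
  have "dist (f (Complex x y)) (f (Complex x' y)) \<le> (1 / y) * (x' - x)"
  proof (rule locally_nonexpanding_imp_nonexpanding[of x x' "\<lambda>t. f (Complex t y)"])
    fix s assume s: "s \<in> {x..x'}"
    then obtain r where r: "0 < r" "ball (Complex s y) r \<subseteq> A"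
        "\<And>u v. u \<in> ball (Complex s y) r \<Longrightarrow> v \<in> ball (Complex s y) r \<Longrightarrow> dist (f u) (f v) = hdist u v"
      using local_isometry_onE[OF f] seg by auto
    have "dist (f (Complex s y)) (f (Complex s' y)) \<le> 1 / y * \<bar>s - s'\<bar>" if "\<bar>s' - s\<bar> < r" for s'
    proof -
      have "Complex s' y \<in> ball (Complex s y) r"
        using that by (simp add: dist_norm cmod_def abs_minus_commute)
      then have "dist (f (Complex s y)) (f (Complex s' y)) = hdist (Complex s y) (Complex s' y)"
        using r by simp
      then show ?thesis using hdist_le_horizontal[OF y, of s s'] by simp
    qed
    then show "\<exists>d>0. \<forall>s'\<in>{x..x'}. \<bar>s' - s\<bar> < d \<longrightarrow> dist (f (Complex s y)) (f (Complex s' y)) \<le> 1 / y * \<bar>s - s'\<bar>"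
      using r(1) by blast
  qed (use y xx in auto)
  then show ?thesis by simp
qed

lemma dist_le_vertical:
  assumes f: "local_isometry_on A f" and A: "A \<subseteq> above 0" and y: "0 < y" "y \<le> y'"
    and seg: "\<And>t. y \<le> t \<Longrightarrow> t \<le> y' \<Longrightarrow> Complex x t \<in> A"
  shows "dist (f (Complex x y)) (f (Complex x y')) \<le> ln y' - ln y"
proof -
  have "dist (f (Complex x (exp (ln y)))) (f (Complex x (exp (ln y')))) \<le> 1 * (ln y' - ln y)"
  proof (rule locally_nonexpanding_imp_nonexpanding[of "ln y" "ln y'" "\<lambda>t. f (Complex x (exp t))"])
    fix s assume s: "s \<in> {ln y..ln y'}"
    then have "exp (ln y) \<le> exp s" "exp s \<le> exp (ln y')" by auto
    then have "y \<le> exp s" "exp s \<le> y'" using y by auto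
    then have "Complex x (exp s) \<in> A" using seg by simp
    then obtain r where r: "0 < r" "ball (Complex x (exp s)) r \<subseteq> A"
        "\<And>u v. u \<in> ball (Complex x (exp s)) r \<Longrightarrow> v \<in> ball (Complex x (exp s)) r \<Longrightarrow> dist (f u) (f v) = hdist u v"
      using local_isometry_onE[OF f] by blast
    have "isCont exp s" by simp
    then obtain d where d: "0 < d" "\<And>s'. \<bar>s' - s\<bar> < d \<Longrightarrow> \<bar>exp s' - exp s\<bar> < r"
      using r(1) unfolding continuous_at_eps_delta by (auto simp: dist_real_def)
    have "dist (f (Complex x (exp s))) (f (Complex x (exp s'))) \<le> 1 * \<bar>s - s'\<bar>" if "\<bar>s' - s\<bar> < d" for s'
    proof -
      have "Complex x (exp s') \<in> ball (Complex x (exp s)) r"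
        using d(2)[OF that] by (simp add: dist_norm cmod_def abs_minus_commute)
      then have "dist (f (Complex x (exp s))) (f (Complex x (exp s'))) = hdist (Complex x (exp s)) (Complex x (exp s'))"
        using r by simp
      then show ?thesis by (simp add: hdist_vertical)
    qed
    then show "\<exists>d>0. \<forall>s'\<in>{ln y..ln y'}. \<bar>s' - s\<bar> < d \<longrightarrow>
        dist (f (Complex x (exp s))) (f (Complex x (exp s'))) \<le> 1 * \<bar>s - s'\<bar>"
      using d(1) by blast
  qed (use y in auto)
  then show ?thesis using y by simp
qed

section \<open>The developing map of a cusp\<close>

text \<open>Two discs centred on the line at height \<open>t\<close> that meet below it also meet
  above it, where the extensions to be glued are known to agree.\<close>

lemma reflect_upwards_in_balls:
  assumes "z \<in> ball (Complex x t) \<delta>" "z \<in> ball (Complex x' t) \<delta>'"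
  shows "Complex (Re z) (t + \<bar>Im z - t\<bar>) \<in> ball (Complex x t) \<delta> \<inter> ball (Complex x' t) \<delta>'"
  using assms power2_commute[of t "Im z"] by (simp add: dist_norm cmod_def)

text \<open>Completeness provides the value at the boundary point: down the vertical line the images
  form a Cauchy sequence, because \<open>ln (h n)\<close> converges. The map is then continued
  through a parametrisation at the limit \<open>v\<close>.\<close>

lemma local_isometry_extend_point:
  assumes X: "hyperbolic_surface X" "complete X" and t: "0 < t"
    and p: "local_isometry_on (above t) p" "p ` above t \<subseteq> X"
  obtains \<delta> f where "0 < \<delta>" "\<delta> \<le> t" "local_isometry_on (ball (Complex x t) \<delta>) f"
    "f ` ball (Complex x t) \<delta> \<subseteq> X" "\<And>z. z \<in> ball (Complex x t) \<delta> \<Longrightarrow> t < Im z \<Longrightarrow> f z = p z"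
proof -
  define h where "h n = t + t / real (Suc n)" for n
  define z where "z n = Complex x (h n)" for n
  have h: "t < h n" for n using t by (simp add: h_def)
  have h_lim: "h \<longlonglongrightarrow> t"
  proof -
    have "(\<lambda>n. t + t * (1 / real (Suc n))) \<longlonglongrightarrow> t + t * 0"
      by (intro tendsto_intros LIMSEQ_Suc lim_1_over_n)
    then show ?thesis by (simp add: h_def[abs_def])
  qed
  have "(\<lambda>n. ln (h n)) \<longlonglongrightarrow> ln t"
    using h_lim t by (intro tendsto_intros) auto
  then have lnC: "Cauchy (\<lambda>n. ln (h n))" by (rule LIMSEQ_imp_Cauchy)
  have above_t: "above t \<subseteq> above 0" using t by auto
  have dle: "dist (p (z m)) (p (z n)) \<le> \<bar>ln (h m) - ln (h n)\<bar>" for m n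
  proof -
    have *: "dist (p (z m)) (p (z n)) \<le> ln (h n) - ln (h m)" if "h m \<le> h n" for m n
      unfolding z_def using that h[of m] t
      by (intro dist_le_vertical[OF p(1) above_t]) auto
    show ?thesis using *[of m n] *[of n m] by (cases "h m \<le> h n") (auto simp: dist_commute)
  qed
  have pC: "Cauchy (\<lambda>n. p (z n))"
    unfolding Cauchy_def
  proof (intro allI impI)
    fix e :: real assume "0 < e"
    then obtain M where M: "\<forall>m\<ge>M. \<forall>n\<ge>M. dist (ln (h m)) (ln (h n)) < e"
      using lnC unfolding Cauchy_def by blast
    have "dist (p (z m)) (p (z n)) < e" if "M \<le> m" "M \<le> n" for m n
      using M that dle[of m n] by (metis dist_real_def le_less_trans)
    then show "\<exists>M. \<forall>m\<ge>M. \<forall>n\<ge>M. dist (p (z m)) (p (z n)) < e" by blast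
  qed
  have pX: "\<forall>n. p (z n) \<in> X" using p(2) h by (auto simp: z_def)
  obtain v where v: "v \<in> X" "(\<lambda>n. p (z n)) \<longlonglongrightarrow> v"
    by (rule completeE[OF X(2) pX pC]) 
  obtain w0 \<eta> \<tau> e where W: "0 < \<eta>" "0 < e" "cball w0 \<eta> \<subseteq> above 0" "\<tau> w0 = v" "\<tau> ` ball w0 \<eta> \<subseteq> X"
    "\<And>a b. a \<in> ball w0 \<eta> \<Longrightarrow> b \<in> ball w0 \<eta> \<Longrightarrow> dist (\<tau> a) (\<tau> b) = hdist a b"
    "X \<inter> ball v e \<subseteq> \<tau> ` ball w0 \<eta>"
    using surface_param[OF X(1) v(1)] by metis
  have W': "ball w0 \<eta> \<subseteq> above 0" using W(3) ball_subset_cball by blast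
  have w0: "0 < Im w0" "w0 \<in> ball w0 \<eta>" using W(1) subsetD[OF W', of w0] by auto
  obtain d where d: "0 < d" "\<And>u. 0 < Im u \<Longrightarrow> hdist w0 u < d \<Longrightarrow> dist w0 u < \<eta>"
    using hdist_small_imp_near[OF w0(1) W(1)] by blast
  \<comment> \<open>The three thirds of \<open>d\<close> are the distance from \<open>w0\<close> to
    the image of \<open>z n\<close> and the distances of \<open>z n\<close> and of \<open>u\<close>
    from the boundary point; together they keep \<open>m u\<close> in the ball of the
    parametrisation.\<close>
  obtain \<delta>0 where \<delta>0: "0 < \<delta>0" "\<And>u. dist (Complex x t) u < \<delta>0 \<Longrightarrow> 0 < Im u \<and> hdist (Complex x t) u < d / 3"
    using near_imp_hdist_small[of "Complex x t" "d / 3"] t d(1) by auto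
  define \<delta> where "\<delta> = min \<delta>0 t"
  define E where "E = ball (Complex x t) \<delta>"
  have \<delta>: "0 < \<delta>" "\<delta> \<le> t" using \<delta>0 t by (auto simp: \<delta>_def)
  have E: "0 < Im u" "hdist (Complex x t) u < d / 3" if "u \<in> E" for u
    using \<delta>0(2)[of u] that by (auto simp: E_def \<delta>_def)
  have "\<forall>\<^sub>F n in sequentially. dist (p (z n)) v < min e (d / 3)"
    using v(2) W(2) d(1) by (intro tendstoD) auto
  moreover have "\<forall>\<^sub>F n in sequentially. dist (h n) t < \<delta>"
    using h_lim \<delta>(1) by (rule tendstoD)
  ultimately have "\<forall>\<^sub>F n in sequentially. dist (p (z n)) v < min e (d / 3) \<and> dist (h n) t < \<delta>"
    by (rule eventually_conj)
  then obtain n where n: "dist (p (z n)) v < min e (d / 3)" "dist (h n) t < \<delta>"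
    by (auto simp: eventually_sequentially)
  have zn: "z n \<in> above t" "z n \<in> E"
    using h[of n] n(2) by (auto simp: z_def E_def dist_norm cmod_def dist_real_def abs_minus_commute)
  obtain m r where m: "m \<in> hyp_iso" "0 < r" "ball (z n) r \<subseteq> above t"
      "\<And>u. u \<in> ball (z n) r \<Longrightarrow> m u \<in> ball w0 \<eta>" "\<And>u. u \<in> ball (z n) r \<Longrightarrow> p u = \<tau> (m u)"
    by (rule local_isometry_factor[OF W' W(6,7) p(1) above_t p(2), of "z n"])
      (use n zn in \<open>auto simp: dist_commute\<close>)
  have zr: "z n \<in> ball (z n) r" using m(2) by simp
  have "hdist w0 (m (z n)) < d / 3"
  proof -
    have "dist (\<tau> w0) (\<tau> (m (z n))) < d / 3" using n(1) m(5)[OF zr] W(4) by (simp add: dist_commute)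
    then show ?thesis using W(6)[OF w0(2) m(4)[OF zr]] by simp
  qed
  then have mE: "m u \<in> ball w0 \<eta>" if u: "u \<in> E" for u
  proof -
    have pos: "0 < Im (m u)" "0 < Im (m (z n))" "0 < Im (z n)"
      using E u zn m(1) by (auto intro: hyp_iso_Im_pos)
    have "hdist w0 (m u) \<le> hdist w0 (m (z n)) + hdist (m (z n)) (m u)"
      using w0 pos by (intro hdist_triangle) auto
    also have "hdist (m (z n)) (m u) = hdist (z n) u"
      using m(1) pos E u by (simp add: hdist_hyp_iso)
    also have "hdist (z n) u \<le> hdist (z n) (Complex x t) + hdist (Complex x t) u"
      using pos E u t by (intro hdist_triangle) auto
    finally have "hdist w0 (m u) < d"
      using \<open>hdist w0 (m (z n)) < d / 3\<close> E(2)[OF u] E(2)[OF zn(2)] by (simp add: hdist_commute)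
    then show ?thesis using d(2) pos by simp
  qed
  have \<tau>l: "local_isometry_on (ball w0 \<eta>) \<tau>"
    unfolding local_isometry_on_def using W(6) by (metis openE open_ball subsetD)
  have fl: "local_isometry_on E (\<lambda>u. \<tau> (m u))"
    by (rule local_isometry_on_subset[OF local_isometry_on_comp[OF \<tau>l m(1)]])
      (use E mE in \<open>auto simp: E_def\<close>)
  have "\<tau> (m u) = p u" if u: "u \<in> E" "t < Im u" for u
  proof (rule local_isometry_unique[OF X(1), of "E \<inter> above t" _ _ "E \<inter> ball (z n) r" "z n"])
    show "open (E \<inter> above t)" by (simp add: E_def open_Int open_above)
    then show "local_isometry_on (E \<inter> above t) (\<lambda>u. \<tau> (m u))" "local_isometry_on (E \<inter> above t) p"
      using local_isometry_on_subset[OF fl] local_isometry_on_subset[OF p(1)] by auto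
    show "connected (E \<inter> above t)"
      by (intro convex_connected convex_Int convex_above) (simp add: E_def)
    show "(\<lambda>u. \<tau> (m u)) ` (E \<inter> above t) \<subseteq> X" using mE W(5) by blast
    show "open (E \<inter> ball (z n) r)" by (simp add: E_def open_Int)
    show "E \<inter> ball (z n) r \<subseteq> E \<inter> above t" using m(3) by blast
    show "\<tau> (m u) = p u" if "u \<in> E \<inter> ball (z n) r" for u using m(5) that by simp
  qed (use u zn zr p(2) t in auto)
  moreover have "(\<lambda>u. \<tau> (m u)) ` E \<subseteq> X" using mE W(5) by blast
  ultimately show ?thesis using that[OF \<delta>] fl unfolding E_def by blast
qed

lemma periodic_int:
  fixes p :: "complex \<Rightarrow> 'a"
  assumes "\<And>z. t < Im z \<Longrightarrow> p (z + of_real \<xi>) = p z" "t < Im z"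
  shows "p (z + of_int k * of_real \<xi>) = p z"
proof (induction k rule: int_induct[where k = 0])
  case (step1 i)
  then show ?case using assms(1)[of "z + of_int i * of_real \<xi>"] assms(2) by (simp add: algebra_simps)
next
  case (step2 i)
  then show ?case using assms(1)[of "z + of_int (i - 1) * of_real \<xi>"] assms(2) by (simp add: algebra_simps)
qed simp

lemma local_isometry_translate:
  assumes "local_isometry_on A f" "A \<subseteq> above 0"
  shows "local_isometry_on ((+) (of_real (- c)) ` A) (\<lambda>z. f (z + of_real c))"
proof -
  have "{z. 0 < Im z \<and> hsim 1 1 c z \<in> A} = (+) (of_real (- c)) ` A"
  proof (intro set_eqI iffI)
    fix z assume "z \<in> {z. 0 < Im z \<and> hsim 1 1 c z \<in> A}"
    moreover have "z = of_real (- c) + hsim 1 1 c z" by (simp add: complex_eq_iff)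
    ultimately show "z \<in> (+) (of_real (- c)) ` A" by blast
  next
    fix z assume "z \<in> (+) (of_real (- c)) ` A"
    then obtain w where "w \<in> A" "z = of_real (- c) + w" by blast
    moreover from this have "hsim 1 1 c z = w" by (simp add: complex_eq_iff)
    ultimately show "z \<in> {z. 0 < Im z \<and> hsim 1 1 c z \<in> A}" using assms(2) by auto
  qed
  moreover have "f (hsim 1 1 c z) = f (z + of_real c)" for z
    by (intro arg_cong[of _ _ f]) (simp add: complex_eq_iff)
  ultimately show ?thesis
    using local_isometry_on_comp[OF assms(1), of "hsim 1 1 c"] by (simp add: hsim_in_hyp_iso)
qed

text \<open>By periodicity the line at height \<open>t\<close> consists of translates of one compact
  segment, and a Lebesgue number of the discs found there serves all of it.\<close>

lemma local_isometry_extend_uniform: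
  assumes X: "hyperbolic_surface X" "complete X" and t: "0 < t" and \<xi>: "0 < \<xi>"
    and p: "local_isometry_on (above t) p" "p ` above t \<subseteq> X"
    and per: "\<And>z. t < Im z \<Longrightarrow> p (z + of_real \<xi>) = p z"
  obtains \<delta> where "0 < \<delta>" "\<delta> \<le> t" "\<And>x. \<exists>f. local_isometry_on (ball (Complex x t) \<delta>) f \<and>
    f ` ball (Complex x t) \<delta> \<subseteq> X \<and> (\<forall>z\<in>ball (Complex x t) \<delta>. t < Im z \<longrightarrow> f z = p z)"
proof -
  define ext where "ext A f \<longleftrightarrow> local_isometry_on A f \<and> f ` A \<subseteq> X \<and> (\<forall>z\<in>A. t < Im z \<longrightarrow> f z = p z)" for A f
  have "\<exists>\<delta>. 0 < \<delta> \<and> \<delta> \<le> t \<and> (\<exists>f. ext (ball (Complex x t) \<delta>) f)" for x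
    using local_isometry_extend_point[OF X t p, of x] unfolding ext_def by metis
  then obtain \<delta> where \<delta>: "\<And>x. 0 < \<delta> x" "\<And>x. \<delta> x \<le> t" "\<And>x. \<exists>f. ext (ball (Complex x t) (\<delta> x)) f"
    by metis
  define S where "S = (\<lambda>x. Complex x t) ` {0..\<xi>}"
  have cS: "compact S"
    unfolding S_def by (intro compact_continuous_image continuous_intros) auto
  have SU: "S \<subseteq> \<Union> ((\<lambda>x. ball (Complex x t) (\<delta> x)) ` UNIV)"
  proof
    fix w assume "w \<in> S"
    then obtain x where "w = Complex x t" by (auto simp: S_def)
    then have "w \<in> ball (Complex x t) (\<delta> x)" using \<delta>(1)[of x] by simp
    then show "w \<in> \<Union> ((\<lambda>x. ball (Complex x t) (\<delta> x)) ` UNIV)" by blast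
  qed
  obtain \<epsilon> where \<epsilon>: "0 < \<epsilon>" "\<And>z. z \<in> S \<Longrightarrow> \<exists>G\<in>(\<lambda>x. ball (Complex x t) (\<delta> x)) ` UNIV. ball z \<epsilon> \<subseteq> G"
    by (rule Heine_Borel_lemma[OF cS SU]) auto
  define \<delta>' where "\<delta>' = min \<epsilon> t"
  have "\<exists>f. ext (ball (Complex x t) \<delta>') f" for x
  proof -
    define k where "k = \<lfloor>x / \<xi>\<rfloor>"
    define c where "c = of_int k * \<xi>"
    have "c \<le> x" "x \<le> c + \<xi>"
      using floor_divide_lower[OF \<xi>, of x] floor_divide_upper[OF \<xi>, of x]
      by (auto simp: c_def k_def algebra_simps)
    then have "Complex (x - c) t \<in> S" by (auto simp: S_def)
    then obtain x' where x': "ball (Complex (x - c) t) \<epsilon> \<subseteq> ball (Complex x' t) (\<delta> x')"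
      using \<epsilon>(2) by blast
    obtain f where f: "ext (ball (Complex x' t) (\<delta> x')) f" using \<delta>(3) by blast
    let ?B = "ball (Complex (x - c) t) \<delta>'"
    have sub: "?B \<subseteq> ball (Complex x' t) (\<delta> x')" using x' by (auto simp: \<delta>'_def subset_iff)
    have fB: "local_isometry_on ?B f" "f ` ?B \<subseteq> X" "\<And>z. z \<in> ?B \<Longrightarrow> t < Im z \<Longrightarrow> f z = p z"
      using f sub local_isometry_on_subset[of _ f ?B] by (auto simp: ext_def)
    have B0: "?B \<subseteq> above 0"
    proof
      fix z assume "z \<in> ?B"
      then have "\<bar>t - Im z\<bar> < t"
        using abs_Im_le_cmod[of "Complex (x - c) t - z"] by (auto simp: dist_norm \<delta>'_def)
      then show "z \<in> above 0" by auto
    qed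
    have eq: "(+) (of_real c) ` ?B = ball (Complex x t) \<delta>'"
      by (subst image_add_ball) (simp add: complex_eq_iff Complex_eq)
    have "ext (ball (Complex x t) \<delta>') (\<lambda>z. f (z + of_real (- c)))"
      unfolding ext_def
    proof (intro conjI ballI impI)
      show "local_isometry_on (ball (Complex x t) \<delta>') (\<lambda>z. f (z + of_real (- c)))"
        using local_isometry_translate[OF fB(1) B0, of "- c"] eq by simp
      show "(\<lambda>z. f (z + of_real (- c))) ` ball (Complex x t) \<delta>' \<subseteq> X"
      proof
        fix w assume "w \<in> (\<lambda>z. f (z + of_real (- c))) ` ball (Complex x t) \<delta>'"
        then obtain z where z: "z \<in> (+) (of_real c) ` ?B" "w = f (z + of_real (- c))"
          unfolding eq by blast
        then have "z + of_real (- c) \<in> ?B" by (auto simp del: image_add_ball)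
        then show "w \<in> X" using fB(2) z(2) by blast
      qed
      fix z assume z: "z \<in> ball (Complex x t) \<delta>'" "t < Im z"
      then have "z + of_real (- c) \<in> ?B" unfolding eq[symmetric] by (auto simp del: image_add_ball)
      then have "f (z + of_real (- c)) = p (z + of_real (- c))" using fB(3) z by simp
      also have "\<dots> = p z"
        using periodic_int[of t p \<xi> z "- k"] per z(2) by (simp add: c_def)
      finally show "f (z + of_real (- c)) = p z" .
    qed
    then show ?thesis by blast
  qed
  then show ?thesis
    using \<epsilon>(1) t unfolding ext_def by (intro that[of \<delta>']) (auto simp: \<delta>'_def)
qed

text \<open>Gluing: two discs that meet also meet above height \<open>t\<close>, where both
  extensions equal \<open>p\<close>, so unique continuation makes them agree on the overlap.\<close>

lemma local_isometry_extend:
  assumes X: "hyperbolic_surface X" "complete X" and t: "0 < t" and \<xi>: "0 < \<xi>"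
    and p: "local_isometry_on (above t) p" "p ` above t \<subseteq> X"
    and per: "\<And>z. t < Im z \<Longrightarrow> p (z + of_real \<xi>) = p z"
  obtains t' p' where "0 \<le> t'" "t' < t" "local_isometry_on (above t') p'" "p' ` above t' \<subseteq> X"
    "\<And>z. t < Im z \<Longrightarrow> p' z = p z"
proof -
  obtain \<delta> where \<delta>: "0 < \<delta>" "\<delta> \<le> t" "\<And>x. \<exists>f. local_isometry_on (ball (Complex x t) \<delta>) f \<and>
    f ` ball (Complex x t) \<delta> \<subseteq> X \<and> (\<forall>z\<in>ball (Complex x t) \<delta>. t < Im z \<longrightarrow> f z = p z)"
    using local_isometry_extend_uniform[OF assms] by blast
  then obtain f where f: "\<And>x. local_isometry_on (ball (Complex x t) \<delta>) (f x)"
    "\<And>x. f x ` ball (Complex x t) \<delta> \<subseteq> X"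
    "\<And>x z. z \<in> ball (Complex x t) \<delta> \<Longrightarrow> t < Im z \<Longrightarrow> f x z = p z"
    by metis
  have B0: "ball (Complex x t) \<delta> \<subseteq> above 0" for x
  proof
    fix z assume "z \<in> ball (Complex x t) \<delta>"
    then have "\<bar>t - Im z\<bar> < t"
      using abs_Im_le_cmod[of "Complex x t - z"] \<delta>(2) by (auto simp: dist_norm)
    then show "z \<in> above 0" by auto
  qed
  have agree: "f x z = f x' z"
    if z: "z \<in> ball (Complex x t) \<delta>" "z \<in> ball (Complex x' t) \<delta>" for x x' z
  proof -
    let ?A = "ball (Complex x t) \<delta> \<inter> ball (Complex x' t) \<delta>"
    have op: "open ?A" by (intro open_Int open_ball)
    show ?thesis
    proof (cases "Im z = t")
      case False
      show ?thesis
      proof (rule local_isometry_unique[OF X(1) op, of "f x" "f x'" "?A \<inter> above t" "Complex (Re z) (t + \<bar>Im z - t\<bar>)"])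
        show "connected ?A" by (intro convex_connected convex_Int) auto
        show "local_isometry_on ?A (f x)" "local_isometry_on ?A (f x')"
          using f(1) op by (auto intro: local_isometry_on_subset)
        show "open (?A \<inter> above t)" by (simp add: open_Int open_above)
        show "Complex (Re z) (t + \<bar>Im z - t\<bar>) \<in> ?A \<inter> above t"
          using reflect_upwards_in_balls[OF z] False by auto
        show "?A \<subseteq> above 0" using B0[of x] by blast
      qed (use z f(2,3) in auto)
    next
      case True
      \<comment> \<open>A point on the line is its own reflection, so a nearby higher point of the
        overlap is used instead.\<close>
      obtain d where d: "0 < d" "ball z d \<subseteq> ?A" using op z by (meson IntI openE)
      show ?thesis
      proof (rule local_isometry_unique[OF X(1) op, of "f x" "f x'" "?A \<inter> above t" "z + Complex 0 (d / 2)"])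
        show "connected ?A" by (intro convex_connected convex_Int) auto
        show "local_isometry_on ?A (f x)" "local_isometry_on ?A (f x')"
          using f(1) op by (auto intro: local_isometry_on_subset)
        show "open (?A \<inter> above t)" by (simp add: open_Int open_above)
        have "z + Complex 0 (d / 2) \<in> ball z d" using d(1) by (simp add: dist_norm cmod_def)
        then show "z + Complex 0 (d / 2) \<in> ?A \<inter> above t" using d True by auto
        show "?A \<subseteq> above 0" using B0[of x] by blast
      qed (use z f(2,3) in auto)
    qed
  qed
  define p' where "p' z = (if t < Im z then p z else f (Re z) z)" for z
  have p'_eq: "p' w = f x w" if "w \<in> ball (Complex x t) \<delta>" "w \<in> above (t - \<delta>)" for x w
  proof (cases "t < Im w")
    case True
    then show ?thesis using f(3) that by (simp add: p'_def)
  next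
    case False
    then have "w \<in> ball (Complex (Re w) t) \<delta>" using that(2) by (auto simp: dist_norm cmod_def)
    then show ?thesis using agree[OF _ that(1)] False by (simp add: p'_def)
  qed
  have loc: "\<exists>r>0. ball z r \<subseteq> above (t - \<delta>) \<and> (\<forall>u\<in>ball z r. \<forall>v\<in>ball z r. dist (p' u) (p' v) = hdist u v)
      \<and> p' z \<in> X" if z: "z \<in> above (t - \<delta>)" for z
  proof (cases "t < Im z")
    case True
    then obtain r where r: "0 < r" "ball z r \<subseteq> above t" "\<And>u v. u \<in> ball z r \<Longrightarrow> v \<in> ball z r \<Longrightarrow> dist (p u) (p v) = hdist u v"
      using local_isometry_onE[OF p(1), of z] by auto
    moreover have "p' u = p u" if "u \<in> ball z r" for u using that r(2) by (auto simp: p'_def)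
    moreover have "above t \<subseteq> above (t - \<delta>)" using \<delta> by auto
    moreover have "p z \<in> X" using True p(2) by auto
    ultimately show ?thesis using True by (intro exI[of _ r]) (auto simp: p'_def)
  next
    case False
    let ?A = "ball (Complex (Re z) t) \<delta> \<inter> above (t - \<delta>)"
    have zA: "z \<in> ?A" using z False by (auto simp: dist_norm cmod_def)
    have "local_isometry_on ?A (f (Re z))"
      by (rule local_isometry_on_subset[OF f(1)[of "Re z"]]) (auto simp: open_Int open_above)
    then have "local_isometry_on ?A p'" by (rule local_isometry_on_cong) (use p'_eq in auto)
    then obtain r where r: "0 < r" "ball z r \<subseteq> ?A" "\<And>u v. u \<in> ball z r \<Longrightarrow> v \<in> ball z r \<Longrightarrow> dist (p' u) (p' v) = hdist u v"
      using local_isometry_onE zA by metis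
    have "p' z \<in> X" using f(2)[of "Re z"] p'_eq[of z "Re z"] zA by auto
    then show ?thesis using r by (intro exI[of _ r]) auto
  qed
  show ?thesis
  proof (rule that[of "t - \<delta>" p'])
    show "local_isometry_on (above (t - \<delta>)) p'" unfolding local_isometry_on_def using loc by blast
    show "p' ` above (t - \<delta>) \<subseteq> X" using loc by blast
  qed (use \<delta> in \<open>auto simp: p'_def\<close>)
qed

lemma cusp_param_eq_iff:
  assumes "cusp_param X \<xi> \<psi>" "1 \<le> Im z" "1 \<le> Im w"
  shows "\<psi> z = \<psi> w \<longleftrightarrow> (\<exists>k::int. z - w = of_int k * of_real \<xi>)"
proof -
  have "\<forall>z w. 1 \<le> Im z \<longrightarrow> 1 \<le> Im w \<longrightarrow> (\<psi> z = \<psi> w \<longleftrightarrow> (\<exists>k::int. z - w = of_int k * of_real \<xi>))"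
    using assms(1) unfolding cusp_param_def by (elim conjE)
  then show ?thesis using assms by simp
qed

text \<open>Let \<open>t0\<close> be the infimum of the heights down to which \<open>\<psi>\<close>
  extends. Extensions are unique, hence unite to one above \<open>t0\<close>, and are periodic; were
  \<open>t0\<close> positive, one more extension would go below it.\<close>

theorem developing_map:
  assumes X: "hyperbolic_surface X" "complete X" and \<xi>: "0 < \<xi>" and \<psi>: "cusp_param X \<xi> \<psi>"
  obtains p where "local_isometry_on (above 0) p" "p ` above 0 \<subseteq> X"
    "\<And>z. 1 \<le> Im z \<Longrightarrow> p z = \<psi> z" "\<And>z. 0 < Im z \<Longrightarrow> p (z + of_real \<xi>) = p z"
proof -
  have \<psi>X: "\<psi> z \<in> X" if "1 \<le> Im z" for z using \<psi> that by (auto simp: cusp_param_def)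
  have \<psi>per: "\<psi> (z + of_real \<xi>) = \<psi> z" if "1 \<le> Im z" for z
  proof -
    have "z + of_real \<xi> - z = of_int 1 * of_real \<xi>" by simp
    then have ex: "\<exists>k::int. z + of_real \<xi> - z = of_int k * of_real \<xi>" by blast
    show ?thesis using ex that by (subst cusp_param_eq_iff[OF \<psi>]) auto
  qed
  have \<psi>loc: "\<exists>r>0. \<forall>u\<in>ball z r. \<forall>v\<in>ball z r. 1 \<le> Im u \<longrightarrow> 1 \<le> Im v \<longrightarrow> dist (\<psi> u) (\<psi> v) = hdist u v"
    if "1 \<le> Im z" for z using \<psi> that unfolding cusp_param_def by blast
  have \<psi>iso: "local_isometry_on (above 1) \<psi>"
    unfolding local_isometry_on_def
  proof
    fix z assume z: "z \<in> above 1"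
    obtain r where r: "0 < r" "\<forall>u\<in>ball z r. \<forall>v\<in>ball z r. 1 \<le> Im u \<longrightarrow> 1 \<le> Im v \<longrightarrow> dist (\<psi> u) (\<psi> v) = hdist u v"
      using \<psi>loc[of z] z by auto
    obtain r' where r': "0 < r'" "ball z r' \<subseteq> above 1" using z open_above openE by blast
    show "\<exists>r>0. ball z r \<subseteq> above 1 \<and> (\<forall>u\<in>ball z r. \<forall>v\<in>ball z r. dist (\<psi> u) (\<psi> v) = hdist u v)"
    proof (intro exI[of _ "min r r'"] conjI ballI)
      show "ball z (min r r') \<subseteq> above 1" using r'(2) by auto
      fix u v assume uv: "u \<in> ball z (min r r')" "v \<in> ball z (min r r')"
      then have "u \<in> above 1" "v \<in> above 1" using r'(2) by (auto simp: subset_iff)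
      then show "dist (\<psi> u) (\<psi> v) = hdist u v" using r(2) uv by auto
    qed (use r r' in simp)
  qed
  define dev where "dev t p \<longleftrightarrow> 0 \<le> t \<and> t \<le> 1 \<and> local_isometry_on (above t) p \<and> p ` above t \<subseteq> X \<and>
    (\<forall>z. 1 < Im z \<longrightarrow> p z = \<psi> z)" for t p
  have dev1: "dev 1 \<psi>" using \<psi>iso \<psi>X by (auto simp: dev_def)
  have dev_unique: "p z = q z" if p: "dev t p" and q: "dev t' q" and z: "t < Im z" "t' < Im z" for p q t t' z
  proof (rule local_isometry_unique[OF X(1) open_above, of "max t t'" p q "above 1" "Complex 0 2"])
    show "connected (above (max t t'))" using convex_above convex_connected by blast
    show "local_isometry_on (above (max t t')) p"
      by (rule local_isometry_on_subset[of "above t", OF _ open_above]) (use p in \<open>auto simp: dev_def\<close>)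
    show "local_isometry_on (above (max t t')) q"
      by (rule local_isometry_on_subset[of "above t'", OF _ open_above]) (use q in \<open>auto simp: dev_def\<close>)
  qed (use p q z in \<open>auto simp: dev_def open_above\<close>)
  have dev_per: "p (z + of_real \<xi>) = p z" if p: "dev t p" and z: "t < Im z" for p t z
  proof (rule local_isometry_unique[OF X(1) open_above, of t "\<lambda>z. p (z + of_real \<xi>)" p "above 1" "Complex 0 2"])
    show "connected (above t)" using convex_above convex_connected by blast
    have "(+) (of_real (- \<xi>)) ` above t = above t"
    proof (intro set_eqI iffI)
      fix z assume "z \<in> above t"
      then show "z \<in> (+) (of_real (- \<xi>)) ` above t"
        by (intro image_eqI[of _ _ "z + of_real \<xi>"]) auto
    qed auto
    then show "local_isometry_on (above t) (\<lambda>z. p (z + of_real \<xi>))"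
      using local_isometry_translate[of "above t" p \<xi>] p by (force simp: dev_def)
    show "p (z + of_real \<xi>) = p z" if "z \<in> above 1" for z
      using p that \<psi>per[of z] by (simp add: dev_def)
  qed (use p z in \<open>auto simp: dev_def open_above\<close>)
  define T where "T = {t. \<exists>p. dev t p}"
  define t0 where "t0 = Inf T"
  have T1: "1 \<in> T" using dev1 unfolding T_def by blast
  have T0: "0 \<le> t" if "t \<in> T" for t using that by (auto simp: T_def dev_def)
  have T: "T \<noteq> {}" "bdd_below T" using T1 T0 by (auto intro!: bdd_belowI[of _ 0])
  have t0: "0 \<le> t0" "t0 \<le> 1"
    using T T0 T1 unfolding t0_def by (auto intro!: cInf_greatest cInf_lower)
  have ex: "\<exists>t p. dev t p \<and> t < Im z" if "t0 < Im z" for z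
    using that T unfolding t0_def by (subst (asm) cInf_less_iff) (auto simp: T_def)
  define P where "P z = (SOME x. \<exists>t p. dev t p \<and> t < Im z \<and> x = p z)" for z
  have P: "P z = p z" if "dev t p" "t < Im z" for t p z
  proof -
    have "\<exists>t p. dev t p \<and> t < Im z \<and> P z = p z"
      unfolding P_def by (rule someI_ex) (use that in blast)
    then obtain t' p' where tp': "dev t' p'" "t' < Im z" "P z = p' z" by blast
    show ?thesis unfolding tp'(3) by (rule dev_unique[OF tp'(1) that(1) tp'(2) that(2)])
  qed
  have devP: "dev t0 P"
    unfolding dev_def
  proof (intro conjI allI impI)
    show "local_isometry_on (above t0) P"
      unfolding local_isometry_on_def
    proof
      fix z assume "z \<in> above t0"
      then obtain t p where tp: "dev t p" "t < Im z" using ex by blast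
      have "t0 \<le> t" unfolding t0_def using T tp(1) by (auto intro!: cInf_lower simp: T_def)
      have "local_isometry_on (above t) P"
        by (rule local_isometry_on_cong[of _ p]) (use tp(1) P in \<open>auto simp: dev_def\<close>)
      then obtain r where "0 < r" "ball z r \<subseteq> above t" "\<And>u v. u \<in> ball z r \<Longrightarrow> v \<in> ball z r \<Longrightarrow> dist (P u) (P v) = hdist u v"
        using local_isometry_onE tp(2) by blast
      moreover have "above t \<subseteq> above t0" using \<open>t0 \<le> t\<close> by auto
      ultimately show "\<exists>r>0. ball z r \<subseteq> above t0 \<and> (\<forall>u\<in>ball z r. \<forall>v\<in>ball z r. dist (P u) (P v) = hdist u v)"
        by blast
    qed
    show "P ` above t0 \<subseteq> X"
    proof
      fix x assume "x \<in> P ` above t0"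
      then obtain z where z: "t0 < Im z" "x = P z" by auto
      then obtain t p where tp: "dev t p" "t < Im z" using ex by blast
      then show "x \<in> X" using P[OF tp] z by (auto simp: dev_def)
    qed
    show "P z = \<psi> z" if "1 < Im z" for z using P[OF dev1 that] by simp
  qed (use t0 in auto)
  have "t0 = 0"
  proof (rule ccontr)
    assume "t0 \<noteq> 0"
    then have pos: "0 < t0" using t0 by simp
    have P': "local_isometry_on (above t0) P" "P ` above t0 \<subseteq> X" using devP by (auto simp: dev_def)
    obtain t' p' where p': "0 \<le> t'" "t' < t0" "local_isometry_on (above t') p'" "p' ` above t' \<subseteq> X"
        "\<And>z. t0 < Im z \<Longrightarrow> p' z = P z"
      using local_isometry_extend[OF X pos \<xi> P'] dev_per[OF devP] by metis
    have "dev t' p'" using p' t0 devP by (auto simp: dev_def)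
    then have "t0 \<le> t'" unfolding t0_def using T by (auto intro!: cInf_lower simp: T_def)
    then show False using p'(2) by simp
  qed
  then have dev0: "dev 0 P" using devP by simp
  have P_loc: "local_isometry_on (above 0) P" using dev0 by (simp add: dev_def)
  have "P z = \<psi> z" if z: "1 \<le> Im z" for z
  proof (cases "1 < Im z")
    case True
    then show ?thesis using dev0 by (simp add: dev_def)
  next
    case False
    \<comment> \<open>At height 1 only the upper half of a ball belongs to the domain of
      \<open>\<psi>\<close>, so equality is obtained as a limit from points \<open>u\<close> just
      above \<open>z\<close>.\<close>
    obtain r where r: "0 < r" "\<forall>u\<in>ball z r. \<forall>v\<in>ball z r. 1 \<le> Im u \<longrightarrow> 1 \<le> Im v \<longrightarrow> dist (\<psi> u) (\<psi> v) = hdist u v"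
      using \<psi>loc[OF z] by auto
    obtain r' where r': "0 < r'" "\<And>u v. u \<in> ball z r' \<Longrightarrow> v \<in> ball z r' \<Longrightarrow> dist (P u) (P v) = hdist u v"
      by (rule local_isometry_onE[OF P_loc, of z]) (use z in auto)
    have "dist (P z) (\<psi> z) \<le> 0 + e" if e: "0 < e" for e
    proof -
      obtain d where d: "0 < d" "\<And>u. dist z u < d \<Longrightarrow> 0 < Im u \<and> hdist z u < e / 2"
        using near_imp_hdist_small[of z "e / 2"] z e by auto
      define s where "s = min d (min r r') / 2"
      define u where "u = z + Complex 0 s"
      have s: "0 < s" "s < d" "s < r" "s < r'" using d(1) r(1) r'(1) by (auto simp: s_def)
      have zu: "dist z u = s" using s by (simp add: u_def dist_norm cmod_def)
      have "1 < Im u" using z s by (simp add: u_def)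
      have "dist (P z) (P u) = hdist z u" using r' zu s by simp
      moreover have "dist (\<psi> z) (\<psi> u) = hdist z u" using r zu s z \<open>1 < Im u\<close> by auto
      moreover have "P u = \<psi> u" using dev0 \<open>1 < Im u\<close> by (simp add: dev_def)
      ultimately show ?thesis using d(2)[of u] zu s dist_triangle[of "P z" "\<psi> z" "\<psi> u"]
        by (simp add: dist_commute)
    qed
    then have "dist (P z) (\<psi> z) \<le> 0" by (rule field_le_epsilon)
    then show ?thesis by simp
  qed
  then show ?thesis using dev0 dev_per[OF dev0] by (intro that[of P]) (auto simp: dev_def)
qed

section \<open>Transitions between cusps\<close>

text \<open>Each \<open>p i\<close> is a developing map normalised to have its cusp at infinity with
  period \<open>\<xi> i\<close>. The conditions \<open>p_inj\<close> and \<open>p_disj\<close> say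
  that the horoballs \<open>1 \<le> Im z\<close> are precisely invariant; the upper bounds on the
  size of transitions come from them.\<close>

locale cusped_surface =
  fixes X :: "'a::metric_space set" and I :: "'i set" and \<xi> :: "'i \<Rightarrow> real" and p :: "'i \<Rightarrow> complex \<Rightarrow> 'a"
    and K :: "'a set"
  assumes hyp: "hyperbolic_surface X" and conn: "connected X" and fin: "finite I"
    and \<xi>_pos: "i \<in> I \<Longrightarrow> 0 < \<xi> i"
    and p_iso: "i \<in> I \<Longrightarrow> local_isometry_on (above 0) (p i)"
    and p_X: "i \<in> I \<Longrightarrow> p i ` above 0 \<subseteq> X"
    and p_per: "i \<in> I \<Longrightarrow> 0 < Im z \<Longrightarrow> p i (z + of_real (\<xi> i)) = p i z"
    and p_inj: "i \<in> I \<Longrightarrow> 1 \<le> Im z \<Longrightarrow> 1 \<le> Im w \<Longrightarrow> p i z = p i w \<Longrightarrow>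
      \<exists>k::int. z - w = of_int k * of_real (\<xi> i)"
    and p_disj: "i \<in> I \<Longrightarrow> j \<in> I \<Longrightarrow> 1 \<le> Im z \<Longrightarrow> 1 \<le> Im w \<Longrightarrow> p i z = p j w \<Longrightarrow> i = j"
    and K: "compact K" "K \<subseteq> X" "X \<subseteq> K \<union> (\<Union>i\<in>I. p i ` {z. 1 \<le> Im z})"
begin

text \<open>It stands for the vertical geodesic above \<open>r\<close> from cusp \<open>i\<close> to
  cusp \<open>j\<close>. Between the horocycles at height 1 of the two coordinates it has signed
  length \<open>ln (1 / a)\<close>, the cost counted below.\<close>

definition transition :: "'i \<Rightarrow> 'i \<Rightarrow> real \<Rightarrow> real \<Rightarrow> real \<Rightarrow> real \<Rightarrow> bool" where
  "transition i j s a b r \<longleftrightarrow> s\<^sup>2 = 1 \<and> 0 < a \<and> (\<forall>z. 0 < Im z \<longrightarrow> p i z = p j (hinv s a b r z))"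

lemma transitionD:
  assumes "transition i j s a b r"
  shows "s\<^sup>2 = 1" "0 < a" "\<And>z. 0 < Im z \<Longrightarrow> p i z = p j (hinv s a b r z)" "hinv s a b r \<in> hyp_iso"
  using assms by (auto simp: transition_def hinv_in_hyp_iso)

lemma p_shift:
  assumes "i \<in> I" "0 < Im z"
  shows "p i (z + of_int k * of_real (\<xi> i)) = p i z"
  using periodic_int[of 0 "p i" "\<xi> i" z k] p_per assms by blast

lemma lift:
  assumes "i \<in> I" "j \<in> I" "0 < Im z" "0 < Im w" "p i z = p j w"
  obtains m where "m \<in> hyp_iso" "m z = w" "\<And>u. 0 < Im u \<Longrightarrow> p i u = p j (m u)"
  using local_isometry_lift[OF hyp p_iso p_X p_iso p_X] assms by metis

lemma transition_inverse:
  assumes "transition i j s a b r"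
  shows "transition j i s a r b"
  unfolding transition_def
proof (intro conjI allI impI)
  fix z :: complex assume z: "0 < Im z"
  have "0 < Im (hinv s a r b z)"
    using z transitionD(1,2)[OF assms] by (simp add: hinv_in_hyp_iso hyp_iso_Im_pos)
  then show "p j z = p i (hinv s a r b z)"
    using transitionD(3)[OF assms, of "hinv s a r b z"] hinv_inverse transitionD(1,2)[OF assms] z by simp
qed (use transitionD[OF assms] in auto)

text \<open>The integer \<open>k\<close> is the freedom by which chains are later given large
  partial quotients.\<close>

lemma transition_shift_target:
  assumes "transition i j s a b r" "j \<in> I"
  shows "transition i j s a (b + of_int k * \<xi> j) r"
  unfolding transition_def
proof (intro conjI allI impI)
  fix z :: complex assume z: "0 < Im z"
  have "0 < Im (hinv s a b r z)"
    using z transitionD(4)[OF assms(1)] by (rule hyp_iso_Im_pos[rotated])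
  moreover have "hinv s a (b + of_int k * \<xi> j) r z = hinv s a b r z + of_int k * of_real (\<xi> j)"
    by (simp add: complex_eq_iff Re_hinv Im_hinv)
  ultimately show "p i z = p j (hinv s a (b + of_int k * \<xi> j) r z)"
    using transitionD(3)[OF assms(1) z] p_shift[OF assms(2)] by simp
qed (use transitionD[OF assms(1)] in auto)

lemma transition_shift_source:
  assumes "transition i j s a b r" "i \<in> I"
  shows "transition i j s a b (r + of_int k * \<xi> i)"
  using transition_inverse[OF transition_shift_target[OF transition_inverse[OF assms(1)] assms(2)]] .

lemma transition_comp:
  assumes "transition i j s a b r" "transition j k s' a' b' r'" "b \<noteq> r'"
  shows "transition i k (- s * s') (a * a' / (b - r')\<^sup>2) (b' + s' * a' / (b - r')) (r - s * a / (b - r'))"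
  unfolding transition_def
proof (intro conjI allI impI)
  show "(- s * s')\<^sup>2 = 1" using transitionD(1)[OF assms(1)] transitionD(1)[OF assms(2)]
    by (simp add: power_mult_distrib)
  show "0 < a * a' / (b - r')\<^sup>2" using transitionD(2)[OF assms(1)] transitionD(2)[OF assms(2)] assms(3) by simp
  fix z :: complex assume z: "0 < Im z"
  have "p i z = p k (hinv s' a' b' r' (hinv s a b r z))"
    using transitionD(3,4)[OF assms(1)] transitionD(3)[OF assms(2)] z hyp_iso_Im_pos by metis
  then show "p i z = p k (hinv (- s * s') (a * a' / (b - r')\<^sup>2) (b' + s' * a' / (b - r')) (r - s * a / (b - r')) z)"
    using hinv_hinv[of s s' z a b r' a' b' r] transitionD(1,2)[OF assms(1)] transitionD(1)[OF assms(2)] z assms(3)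
    by simp
qed

text \<open>A map fixing infinity keeps high points in the horoballs, so precise invariance applies:
  a change of cusp or a scaling is impossible, and only translations by periods survive.\<close>

lemma similarity_trivial:
  assumes ij: "i \<in> I" "j \<in> I" and s: "s\<^sup>2 = 1" and \<alpha>: "0 < \<alpha>"
    and eq: "\<And>z. 0 < Im z \<Longrightarrow> p i z = p j (hsim s \<alpha> \<beta> z)"
  shows "i = j" "\<alpha> = 1" "s = 1" "\<exists>k::int. \<beta> = of_int k * \<xi> i"
proof -
  define y where "y = max 1 (1 / \<alpha>)"
  have y: "1 \<le> y" "1 \<le> \<alpha> * y"
    using \<alpha> by (auto simp: y_def max_def field_simps)
  show [simp]: "i = j"
    using p_disj[OF ij, of "Complex 0 y" "hsim s \<alpha> \<beta> (Complex 0 y)"] eq[of "Complex 0 y"] y by simp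
  have ex: "\<exists>k::int. Complex x y - hsim s \<alpha> \<beta> (Complex x y) = of_int k * of_real (\<xi> i)" for x
    using p_inj[of i "Complex x y" "hsim s \<alpha> \<beta> (Complex x y)"] ij eq[of "Complex x y"] y by simp
  then obtain k :: int where "Complex 0 y - hsim s \<alpha> \<beta> (Complex 0 y) = of_int k * of_real (\<xi> i)" by blast
  then have "y - \<alpha> * y = 0" by (simp add: complex_eq_iff)
  then have "(1 - \<alpha>) * y = 0" by (simp add: algebra_simps)
  then show \<alpha>1: "\<alpha> = 1" using y by simp
  have ex': "\<exists>k::int. x - \<beta> - s * x = of_int k * \<xi> i" for x
  proof -
    obtain k :: int where "Complex x y - hsim s \<alpha> \<beta> (Complex x y) = of_int k * of_real (\<xi> i)"
      using ex by blast
    then have "x - \<beta> - s * x = of_int k * \<xi> i" using \<alpha>1 by (simp add: complex_eq_iff algebra_simps)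
    then show ?thesis by blast
  qed
  show s1: "s = 1"
  proof (rule ccontr)
    assume "s \<noteq> 1"
    then have "s = -1" using s by (simp add: power2_eq_1_iff)
    \<comment> \<open>A reflection would move some point by half a period;
      \<open>\<beta> / 2 + \<xi> i / 4\<close> is such a point.\<close>
    then obtain k :: int where "\<xi> i / 2 = of_int k * \<xi> i"
      using ex'[of "\<beta> / 2 + \<xi> i / 4"] by (auto simp: field_simps)
    then have "of_int (2 * k) = (1::real)" using \<xi>_pos[OF ij(1)] by simp
    then have "2 * k = 1" by linarith
    then show False by presburger
  qed
  obtain k :: int where "- \<beta> = of_int k * \<xi> i" using ex'[of 0] by auto
  then have "\<beta> = of_int (- k) * \<xi> i" by simp
  then show "\<exists>k::int. \<beta> = of_int k * \<xi> i" by blast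
qed

text \<open>For \<open>a > 1\<close> the point at height 1 above \<open>r\<close> would be sent to
  height \<open>a\<close>, also inside a horoball; precise invariance then forces equal
  heights.\<close>

lemma transition_le_1:
  assumes "transition i j s a b r" and ij: "i \<in> I" "j \<in> I"
  shows "a \<le> 1"
proof (rule ccontr)
  assume "\<not> a \<le> 1"
  then have a: "1 < a" by simp
  let ?z = "Complex r 1"
  have w: "Im (hinv s a b r ?z) = a" by (simp add: Im_hinv)
  have eq: "p i ?z = p j (hinv s a b r ?z)" using transitionD(3)[OF assms(1)] by simp
  then have "i = j" using p_disj[OF ij, of ?z "hinv s a b r ?z"] w a by simp
  then obtain k :: int where "?z - hinv s a b r ?z = of_int k * of_real (\<xi> i)"
    using p_inj[OF ij(1), of ?z "hinv s a b r ?z"] eq w a by auto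
  then have "1 - a = 0" using w by (simp add: complex_eq_iff)
  then show False using a by simp
qed

text \<open>
  This is Shimizu's lemma: composing a transition with a suitable translate of itself replaces
  \<open>a\<close> by at least \<open>a\<^sup>2 / (\<xi> i)\<^sup>2\<close>, which cannot be iterated if \<open>a\<close> is larger than \<open>(\<xi> i)\<^sup>2\<close>.
\<close>

lemma transition_self_le:
  assumes tr: "transition i i s a b r" and i: "i \<in> I"
  shows "a \<le> (\<xi> i)\<^sup>2"
proof (rule ccontr)
  assume "\<not> a \<le> (\<xi> i)\<^sup>2"
  define q where "q = a / (\<xi> i)\<^sup>2"
  have \<xi>: "0 < \<xi> i" using \<xi>_pos[OF i] .
  have q: "1 < q" using \<open>\<not> a \<le> (\<xi> i)\<^sup>2\<close> \<xi> by (simp add: q_def)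
  have a: "0 < a" using transitionD(2)[OF tr] .
  have "\<exists>s' a' b' r'. transition i i s' a' b' r' \<and> a * q ^ n \<le> a'" for n
  proof (induction n)
    case 0
    then show ?case using tr by auto
  next
    case (Suc n)
    then obtain s' a' b' r' where tr': "transition i i s' a' b' r'" "a * q ^ n \<le> a'" by blast
    have a': "0 < a'" using transitionD(2)[OF tr'(1)] .
    \<comment> \<open>The translate is chosen with \<open>0 < D \<le> \<xi> i\<close>, so that
      dividing by \<open>D\<^sup>2\<close> loses at most the factor
      \<open>(\<xi> i)\<^sup>2\<close>.\<close>
    define k where "k = \<lfloor>(r' - b') / \<xi> i\<rfloor> + 1"
    define D where "D = b' + of_int k * \<xi> i - r'"
    have D: "0 < D" "D \<le> \<xi> i"
      using floor_divide_lower[OF \<xi>, of "r' - b'"] floor_divide_upper[OF \<xi>, of "r' - b'"]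
      by (auto simp: D_def k_def algebra_simps)
    have tr2: "transition i i s' a' (b' + of_int k * \<xi> i) r'"
      by (rule transition_shift_target[OF tr'(1) i])
    have "b' + of_int k * \<xi> i \<noteq> r'" using D(1) by (simp add: D_def)
    then have tr3: "transition i i (- s' * s') (a' * a' / D\<^sup>2)
        (b' + of_int k * \<xi> i + s' * a' / D) (r' - s' * a' / D)"
      using transition_comp[OF tr2 tr2] by (simp add: D_def)
    have "a \<le> a'" using tr'(2) q a by (smt (verit) mult_le_cancel_left1 one_le_power)
    have "a * q ^ Suc n = (a * q ^ n) * (a / (\<xi> i)\<^sup>2)" by (simp add: q_def)
    also have "\<dots> \<le> a' * (a' / (\<xi> i)\<^sup>2)"
      using tr'(2) \<open>a \<le> a'\<close> a a' \<xi> by (intro mult_mono divide_right_mono) auto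
    also have "\<dots> \<le> a' * a' / D\<^sup>2"
      using D a' \<xi> by (simp add: divide_left_mono power_mono)
    finally show ?case using tr3 by blast
  qed
  moreover obtain n where "1 / a < q ^ n" using real_arch_pow[OF q] by blast
  ultimately obtain s' a' b' r' where tr': "transition i i s' a' b' r'" "a * q ^ n \<le> a'" by blast
  have "1 < a * q ^ n" using \<open>1 / a < q ^ n\<close> a by (simp add: field_simps)
  then show False using transition_le_1[OF tr'(1) i i] tr'(2) by simp
qed

section \<open>The thick part, and horoballs over its complement\<close>

text \<open>The band up to height 2 is a safety margin: points of the surface outside lie in
  horoballs at height above 2, an open condition, while precise invariance already holds from height
  1.\<close>

definition thick :: "'a set" where
  "thick = K \<union> (\<Union>i\<in>I. p i ` cbox (Complex 0 1) (Complex (\<xi> i) 2))"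

lemma thick: "compact thick" "thick \<subseteq> X"
proof -
  have sub: "cbox (Complex 0 1) (Complex (\<xi> i) 2) \<subseteq> above 0" for i
    by (auto simp: in_cbox_complex_iff)
  have "compact (p i ` cbox (Complex 0 1) (Complex (\<xi> i) 2))" if "i \<in> I" for i
    using continuous_on_local_isometry[OF p_iso[OF that]] sub
    by (intro compact_continuous_image) (auto intro: continuous_on_subset)
  then show "compact thick" unfolding thick_def using K(1) fin by (intro compact_Un compact_UN) auto
  show "thick \<subseteq> X" unfolding thick_def using K(2) p_X sub by blast
qed

lemma normalize:
  assumes "i \<in> I" "0 < Im w"
  obtains w' where "Im w' = Im w" "0 \<le> Re w'" "Re w' \<le> \<xi> i" "p i w' = p i w"
proof -
  have \<xi>: "0 < \<xi> i" using \<xi>_pos assms by simp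
  define k where "k = - \<lfloor>Re w / \<xi> i\<rfloor>"
  show ?thesis
    using floor_divide_lower[OF \<xi>, of "Re w"] floor_divide_upper[OF \<xi>, of "Re w"] p_shift[OF assms, of k]
    by (intro that[of "w + of_int k * of_real (\<xi> i)"]) (auto simp: k_def algebra_simps)
qed

text \<open>The horoball cannot change on the way through the thin part, since two coordinates that
  both exceed height 2 at a point give it the same height.\<close>

lemma thin_connected:
  assumes i: "i \<in> I" and Q: "connected Q" "Q \<noteq> {}" "Q \<subseteq> above 0" and thin: "\<And>z. z \<in> Q \<Longrightarrow> p i z \<notin> thick"
  obtains k m where "k \<in> I" "m \<in> hyp_iso" "\<And>z. 0 < Im z \<Longrightarrow> p i z = p k (m z)" "\<And>z. z \<in> Q \<Longrightarrow> 2 < Im (m z)"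
proof -
  define D where "D = {(k, m). k \<in> I \<and> m \<in> hyp_iso \<and> (\<forall>z. 0 < Im z \<longrightarrow> p i z = p k (m z))}"
  define U where "U m = {z. 0 < Im z \<and> 2 < Im (m z)}" for m :: "complex \<Rightarrow> complex"
  have open_U: "open (U m)" if "(k, m) \<in> D" for k m
  proof -
    have "open {z. 0 < Im z \<and> m z \<in> above 2}"
      using that by (intro open_hyp_iso_vimage open_above) (auto simp: D_def)
    then show ?thesis by (simp add: U_def)
  qed
  have ex: "\<exists>k m. (k, m) \<in> D \<and> z \<in> U m" if z: "z \<in> Q" for z
  proof -
    have z0: "0 < Im z" using Q(3) z by auto
    have "p i z \<in> X" "p i z \<notin> K" using p_X[OF i] z0 thin[OF z] by (auto simp: thick_def)
    then obtain k w where w: "k \<in> I" "1 \<le> Im w" "p i z = p k w" using K(3) by blast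
    obtain w' where w': "Im w' = Im w" "0 \<le> Re w'" "Re w' \<le> \<xi> k" "p k w' = p k w"
      using normalize[OF w(1), of w] w(2) by auto
    have "2 < Im w'"
    proof (rule ccontr)
      assume "\<not> 2 < Im w'"
      then have "w' \<in> cbox (Complex 0 1) (Complex (\<xi> k) 2)" using w w' by (simp add: in_cbox_complex_iff)
      then have "p i z \<in> thick" unfolding thick_def using w(1,3) w'(4) by (metis UN_iff UnI2 image_eqI)
      then show False using thin[OF z] by simp
    qed
    obtain m where "m \<in> hyp_iso" "m z = w'" "\<And>u. 0 < Im u \<Longrightarrow> p i u = p k (m u)"
      using lift[OF i w(1) z0, of w'] w w' by auto
    then show ?thesis using w(1) z0 \<open>2 < Im w'\<close> by (intro exI[of _ k] exI[of _ m]) (auto simp: D_def U_def)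
  qed
  have height: "Im (m z) = Im (m' z)" if D: "(k, m) \<in> D" "(k', m') \<in> D" and z: "z \<in> U m" "z \<in> U m'" for k m k' m' z
  proof -
    have eq: "p k (m z) = p k' (m' z)" using D z by (auto simp: D_def U_def)
    have "k = k'" by (rule p_disj[OF _ _ _ _ eq]) (use D z in \<open>auto simp: D_def U_def\<close>)
    then obtain l :: int where "m z - m' z = of_int l * of_real (\<xi> k)"
      using p_inj[of k "m z" "m' z"] D z eq by (auto simp: D_def U_def)
    then show ?thesis by (simp add: complex_eq_iff)
  qed
  obtain z0 where z0: "z0 \<in> Q" using Q(2) by blast
  obtain k m where km: "(k, m) \<in> D" "z0 \<in> U m" using ex[OF z0] by blast
  have mcont: "continuous_on (above 0) m" using continuous_on_hyp_iso km(1) by (auto simp: D_def)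
  \<comment> \<open>\<open>V\<close> collects the points that are higher in another coordinate. It
    contains the points of \<open>Q\<close> outside \<open>U m\<close>, and misses
    \<open>U m\<close> because heights above 2 agree.\<close>
  define V where "V = (\<Union>(k', m')\<in>D. {z\<in>U m'. Im (m z) < Im (m' z)})"
  have "open V"
  proof -
    have "open {z\<in>U m'. Im (m z) < Im (m' z)}" if D': "(k', m') \<in> D" for k' m'
    proof -
      have m'cont: "continuous_on (above 0) m'" using continuous_on_hyp_iso D' by (auto simp: D_def)
      have sub: "U m' \<subseteq> above 0" by (auto simp: U_def)
      have "open (U m' \<inter> (\<lambda>z. Im (m' z) - Im (m z)) -` {0<..})"
        using open_U[OF D'] m'cont mcont sub
        by (intro continuous_open_preimage continuous_intros) (auto intro: continuous_on_subset)
      moreover have "U m' \<inter> (\<lambda>z. Im (m' z) - Im (m z)) -` {0<..} = {z\<in>U m'. Im (m z) < Im (m' z)}"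
        by (auto simp: U_def)
      ultimately show ?thesis by simp
    qed
    then show ?thesis unfolding V_def by (intro open_UN) auto
  qed
  moreover have "Q \<subseteq> U m \<union> V"
  proof
    fix z assume z: "z \<in> Q"
    obtain k' m' where "(k', m') \<in> D" "z \<in> U m'" using ex[OF z] by blast
    then show "z \<in> U m \<union> V"
      unfolding V_def U_def using Q(3) z by (cases "2 < Im (m z)") fastforce+
  qed
  moreover have "U m \<inter> V = {}"
    unfolding V_def using height[OF km(1)] by (fastforce simp: U_def)
  ultimately have "U m \<inter> Q = {} \<or> V \<inter> Q = {}"
    using connectedD[OF Q(1) open_U[OF km(1)]] by blast
  then have "Q \<subseteq> U m" using z0 km(2) \<open>Q \<subseteq> U m \<union> V\<close> by blast
  then show ?thesis using km(1) by (intro that[of k m]) (auto simp: D_def U_def)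
qed

text \<open>Otherwise the whole segment lies in one horoball above height 2. As
  \<open>a \<le> 1\<close>, its base point \<open>r\<close> satisfies
  \<open>(t - r)\<^sup>2 < y / 2\<close> along the segment, but one end is at distance at least
  \<open>e / 2\<close> from \<open>r\<close>.\<close>

lemma segment_meets_thick:
  assumes i: "i \<in> I" and y: "0 < y" "y < 2" "2 * y \<le> e\<^sup>2" and e: "0 < e"
  shows "\<exists>t. \<bar>t - x\<bar> \<le> e / 2 \<and> p i (Complex t y) \<in> thick"
proof (rule ccontr)
  assume "\<nexists>t. \<bar>t - x\<bar> \<le> e / 2 \<and> p i (Complex t y) \<in> thick"
  then have no: "p i (Complex t y) \<notin> thick" if "\<bar>t - x\<bar> \<le> e / 2" for t using that by blast
  define Q where "Q = (\<lambda>t. Complex t y) ` {x - e / 2..x + e / 2}"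
  have "connected Q" unfolding Q_def
    by (intro connected_continuous_image continuous_intros) auto
  moreover have "Q \<noteq> {}" "Q \<subseteq> above 0" using e y by (auto simp: Q_def)
  moreover have "p i z \<notin> thick" if z: "z \<in> Q" for z
  proof -
    from z[unfolded Q_def] obtain t where "z = Complex t y" "t \<in> {x - e / 2..x + e / 2}" by (rule imageE)
    moreover from this(2) have "\<bar>t - x\<bar> \<le> e / 2" unfolding abs_le_iff atLeastAtMost_iff by linarith
    ultimately show ?thesis using no by simp
  qed
  ultimately obtain k m where m: "k \<in> I" "m \<in> hyp_iso" "\<And>z. 0 < Im z \<Longrightarrow> p i z = p k (m z)" "\<And>z. z \<in> Q \<Longrightarrow> 2 < Im (m z)"
    using thin_connected[OF i] by metis
  have ends: "Complex (x - e / 2) y \<in> Q" "Complex (x + e / 2) y \<in> Q" using e by (auto simp: Q_def)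
  from m(2) show False
  proof (cases rule: hyp_iso_cases)
    case (sim s \<alpha> \<beta>)
    then have "\<alpha> = 1" using similarity_trivial(2)[OF i m(1)] m(3) by blast
    then show False using m(4)[OF ends(1)] sim y by simp
  next
    case (inv s a b r)
    have tr: "transition i k s a b r" using inv m(3) by (auto simp: transition_def)
    have a: "0 < a" "a \<le> 1" using inv transition_le_1[OF tr i m(1)] by auto
    have bound: "(t - r)\<^sup>2 < y / 2" if "Complex t y \<in> Q" for t
    proof -
      have pos: "0 < (t - r)\<^sup>2 + y\<^sup>2" using y by (simp add: sq_sum_pos)
      have "2 < a * y / ((t - r)\<^sup>2 + y\<^sup>2)" using m(4)[OF that] inv by (simp add: Im_hinv)
      then have "2 * ((t - r)\<^sup>2 + y\<^sup>2) < a * y" using pos by (simp add: pos_less_divide_eq)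
      also have "\<dots> \<le> 1 * y" using a y by (intro mult_right_mono) auto
      finally show ?thesis using zero_le_power2[of y] unfolding distrib_left by linarith
    qed
    have "(e / 2)\<^sup>2 \<le> (x - e / 2 - r)\<^sup>2 \<or> (e / 2)\<^sup>2 \<le> (x + e / 2 - r)\<^sup>2"
    proof (cases "r \<le> x")
      case True
      then have "(e / 2)\<^sup>2 \<le> (x + e / 2 - r)\<^sup>2" using e by (intro power_mono) auto
      then show ?thesis ..
    next
      case False
      then have "(e / 2)\<^sup>2 \<le> (r - x + e / 2)\<^sup>2" using e by (intro power_mono) auto
      then show ?thesis by (simp add: power2_eq_square algebra_simps)
    qed
    then have "(e / 2)\<^sup>2 < y / 2" using bound[OF ends(1)] bound[OF ends(2)] by linarith
    then show False using y(3) by (simp add: power_divide)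
  qed
qed

lemma thick_cover:
  assumes j: "j \<in> I"
  obtains y Y where "0 < y" "y \<le> 1" "1 \<le> Y"
    "\<And>x. x \<in> thick \<Longrightarrow> \<exists>w. x = p j w \<and> y \<le> Im w \<and> Im w \<le> Y \<and> 0 \<le> Re w \<and> Re w \<le> \<xi> j"
proof -
  obtain y Y where yY: "0 < y" "thick \<subseteq> p j ` {u. y \<le> Im u \<and> Im u \<le> Y}"
    using local_isometry_compact_cover[OF hyp conn p_iso[OF j] p_X[OF j] thick] by blast
  have "\<exists>w. x = p j w \<and> min y 1 \<le> Im w \<and> Im w \<le> max Y 1 \<and> 0 \<le> Re w \<and> Re w \<le> \<xi> j" if x: "x \<in> thick" for x
  proof -
    obtain u where u: "x = p j u" "y \<le> Im u" "Im u \<le> Y"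
      using subsetD[OF yY(2) x] by blast
    obtain w where w: "Im w = Im u" "0 \<le> Re w" "Re w \<le> \<xi> j" "p j w = p j u"
      using normalize[OF j, of u] u yY(1) by auto
    show ?thesis using u w by (intro exI[of _ w]) auto
  qed
  then show ?thesis using yY(1) by (intro that[of "min y 1" "max Y 1"]) auto
qed

text \<open>A thick point is found at height \<open>y / 2\<close>, below the band whose image covers
  the thick part. A lift takes it to a representative at height at least \<open>y\<close>, so it
  changes the height and cannot be a similarity.\<close>

lemma ex_transition_self:
  assumes j: "j \<in> I"
  obtains s a b r where "transition j j s a b r"
proof -
  obtain y Y where yY: "0 < y" "y \<le> 1"
    "\<And>x. x \<in> thick \<Longrightarrow> \<exists>w. x = p j w \<and> y \<le> Im w \<and> Im w \<le> Y \<and> 0 \<le> Re w \<and> Re w \<le> \<xi> j"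
    using thick_cover[OF j] by metis
  obtain t where t: "p j (Complex t (y / 2)) \<in> thick"
    using segment_meets_thick[OF j, of "y / 2" 1 0] yY by auto
  then obtain w where w: "p j (Complex t (y / 2)) = p j w" "y \<le> Im w" using yY(3) by metis
  obtain m where m: "m \<in> hyp_iso" "m (Complex t (y / 2)) = w" "\<And>u. 0 < Im u \<Longrightarrow> p j u = p j (m u)"
    using lift[OF j j, of "Complex t (y / 2)" w] w yY(1) by auto
  from m(1) show ?thesis
  proof (cases rule: hyp_iso_cases)
    case (sim s \<alpha> \<beta>)
    then have "\<alpha> = 1" using similarity_trivial(2)[OF j j] m(3) by blast
    then show ?thesis using m(2) sim w(2) yY(1) by auto
  next
    case (inv s a b r)
    then have "transition j j s a b r" using m(3) by (simp add: transition_def)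
    then show ?thesis by (rule that)
  qed
qed

text \<open>
  A point at height \<open>e\<^sup>2\<close> that lies over the thick part is close to some horoball of the cusp \<open>j\<close>,
  but this horoball may be large, with a base point far away. It has two neighbours at bounded
  distance, at \<open>r0\<close> and \<open>r0 + \<xi> j\<close> in its own coordinate, and one of them is small.
\<close>

lemma transition_dense:
  assumes j: "j \<in> I"
  obtains c where "0 < c" "\<And>i x e. i \<in> I \<Longrightarrow> 0 < e \<Longrightarrow> e \<le> 1 \<Longrightarrow>
    \<exists>s a b r. transition i j s a b r \<and> \<bar>r - x\<bar> \<le> e \<and> c * e\<^sup>2 \<le> a"
proof -
  obtain y0 Y0 where yY: "0 < y0" "y0 \<le> 1" "1 \<le> Y0"
    "\<And>x. x \<in> thick \<Longrightarrow> \<exists>w. x = p j w \<and> y0 \<le> Im w \<and> Im w \<le> Y0 \<and> 0 \<le> Re w \<and> Re w \<le> \<xi> j"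
    using thick_cover[OF j] by metis
  obtain s0 a0 b0 r0 where tr0: "transition j j s0 a0 b0 r0" using ex_transition_self[OF j] .
  have a0: "0 < a0" using transitionD(2)[OF tr0] .
  have \<xi>: "0 < \<xi> j" using \<xi>_pos[OF j] .
  \<comment> \<open>\<open>R\<close> bounds the squared distance from a lifted thick point
    \<open>w\<close> to both base points \<open>r0\<close> and \<open>r0 + \<xi> j\<close>, and
    \<open>q1\<close> bounds its height after the self-transition from below. \<open>A * y\<close>
    will bound the size of the transition produced.\<close>
  define R where "R = (\<bar>r0\<bar> + 2 * \<xi> j)\<^sup>2 + Y0\<^sup>2"
  define q1 where "q1 = a0 * y0 / R"
  define q2 where "q2 = 2 * (R * 4 / (\<xi> j)\<^sup>2 + 1)"
  define A where "A = a0 * q2 / y0"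
  \<comment> \<open>The test height is lowered to \<open>\<eta> * e\<^sup>2\<close> so that the
    final horizontal error \<open>sqrt (A / q1) * y\<close> is at most \<open>e / 2\<close>.\<close>
  define \<eta> where "\<eta> = min (1 / 2) (1 / (2 * (sqrt (A / q1) + 1)))"
  have R: "0 < R" using yY(3) by (simp add: R_def sq_sum_pos)
  have q1: "0 < q1" using a0 yY R by (simp add: q1_def)
  have q2: "1 \<le> q2" using R \<xi> by (simp add: q2_def)
  have A: "0 < A" using a0 q2 yY by (simp add: A_def)
  have sq: "0 \<le> sqrt (A / q1)" using A q1 by simp
  have \<eta>: "0 < \<eta>" "\<eta> \<le> 1 / 2" using sq by (auto simp: \<eta>_def add_nonneg_pos)
  have \<eta>2: "\<eta> * sqrt (A / q1) \<le> 1 / 2"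
  proof -
    have "\<eta> * (sqrt (A / q1) + 1) \<le> 1 / (2 * (sqrt (A / q1) + 1)) * (sqrt (A / q1) + 1)"
      using sq by (intro mult_right_mono) (auto simp: \<eta>_def)
    also have "\<dots> = 1 / 2" using add_nonneg_pos[OF sq zero_less_one] by simp
    finally show ?thesis using \<eta>(1) by (simp add: algebra_simps)
  qed
  have "\<exists>s a b r. transition i j s a b r \<and> \<bar>r - x\<bar> \<le> e \<and> q1 * \<eta> * e\<^sup>2 \<le> a"
    if i: "i \<in> I" and e: "0 < e" "e \<le> 1" for i x e
  proof -
    define y where "y = \<eta> * e\<^sup>2"
    have e2: "0 < e\<^sup>2" "e\<^sup>2 \<le> e" "e\<^sup>2 \<le> 1"
      using e by (auto simp: power2_eq_square mult_le_one mult_left_le)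
    have y: "0 < y" using \<eta> e2 by (simp add: y_def)
    have "y \<le> 1 / 2 * e\<^sup>2" unfolding y_def using \<eta> e2 by (intro mult_right_mono) auto
    then have y2: "2 * y \<le> e\<^sup>2" "y < 2" using e2 by auto
    obtain t where t: "\<bar>t - x\<bar> \<le> e / 2" "p i (Complex t y) \<in> thick"
      using segment_meets_thick[OF i y y2(2,1) e(1)] by metis
    define z where "z = Complex t y"
    obtain w where w: "p i z = p j w" "y0 \<le> Im w" "Im w \<le> Y0" "0 \<le> Re w" "Re w \<le> \<xi> j"
      using yY(4)[OF t(2)] unfolding z_def by blast
    have z0: "0 < Im z" and w0: "0 < Im w" using y w yY by (auto simp: z_def)
    obtain m where m: "m \<in> hyp_iso" "m z = w" "\<And>u. 0 < Im u \<Longrightarrow> p i u = p j (m u)"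
      using lift[OF i j z0 w0 w(1)] by blast
    have wR: "(Re w - u)\<^sup>2 + (Im w)\<^sup>2 \<le> R" if "u = r0 \<or> u = r0 + \<xi> j" for u
    proof -
      have "(Re w - u)\<^sup>2 \<le> (\<bar>r0\<bar> + 2 * \<xi> j)\<^sup>2"
        using that w(4,5) \<xi> by (intro abs_le_square_iff[THEN iffD1]) auto
      moreover have "(Im w)\<^sup>2 \<le> Y0\<^sup>2" using w(3) w0 by (intro power_mono) auto
      ultimately show ?thesis by (simp add: R_def)
    qed
    have tru: "transition j j s0 a0 b0 u" if "u = r0 \<or> u = r0 + \<xi> j" for u
      using that tr0 transition_shift_source[OF tr0 j, of 1] by auto
    have "\<exists>u s' a' b' r'. (u = r0 \<or> u = r0 + \<xi> j) \<and> transition i j s' a' b' r' \<and>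
      hinv s' a' b' r' z = hinv s0 a0 b0 u w \<and> a' \<le> A * y"
      using m(1)
    proof (cases rule: hyp_iso_cases)
      case (sim s \<alpha> \<beta>)
      have Imw: "Im w = \<alpha> * y" using m(2) sim by (auto simp: z_def)
      have "transition i j (s0 * s) (a0 / \<alpha>) b0 (s * (r0 - \<beta>) / \<alpha>)"
        unfolding transition_def
      proof (intro conjI allI impI)
        show "(s0 * s)\<^sup>2 = 1" using sim(2) transitionD(1)[OF tr0] by (simp add: power_mult_distrib)
        show "0 < a0 / \<alpha>" using a0 sim by simp
        fix u :: complex assume u: "0 < Im u"
        have "p i u = p j (hinv s0 a0 b0 r0 (hsim s \<alpha> \<beta> u))"
          using m(3)[OF u] sim(1) transitionD(3)[OF tr0, of "hsim s \<alpha> \<beta> u"] sim(3) u by simp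
        then show "p i u = p j (hinv (s0 * s) (a0 / \<alpha>) b0 (s * (r0 - \<beta>) / \<alpha>) u)"
          using hinv_hsim[OF sim(2,3) u] by simp
      qed
      moreover have "hinv (s0 * s) (a0 / \<alpha>) b0 (s * (r0 - \<beta>) / \<alpha>) z = hinv s0 a0 b0 r0 w"
        using hinv_hsim[OF sim(2,3) z0, of s0 a0 b0 r0 \<beta>] m(2) sim(1) by simp
      moreover have "a0 / \<alpha> \<le> A * y"
      proof -
        have "a0 / \<alpha> = a0 * y / Im w" using Imw y sim(3) by simp
        also have "\<dots> \<le> a0 * y / y0" using a0 y w(2) yY(1) w0 by (intro divide_left_mono) auto
        also have "\<dots> = a0 * 1 / y0 * y" by simp
        also have "\<dots> \<le> A * y" unfolding A_def using a0 q2 yY(1) y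
          by (intro mult_right_mono divide_right_mono mult_left_mono) auto
        finally show ?thesis .
      qed
      ultimately show ?thesis by blast
    next
      case (inv s a b r)
      have tr: "transition i j s a b r" using inv m(3) by (auto simp: transition_def)
      \<comment> \<open>\<open>b\<close> cannot be closer than half a period to both base points, so
        one choice of \<open>u\<close> keeps the composition away from degeneracy.\<close>
      define u where "u = (if \<xi> j / 2 \<le> \<bar>b - r0\<bar> then r0 else r0 + \<xi> j)"
      have u: "u = r0 \<or> u = r0 + \<xi> j" by (simp add: u_def)
      have bu: "\<xi> j / 2 \<le> \<bar>b - u\<bar>" using \<xi> by (auto simp: u_def abs_if split: if_splits)
      then have ne: "b \<noteq> u" using \<xi> by auto
      have bu2: "(\<xi> j)\<^sup>2 / 4 \<le> (b - u)\<^sup>2"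
        using abs_le_square_iff[of "\<xi> j / 2" "b - u"] bu \<xi> by (simp add: power_divide)
      have bupos: "0 < (b - u)\<^sup>2" using ne by simp
      have "z = hinv s a r b w" using hinv_inverse[OF inv(2,3) z0, of r b] m(2) inv(1) by simp
      then have yw: "y = a * Im w / ((Re w - b)\<^sup>2 + (Im w)\<^sup>2)" by (simp add: z_def Im_hinv complex_eq_iff)
      define W where "W = (Re w - b)\<^sup>2 + (Im w)\<^sup>2"
      have W: "0 < W" using w0 by (simp add: W_def sq_sum_pos)
      have "y = a * Im w / W" using yw by (simp add: W_def)
      then have a: "a = y * W / Im w" using W w0 by simp
      have "W \<le> 2 * ((Re w - u)\<^sup>2 + (Im w)\<^sup>2) + 2 * (b - u)\<^sup>2"
      proof -
        have "2 * (Re w - u)\<^sup>2 + 2 * (b - u)\<^sup>2 - (Re w - b)\<^sup>2 = ((Re w - u) + (b - u))\<^sup>2" by algebra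
        then have "(Re w - b)\<^sup>2 \<le> 2 * (Re w - u)\<^sup>2 + 2 * (b - u)\<^sup>2"
          by (metis diff_ge_0_iff_ge zero_le_power2)
        then show ?thesis unfolding W_def using zero_le_power2[of "Im w"] unfolding distrib_left by linarith
      qed
      also have "\<dots> \<le> 2 * (R * 4 / (\<xi> j)\<^sup>2 * (b - u)\<^sup>2) + 2 * (b - u)\<^sup>2"
      proof -
        have "R * 1 \<le> R * (4 / (\<xi> j)\<^sup>2 * (b - u)\<^sup>2)"
          using R bu2 \<xi> by (intro mult_left_mono) (auto simp: field_simps)
        then show ?thesis using wR[OF u] by simp
      qed
      also have "\<dots> = q2 * (b - u)\<^sup>2" by (simp add: q2_def algebra_simps)
      finally have Wq: "W / (b - u)\<^sup>2 \<le> q2" using bupos by (simp add: pos_divide_le_eq)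
      have "transition i j (- s * s0) (a * a0 / (b - u)\<^sup>2) (b0 + s0 * a0 / (b - u)) (r - s * a / (b - u))"
        by (rule transition_comp[OF tr tru[OF u] ne])
      moreover have "hinv (- s * s0) (a * a0 / (b - u)\<^sup>2) (b0 + s0 * a0 / (b - u)) (r - s * a / (b - u)) z = hinv s0 a0 b0 u w"
        using hinv_hinv[OF inv(2) transitionD(1)[OF tr0] z0 inv(3) ne, of a0 b0 r] m(2) inv(1) by simp
      moreover have "a * a0 / (b - u)\<^sup>2 \<le> A * y"
      proof -
        have "a * a0 / (b - u)\<^sup>2 = a0 * y * (W / (b - u)\<^sup>2) / Im w" unfolding a by (simp add: mult.commute mult.left_commute)
        also have "\<dots> \<le> a0 * y * q2 / Im w"
          using a0 y w0 Wq by (intro divide_right_mono mult_left_mono) auto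
        also have "\<dots> \<le> a0 * y * q2 / y0"
          using a0 y w(2) yY(1) w0 q2 by (intro divide_left_mono) auto
        also have "\<dots> = A * y" by (simp add: A_def)
        finally show ?thesis .
      qed
      ultimately show ?thesis using u by blast
    qed
    then obtain u s' a' b' r' where u: "u = r0 \<or> u = r0 + \<xi> j" and tr': "transition i j s' a' b' r'"
      and zw: "hinv s' a' b' r' z = hinv s0 a0 b0 u w" and a'A: "a' \<le> A * y" by blast
    have a': "0 < a'" using transitionD(2)[OF tr'] .
    \<comment> \<open>Height at least \<open>q1\<close> after the transition means
      \<open>q1 * P \<le> a' * y\<close>. This bounds \<open>a'\<close> from below and, with
      \<open>a' \<le> A * y\<close>, the distance of \<open>r'\<close> from \<open>t\<close> from
      above.\<close>
    define P where "P = (t - r')\<^sup>2 + y\<^sup>2"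
    have P: "0 < P" using y by (simp add: P_def sq_sum_pos)
    have "a' * y / P = a0 * Im w / ((Re w - u)\<^sup>2 + (Im w)\<^sup>2)"
      using zw by (simp add: complex_eq_iff Im_hinv z_def P_def)
    also have "\<dots> \<ge> a0 * y0 / R"
      using a0 w(2) wR[OF u] w0 R yY(1) by (intro frac_le mult_left_mono) (auto simp: sq_sum_pos)
    finally have low: "q1 \<le> a' * y / P" by (simp add: q1_def)
    then have qP: "q1 * P \<le> a' * y" using P by (simp add: pos_le_divide_eq)
    have "q1 * y\<^sup>2 \<le> q1 * P" using q1 by (simp add: P_def)
    with qP have "q1 * y * y \<le> a' * y" by (simp add: power2_eq_square)
    then have ay: "q1 * y \<le> a'" using y by simp
    have "q1 * (t - r')\<^sup>2 \<le> q1 * P" using q1 by (simp add: P_def)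
    also note qP
    also have "a' * y \<le> A * y * y" using a'A y by (intro mult_right_mono) auto
    finally have "(t - r')\<^sup>2 \<le> A / q1 * y\<^sup>2" using q1 by (simp add: field_simps power2_eq_square)
    then have "\<bar>t - r'\<bar> \<le> sqrt (A / q1 * y\<^sup>2)" using real_le_rsqrt[of "\<bar>t - r'\<bar>"] by simp
    also have "\<dots> = sqrt (A / q1) * y" using y unfolding real_sqrt_mult by simp
    also have "\<dots> = \<eta> * sqrt (A / q1) * e\<^sup>2" by (simp add: y_def)
    also have "\<dots> \<le> 1 / 2 * e" using \<eta>2 e2 e sq \<eta> by (intro mult_mono) auto
    finally have "\<bar>r' - x\<bar> \<le> e" using t(1) by linarith
    then show ?thesis using tr' ay by (intro exI[of _ s'] exI[of _ a'] exI[of _ b'] exI[of _ r']) (simp add: y_def)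
  qed
  then show ?thesis using that[of "q1 * \<eta>"] q1 \<eta>(1) by simp
qed

end

section \<open>Chains of transitions\<close>

text \<open>Thales' equation of the half-circle over the segment between \<open>u\<close> and
  \<open>v\<close>; it is symmetric in the ends and avoids centre and radius.\<close>

definition on_geodesic :: "real \<Rightarrow> real \<Rightarrow> complex \<Rightarrow> bool" where
  "on_geodesic u v z \<longleftrightarrow> 0 < Im z \<and> (Re z - u) * (Re z - v) + (Im z)\<^sup>2 = 0"

lemma on_geodesic_hinv:
  assumes s: "s\<^sup>2 = 1" and z: "on_geodesic u v z" and ne: "u \<noteq> b" "v \<noteq> b" and a: "0 < a"
  shows "on_geodesic (r + s * a / (u - b)) (r + s * a / (v - b)) (hinv s a r b z)"
proof -
  define U V x y where "U = u - b" and "V = v - b" and "x = Re z - b" and "y = Im z"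
  define \<rho> where "\<rho> = x\<^sup>2 + y\<^sup>2"
  have y: "0 < y" using z by (simp add: on_geodesic_def y_def)
  have \<rho>: "0 < \<rho>" using y by (simp add: \<rho>_def sq_sum_pos)
  have UV: "U \<noteq> 0" "V \<noteq> 0" using ne by (auto simp: U_def V_def)
  have "(x - U) * (x - V) + y\<^sup>2 = 0" using z by (simp add: on_geodesic_def U_def V_def x_def y_def)
  then have eq: "\<rho> = (U + V) * x - U * V" by (simp add: \<rho>_def power2_eq_square algebra_simps)
  have ss: "s * s = 1" using s by (simp add: power2_eq_square)
  have "(s * a * x / \<rho> - s * a / U) * (s * a * x / \<rho> - s * a / V) + (a * y / \<rho>)\<^sup>2
    = (s * s) * a\<^sup>2 * ((x / \<rho> - 1 / U) * (x / \<rho> - 1 / V)) + a\<^sup>2 * y\<^sup>2 / \<rho>\<^sup>2"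
    by (simp add: power2_eq_square algebra_simps)
  also have "\<dots> = a\<^sup>2 * ((x / \<rho> - 1 / U) * (x / \<rho> - 1 / V) + y\<^sup>2 / \<rho>\<^sup>2)"
    by (simp add: ss distrib_left)
  also have "(x / \<rho> - 1 / U) * (x / \<rho> - 1 / V) + y\<^sup>2 / \<rho>\<^sup>2 = (x\<^sup>2 + y\<^sup>2) / \<rho>\<^sup>2 - (U + V) * x / (\<rho> * U * V) + 1 / (U * V)"
    using UV \<rho> by (simp add: field_simps power2_eq_square)
  also have "\<dots> = 1 / \<rho> - (U + V) * x / (\<rho> * U * V) + 1 / (U * V)"
    unfolding \<rho>_def[symmetric] using \<rho> by (simp add: power2_eq_square)
  also have "\<dots> = (U * V - (U + V) * x + \<rho>) / (\<rho> * U * V)"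
    using UV \<rho> by (simp add: field_simps)
  also have "\<dots> = 0" by (simp add: eq)
  finally have "(s * a * x / \<rho> - s * a / U) * (s * a * x / \<rho> - s * a / V) + (a * y / \<rho>)\<^sup>2 = 0" by simp
  moreover have "0 < a * y / \<rho>" using a y \<rho> by simp
  ultimately show ?thesis
    unfolding on_geodesic_def Re_hinv Im_hinv U_def V_def x_def y_def \<rho>_def by simp
qed

text \<open>For a half-circle ending at the pole, Thales' equation makes the denominator
  proportional to \<open>Re z - b\<close>, so the inversion opens it to a vertical line.\<close>

lemma Re_hinv_on_geodesic:
  assumes z: "on_geodesic b v z" and ne: "v \<noteq> b"
  shows "Re (hinv s a r b z) = r + s * a / (v - b)"
proof -
  define x y V where "x = Re z - b" and "y = Im z" and "V = v - b"
  have y: "0 < y" using z by (simp add: on_geodesic_def y_def)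
  have "x * (x - V) + y\<^sup>2 = 0" using z by (simp add: on_geodesic_def x_def y_def V_def)
  then have \<rho>: "x\<^sup>2 + y\<^sup>2 = V * x" by (simp add: power2_eq_square algebra_simps)
  moreover have "0 < x\<^sup>2 + y\<^sup>2" using y by (rule sq_sum_pos)
  ultimately have "x \<noteq> 0" by auto
  then have "s * a * x / (x\<^sup>2 + y\<^sup>2) = s * a / V" unfolding \<rho> by simp
  then show ?thesis by (simp add: Re_hinv x_def y_def V_def)
qed

text \<open>The smaller root \<open>w\<close> of \<open>w * (D - w) = t\<^sup>2\<close> satisfies
  \<open>D - w \<ge> D / 2\<close>: a half-circle of large diameter rises almost vertically at its
  ends.\<close>

lemma ex_on_geodesic_near_end:
  assumes t: "0 < t" and D: "2 * t \<le> u - v"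
  obtains x where "on_geodesic u v (Complex x t)" "v \<le> x" "x - v \<le> 2 * t\<^sup>2 / (u - v)"
proof -
  define D where "D = u - v"
  define q where "q = sqrt (D\<^sup>2 - 4 * t\<^sup>2)"
  have D0: "0 < D" "2 * t \<le> D" using assms by (auto simp: D_def)
  have "(2 * t)\<^sup>2 \<le> D\<^sup>2" using D0 t by (intro power_mono) auto
  then have nn: "0 \<le> D\<^sup>2 - 4 * t\<^sup>2" by (simp add: power_mult_distrib)
  have q2: "q\<^sup>2 = D\<^sup>2 - 4 * t\<^sup>2" unfolding q_def by (rule real_sqrt_pow2[OF nn])
  have q0: "0 \<le> q" unfolding q_def by (rule real_sqrt_ge_zero[OF nn])
  have "q\<^sup>2 \<le> D\<^sup>2" unfolding q2 by simp
  then have qD: "q \<le> D" by (rule power2_le_imp_le) (rule less_imp_le[OF D0(1)])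
  define w where "w = (D - q) / 2"
  have w0: "0 \<le> w" using qD by (simp add: w_def)
  have weq: "w * (D - w) = t\<^sup>2"
  proof -
    have "w * (D - w) = (D\<^sup>2 - q\<^sup>2) / 4" by (simp add: w_def power2_eq_square field_simps)
    then show ?thesis by (simp add: q2)
  qed
  have "w * (D / 2) \<le> w * (D - w)" using w0 q0 by (intro mult_left_mono) (auto simp: w_def)
  then have "w \<le> 2 * t\<^sup>2 / D" using weq D0 by (simp add: field_simps)
  moreover have "on_geodesic u v (Complex (v + w) t)"
    using weq t unfolding on_geodesic_def D_def by (simp add: algebra_simps)
  ultimately show ?thesis using w0 by (intro that[of "v + w"]) (auto simp: D_def)
qed

lemma divide_square_le:
  fixes x y t :: real
  assumes "1 \<le> t" "t \<le> \<bar>x\<bar>" "0 \<le> c"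
  shows "c / (x\<^sup>2 + y\<^sup>2) \<le> c / t"
proof -
  have "t * 1 \<le> t * t" using assms by (intro mult_left_mono) auto
  also have "t * t \<le> \<bar>x\<bar> * \<bar>x\<bar>" using assms by (intro mult_mono) auto
  finally have "t \<le> x\<^sup>2 + y\<^sup>2" by (simp add: power2_eq_square[symmetric] add_increasing2)
  then show ?thesis using assms by (intro divide_left_mono) (auto intro!: mult_pos_pos)
qed

lemma abs_divide_square_le:
  fixes x y :: real
  assumes "x \<noteq> 0"
  shows "\<bar>x\<bar> / (x\<^sup>2 + y\<^sup>2) \<le> 1 / \<bar>x\<bar>"
proof -
  have "\<bar>x\<bar> / (x\<^sup>2 + y\<^sup>2) \<le> \<bar>x\<bar> / x\<^sup>2" using assms by (intro divide_left_mono) (auto simp: add_pos_nonneg)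
  also have "\<dots> = 1 / \<bar>x\<bar>" using assms by (cases "0 < x") (auto simp: power2_eq_square)
  finally show ?thesis .
qed

context cusped_surface
begin

text \<open>\<open>M\<close> is the least translation used in a chain, \<open>W\<close> bounds the
  periods, and columns have half-width \<open>\<delta>\<close> and heights from \<open>y0\<close> to
  \<open>H\<close>. \<open>M1\<close>, \<open>M2\<close> and the bound on \<open>\<delta>\<close>
  split the allowed horizontal error \<open>\<epsilon> * t\<close> at height \<open>t\<close> into
  thirds; \<open>M3\<close> keeps the chosen point of the arc within \<open>1 / 2\<close> of its
  end; \<open>M4\<close> to \<open>M6\<close> keep heights in the first and last coordinates below
  \<open>h0\<close>.\<close>

context
  fixes j0 :: 'i and M H y0 \<epsilon> h0 \<delta> W :: real
  assumes j0: "j0 \<in> I" and H: "1 \<le> H" and y0: "0 < y0" "y0 \<le> 1" and \<epsilon>: "0 < \<epsilon>" and h0: "0 < h0"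
    and \<delta>: "0 \<le> \<delta>" "\<delta> \<le> \<epsilon> * y0 / 3"
    and M1: "3 / (\<epsilon> * y0) \<le> M - 2" and M2: "6 * H / \<epsilon> \<le> M - 2" and M3: "4 * H\<^sup>2 \<le> M - 2"
    and M4: "2 / y0 + 2 \<le> M" and M5: "2 / (y0 * h0) \<le> M" and M6: "H / h0 \<le> M - 2"
    and W: "\<And>i. i \<in> I \<Longrightarrow> \<xi> i \<le> W"
begin

lemma M_ge: "6 \<le> M" "4 * H \<le> M - 2"
proof -
  have "H * 1 \<le> H * H" using H by (intro mult_left_mono) auto
  then have "4 * H \<le> 4 * H\<^sup>2" by (simp add: power2_eq_square)
  then show "4 * H \<le> M - 2" using M3 by simp
  then show "6 \<le> M" using H by simp
qed

lemma W_pos: "0 < W" using W[OF j0] \<xi>_pos[OF j0] by simp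

definition column :: "'i \<Rightarrow> real \<Rightarrow> 'a set" where
  "column i r = p i ` {w. \<bar>Re w - r\<bar> \<le> \<delta> \<and> y0 \<le> Im w \<and> Im w \<le> H}"

text \<open>
  \<open>tail i r \<Lambda> Z\<close> describes a chain of cost at most \<open>\<Lambda>\<close> from the cusp \<open>i\<close>, whose first transition
  starts at \<open>r\<close>, to the cusp \<open>j0\<close>: the geodesic to its end point \<open>P\<close> from any point \<open>\<beta>\<close> far to the
  right comes close to all points of \<open>Z\<close>. The bounds on the heights in the first and in the last
  coordinate ensure that this happens between the two truncating horocycles.
\<close>

definition tail :: "'i \<Rightarrow> real \<Rightarrow> real \<Rightarrow> 'a set \<Rightarrow> bool" where
  "tail i r \<Lambda> Z \<longleftrightarrow> (\<exists>S A B P. transition i j0 S A B P \<and> \<bar>P - r\<bar> \<le> 1 / 2 \<and> ln (1 / A) \<le> \<Lambda> \<and>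
     (\<forall>\<beta> y. r + M - 1 \<le> \<beta> \<longrightarrow> y \<in> Z \<longrightarrow> (\<exists>z. on_geodesic \<beta> P z \<and> \<bar>Re z - r\<bar> \<le> 1 \<and> Im z \<le> H \<and>
        Im (hinv S A B P z) \<le> h0 \<and> dist y (p i z) \<le> \<epsilon>)))"

lemma tail_single: "transition i j0 s a b r \<Longrightarrow> tail i r (ln (1 / a)) {}"
  unfolding tail_def by (intro exI[of _ s] exI[of _ a] exI[of _ b] exI[of _ r]) simp

text \<open>\<open>1 / A\<close> of a composite is a product, so costs add. The bound on
  \<open>D\<close> allows for a translate that exceeds \<open>M\<close> by up to a period and for
  \<open>P\<close> being up to \<open>1 / 2\<close> away from \<open>r'\<close>.\<close>

lemma composite_ln:
  assumes "0 < a" "0 < A" "0 < D" "D \<le> M + W + 1" "ln (1 / A) \<le> \<Lambda>"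
  shows "ln (1 / (a * A / D\<^sup>2)) \<le> ln (1 / a) + \<Lambda> + 2 * ln (M + W + 1)"
proof -
  have "ln (1 / (a * A / D\<^sup>2)) = ln ((1 / a) * (1 / A) * D\<^sup>2)"
    using assms by (intro arg_cong[of _ _ ln]) (simp add: field_simps)
  also have "\<dots> = ln (1 / a) + ln (1 / A) + 2 * ln D"
    using assms by (simp add: ln_mult ln_div ln_realpow)
  also have "ln D \<le> ln (M + W + 1)" using assms by (subst ln_le_cancel_iff) auto
  finally show ?thesis using assms(5) by simp
qed

text \<open>Points near \<open>r'\<close> are at distance at least \<open>M - 1\<close> from the
  pole \<open>b\<close>, so the inversion throws them close to \<open>r\<close> and down to height
  at most \<open>H / (M - 1)\<close>. Earlier coordinates thus see later parts of the geodesic low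
  down.\<close>

lemma pull_back:
  assumes tr: "transition i j s a b r" and ij: "i \<in> I" "j \<in> I" and b: "M \<le> b - r'"
    and z': "on_geodesic \<beta>' P z'" "\<bar>Re z' - r'\<bar> \<le> 1" "Im z' \<le> H"
  defines "z \<equiv> hinv s a r b z'"
  shows "0 < Im z" "hinv s a b r z = z'" "p i z = p j z'" "\<bar>Re z - r\<bar> \<le> 1" "Im z \<le> min H h0"
proof -
  have z'0: "0 < Im z'" using z'(1) by (simp add: on_geodesic_def)
  have a: "0 < a" "a \<le> 1" using transitionD(2)[OF tr] transition_le_1[OF tr ij] by auto
  show z0: "0 < Im z"
    unfolding z_def using z'0 transitionD(4)[OF transition_inverse[OF tr]] by (rule hyp_iso_Im_pos[rotated])
  show zz': "hinv s a b r z = z'"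
    unfolding z_def using hinv_inverse[OF transitionD(1,2)[OF tr] z'0, of b r] .
  show "p i z = p j z'" using transitionD(3)[OF tr z0] zz' by simp
  have far: "M - 1 \<le> \<bar>Re z' - b\<bar>" using z'(2) b by linarith
  have "\<bar>Re z - r\<bar> = a * (\<bar>Re z' - b\<bar> / ((Re z' - b)\<^sup>2 + (Im z')\<^sup>2))"
    using transitionD(1)[OF tr] a by (simp add: z_def Re_hinv abs_mult power2_eq_1_iff) auto
  also have "\<dots> \<le> 1 * (1 / \<bar>Re z' - b\<bar>)"
    using a far M_ge by (intro mult_mono abs_divide_square_le) auto
  also have "\<dots> \<le> 1" using far M_ge by simp
  finally show "\<bar>Re z - r\<bar> \<le> 1" .
  have "Im z = a * (Im z' / ((Re z' - b)\<^sup>2 + (Im z')\<^sup>2))" by (simp add: z_def Im_hinv)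
  also have "\<dots> \<le> 1 * (Im z' / ((Re z' - b)\<^sup>2 + (Im z')\<^sup>2))"
    using a z'0 by (intro mult_right_mono) auto
  also have "\<dots> \<le> Im z' / (M - 1)"
    using divide_square_le[of "M - 1" "Re z' - b" "Im z'" "Im z'"] M_ge far z'0 by simp
  also have "\<dots> \<le> H / (M - 1)" using z'(3) M_ge by (intro divide_right_mono) auto
  finally have *: "Im z \<le> H / (M - 1)" .
  have "H / (M - 1) \<le> H / 1" using M_ge H by (intro divide_left_mono) auto
  moreover have "H / (M - 1) \<le> h0"
  proof -
    have "H / h0 \<le> M - 1" using M6 by simp
    then have "H \<le> (M - 1) * h0" using h0 by (simp add: pos_divide_le_eq)
    then show ?thesis using M_ge by (simp add: pos_divide_le_eq mult.commute)
  qed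
  ultimately show "Im z \<le> min H h0" using * by simp
qed

text \<open>Points of \<open>Z\<close> are reached by the old geodesic from the image
  \<open>\<beta>'\<close> of \<open>\<beta>\<close>, which is still far to the right of
  \<open>r'\<close>. The new column is reached near the end \<open>P'\<close>, which lies within
  \<open>1 / (M - 1)\<close> of \<open>r\<close> and from which the geodesic rises almost
  vertically.\<close>

lemma tail_step:
  assumes tr: "transition i j s a b r" and ij: "i \<in> I" "j \<in> I" and tl: "tail j r' \<Lambda> Z"
    and b: "M \<le> b - r'" "b - r' \<le> M + \<xi> j"
  shows "tail i r (ln (1 / a) + \<Lambda> + 2 * ln (M + W + 1)) (Z \<union> column i r)"
proof -
  obtain S A B P where P: "transition j j0 S A B P" "\<bar>P - r'\<bar> \<le> 1 / 2" "ln (1 / A) \<le> \<Lambda>"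
    and Z: "\<And>\<beta> y. r' + M - 1 \<le> \<beta> \<Longrightarrow> y \<in> Z \<Longrightarrow> \<exists>z. on_geodesic \<beta> P z \<and> \<bar>Re z - r'\<bar> \<le> 1 \<and> Im z \<le> H \<and>
        Im (hinv S A B P z) \<le> h0 \<and> dist y (p j z) \<le> \<epsilon>"
    using tl unfolding tail_def by blast
  define D where "D = b - P"
  define A' B' P' where "A' = a * A / D\<^sup>2" and "B' = B + S * A / D" and "P' = r - s * a / D"
  have D: "M - 1 / 2 \<le> D" "D \<le> M + W + 1" using P(2) b W[OF ij(2)] unfolding D_def by linarith+
  have D0: "0 < D" using D M_ge by simp
  have a: "0 < a" "a \<le> 1" using transitionD(2)[OF tr] transition_le_1[OF tr ij] by auto
  have A: "0 < A" "A \<le> 1" using transitionD(2)[OF P(1)] transition_le_1[OF P(1) ij(2) j0] by auto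
  have s: "s\<^sup>2 = 1" "\<bar>s\<bar> = 1" "s * s = 1" using transitionD(1)[OF tr] by (auto simp: power2_eq_1_iff)
  have ne: "b \<noteq> P" using D0 by (simp add: D_def)
  have trP: "transition i j0 (- s * S) A' B' P'"
    using transition_comp[OF tr P(1) ne] by (simp add: A'_def B'_def P'_def D_def)
  have comp: "hinv (- s * S) A' B' P' z = hinv S A B P (hinv s a b r z)" if "0 < Im z" for z
    using hinv_hinv[OF s(1) transitionD(1)[OF P(1)] that a(1) ne, of A B r] by (simp add: A'_def B'_def P'_def D_def)
  have P'r: "\<bar>P' - r\<bar> \<le> 1 / (M - 1)"
  proof -
    have "\<bar>P' - r\<bar> = a / D" using D0 a s by (simp add: P'_def abs_mult)
    also have "\<dots> \<le> 1 / (M - 1)" using a D M_ge by (intro frac_le) auto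
    finally show ?thesis .
  qed
  have P'half: "1 / (M - 1) \<le> 1 / 2" using M_ge by simp
  have "\<exists>z. on_geodesic \<beta> P' z \<and> \<bar>Re z - r\<bar> \<le> 1 \<and> Im z \<le> H \<and>
        Im (hinv (- s * S) A' B' P' z) \<le> h0 \<and> dist y (p i z) \<le> \<epsilon>"
    if \<beta>: "r + M - 1 \<le> \<beta>" and y: "y \<in> Z \<union> column i r" for \<beta> y
    using y
  proof
    assume y: "y \<in> Z"
    define \<beta>' where "\<beta>' = b + s * a / (\<beta> - r)"
    have \<beta>r: "M - 1 \<le> \<beta> - r" "0 < \<beta> - r" using \<beta> M_ge by auto
    have "\<bar>\<beta>' - b\<bar> = a / (\<beta> - r)" using \<beta>r a s by (simp add: \<beta>'_def abs_mult)
    also have "\<dots> \<le> 1 / (M - 1)" using a \<beta>r M_ge by (intro frac_le) auto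
    finally have "r' + M - 1 \<le> \<beta>'" using b(1) P'half by linarith
    then obtain z' where z': "on_geodesic \<beta>' P z'" "\<bar>Re z' - r'\<bar> \<le> 1" "Im z' \<le> H"
        "Im (hinv S A B P z') \<le> h0" "dist y (p j z') \<le> \<epsilon>"
      using Z[OF _ y] by blast
    note pb = pull_back[OF tr ij b(1) z'(1-3)]
    have "\<beta>' \<noteq> b" using \<beta>r a s by (auto simp: \<beta>'_def)
    then have "on_geodesic (r + s * a / (\<beta>' - b)) (r + s * a / (P - b)) (hinv s a r b z')"
      using on_geodesic_hinv[OF s(1) z'(1) _ ne[symmetric] a(1)] by blast
    moreover have "r + s * a / (\<beta>' - b) = \<beta>" using \<beta>r a s(2) by (auto simp: \<beta>'_def)
    moreover have "r + s * a / (P - b) = P'"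
      by (simp add: P'_def D_def) (metis minus_diff_eq minus_divide_right uminus_add_conv_diff add.commute)
    ultimately have "on_geodesic \<beta> P' (hinv s a r b z')" by simp
    then show ?thesis
      using pb z'(4,5) comp[OF pb(1)] by (intro exI[of _ "hinv s a r b z'"]) auto
  next
    assume "y \<in> column i r"
    then obtain w where w: "y = p i w" "\<bar>Re w - r\<bar> \<le> \<delta>" "y0 \<le> Im w" "Im w \<le> H"
      by (auto simp: column_def)
    define t where "t = Im w"
    have t: "0 < t" "y0 \<le> t" "t \<le> H" using w y0 by (auto simp: t_def)
    have E: "M - 2 \<le> \<beta> - P'" using \<beta> P'r P'half by linarith
    have E0: "0 < \<beta> - P'" "2 * t \<le> \<beta> - P'" using E M_ge t by auto
    obtain x where x: "on_geodesic \<beta> P' (Complex x t)" "P' \<le> x" "x - P' \<le> 2 * t\<^sup>2 / (\<beta> - P')"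
      using ex_on_geodesic_near_end[OF t(1) E0(2)] by blast
    have "2 * t\<^sup>2 / (\<beta> - P') \<le> 2 * (t * H) / (M - 2)"
      using t E M_ge by (intro frac_le) (auto simp: power2_eq_square)
    also have "\<dots> \<le> t * \<epsilon> / 3"
    proof -
      have "6 * H \<le> (M - 2) * \<epsilon>" using M2 \<epsilon> by (simp add: pos_divide_le_eq)
      then have "t * (6 * H) \<le> t * ((M - 2) * \<epsilon>)" using t by (intro mult_left_mono) auto
      then show ?thesis using M_ge by (simp add: pos_divide_le_eq algebra_simps)
    qed
    finally have x1: "x - P' \<le> t * \<epsilon> / 3" using x(3) by simp
    have "2 * t\<^sup>2 / (\<beta> - P') \<le> 2 * H\<^sup>2 / (M - 2)"
      using t E M_ge by (intro frac_le mult_left_mono power_mono) auto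
    also have "\<dots> \<le> 1 / 2" using M3 M_ge by (simp add: pos_divide_le_eq)
    finally have x2: "x - P' \<le> 1 / 2" using x(3) by simp
    \<comment> \<open>The three thirds: from \<open>w\<close> to \<open>r\<close>, from
      \<open>r\<close> to \<open>P'\<close>, and from \<open>P'\<close> to \<open>x\<close>.\<close>
    have "\<bar>Re w - x\<bar> \<le> \<epsilon> * t"
    proof -
      have "3 \<le> (M - 2) * (\<epsilon> * y0)" using M1 \<epsilon> y0 by (simp add: pos_divide_le_eq)
      also have "\<dots> \<le> (M - 1) * (\<epsilon> * y0)" using \<epsilon> y0 by (intro mult_right_mono) auto
      finally have "1 / (M - 1) \<le> \<epsilon> * y0 / 3" using M_ge by (simp add: field_simps)
      moreover have "\<epsilon> * y0 \<le> \<epsilon> * t" using t \<epsilon> by simp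
      ultimately show ?thesis using x1 x(2) w(2) \<delta>(2) P'r by (simp add: abs_le_iff mult.commute)
    qed
    then have dist: "dist y (p i (Complex x t)) \<le> \<epsilon>"
    proof -
      have *: "dist (p i (Complex x1 t)) (p i (Complex x2 t)) \<le> (x2 - x1) / t" if "x1 \<le> x2" for x1 x2
        by (rule dist_le_horizontal[OF p_iso[OF ij(1)]]) (use t that in auto)
      have "w = Complex (Re w) t" by (simp add: t_def)
      then have "dist y (p i (Complex x t)) \<le> \<bar>Re w - x\<bar> / t"
        using *[of "Re w" x] *[of x "Re w"] w(1) by (cases "Re w \<le> x") (auto simp: dist_commute)
      also have "\<dots> \<le> \<epsilon>" using \<open>\<bar>Re w - x\<bar> \<le> \<epsilon> * t\<close> t by (simp add: pos_divide_le_eq)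
      finally show ?thesis .
    qed
    \<comment> \<open>The transition sends this point to within \<open>1 / y0\<close> of
      \<open>b\<close> horizontally, hence far from \<open>P\<close>, so that the rest of the chain
      takes it to height at most \<open>h0\<close>.\<close>
    define z' where "z' = hinv s a b r (Complex x t)"
    define \<rho> where "\<rho> = (x - r)\<^sup>2 + t\<^sup>2"
    have \<rho>: "0 < \<rho>" "t\<^sup>2 \<le> \<rho>" "\<bar>x - r\<bar> * t \<le> \<rho>"
    proof -
      show "0 < \<rho>" "t\<^sup>2 \<le> \<rho>" using t by (auto simp: \<rho>_def sq_sum_pos)
      have "0 \<le> (\<bar>x - r\<bar> - t)\<^sup>2" by simp
      then have "2 * (\<bar>x - r\<bar> * t) \<le> \<rho>" by (simp add: \<rho>_def power2_diff)
      moreover have "0 \<le> \<bar>x - r\<bar> * t" using t by simp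
      ultimately show "\<bar>x - r\<bar> * t \<le> \<rho>" by linarith
    qed
    have Imz': "0 < Im z'" "Im z' \<le> 1 / y0"
    proof -
      show "0 < Im z'" unfolding z'_def using transitionD(4)[OF tr] t by (simp add: hyp_iso_Im_pos)
      have "Im z' = a * (t / \<rho>)" by (simp add: z'_def Im_hinv \<rho>_def)
      also have "\<dots> \<le> 1 * (t / t\<^sup>2)" using a t \<rho> by (intro mult_mono divide_left_mono) auto
      also have "\<dots> = 1 / t" using t by (simp add: power2_eq_square)
      also have "\<dots> \<le> 1 / y0" using t y0 by (intro divide_left_mono) auto
      finally show "Im z' \<le> 1 / y0" .
    qed
    have Rez': "\<bar>Re z' - b\<bar> \<le> 1 / y0"
    proof -
      have "\<bar>Re z' - b\<bar> = a * (\<bar>x - r\<bar> / \<rho>)" using a s \<rho> by (simp add: z'_def Re_hinv \<rho>_def abs_mult)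
      also have "\<dots> \<le> 1 * (1 / t)" using a t \<rho> by (intro mult_mono) (auto simp: field_simps)
      also have "\<dots> \<le> 1 / y0" using t y0 by (simp add: divide_left_mono)
      finally show ?thesis .
    qed
    have far: "M / 2 \<le> \<bar>Re z' - P\<bar>"
    proof -
      have "1 / y0 + 1 \<le> M / 2" using M4 by simp
      then show ?thesis using Rez' P(2) b(1) by linarith
    qed
    have "Im (hinv S A B P z') = A * (Im z' / ((Re z' - P)\<^sup>2 + (Im z')\<^sup>2))" by (simp add: Im_hinv)
    also have "\<dots> \<le> 1 * (Im z' / (M / 2))"
      using A Imz' far M_ge by (intro mult_mono divide_square_le) auto
    also have "\<dots> \<le> (1 / y0) / (M / 2)"
      unfolding mult_1 using Imz' M_ge by (intro divide_right_mono) auto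
    also have "\<dots> \<le> h0" using M5 M_ge y0 h0 by (simp add: field_simps)
    finally have "Im (hinv (- s * S) A' B' P' (Complex x t)) \<le> h0"
      using comp[of "Complex x t"] t by (simp add: z'_def)
    moreover have "\<bar>Re (Complex x t) - r\<bar> \<le> 1" using P'r P'half x(2) x2 by simp
    ultimately show ?thesis using x(1) dist t by (intro exI[of _ "Complex x t"]) simp
  qed
  moreover have "\<bar>P' - r\<bar> \<le> 1 / 2" using P'r P'half by linarith
  moreover have "ln (1 / A') \<le> ln (1 / a) + \<Lambda> + 2 * ln (M + W + 1)"
    unfolding A'_def using composite_ln a A D0 D(2) P(3) by simp
  ultimately show ?thesis unfolding tail_def using trP by blast
qed

lemma ex_shift:
  assumes "j \<in> I"
  obtains k :: int where "M \<le> b + of_int k * \<xi> j - r'" "b + of_int k * \<xi> j - r' \<le> M + \<xi> j"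
proof -
  have \<xi>: "0 < \<xi> j" using \<xi>_pos assms .
  define c where "c = M + r' - b"
  show ?thesis
    using floor_divide_lower[OF \<xi>, of c] floor_divide_upper[OF \<xi>, of c]
    by (intro that[of "\<lfloor>c / \<xi> j\<rfloor> + 1"]) (auto simp: c_def algebra_simps)
qed

lemma tail_mono: "tail i r \<Lambda> Z \<Longrightarrow> \<Lambda> \<le> \<Lambda>' \<Longrightarrow> Z' \<subseteq> Z \<Longrightarrow> tail i r \<Lambda>' Z'"
  unfolding tail_def by (meson order_trans subsetD)

text \<open>The columns belong to various cusps, while the chain must always resume from
  \<open>j0\<close>. So each listed transition from \<open>i\<close> to \<open>j0\<close> is
  preceded by its inverse, whence the factor 2; for the empty list a given transition is run back
  and forth.\<close>

lemma tail_list: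
  assumes x: "i0 \<in> I" "transition i0 j0 s0 a0 b0 r0" "ln (1 / a0) \<le> l"
    and ts: "\<And>i s a b r. (i, s, a, b, r) \<in> set ts \<Longrightarrow> i \<in> I \<and> transition i j0 s a b r \<and> ln (1 / a) \<le> l"
    and l: "0 \<le> l"
  shows "\<exists>b. tail j0 b (2 * (real (length ts) + 1) * (l + 2 * ln (M + W + 1)))
    (\<Union>(i, s, a, b, r)\<in>set ts. column i r)"
  using ts
proof (induction ts)
  case Nil
  obtain k :: int where k: "M \<le> r0 + of_int k * \<xi> i0 - r0" "r0 + of_int k * \<xi> i0 - r0 \<le> M + \<xi> i0"
    using ex_shift[OF x(1)] by blast
  have ln0: "0 \<le> ln (M + W + 1)" using M_ge W_pos by (intro ln_ge_zero) auto
  have "tail j0 b0 (ln (1 / a0) + ln (1 / a0) + 2 * ln (M + W + 1)) ({} \<union> column j0 b0)"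
    by (rule tail_step[OF transition_shift_target[OF transition_inverse[OF x(2)] x(1)] j0 x(1)
          tail_single[OF x(2)] k])
  then have "tail j0 b0 (2 * (real (length []) + 1) * (l + 2 * ln (M + W + 1)))
    (\<Union>(i, s, a, b, r)\<in>set []. column i r)"
    by (rule tail_mono) (use x(3) ln0 in auto)
  then show ?case by blast
next
  case (Cons y ts)
  obtain i s a b r where y: "y = (i, s, a, b, r)" by (cases y)
  have tr: "i \<in> I" "transition i j0 s a b r" "ln (1 / a) \<le> l" using Cons.prems[of i s a b r] y by auto
  obtain b' where b': "tail j0 b' (2 * (real (length ts) + 1) * (l + 2 * ln (M + W + 1)))
    (\<Union>(i, s, a, b, r)\<in>set ts. column i r)"
    using Cons.IH Cons.prems by (metis list.set_intros(2))
  obtain k :: int where k: "M \<le> b + of_int k * \<xi> j0 - b'" "b + of_int k * \<xi> j0 - b' \<le> M + \<xi> j0"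
    using ex_shift[OF j0] by blast
  note 1 = tail_step[OF transition_shift_target[OF tr(2) j0] tr(1) j0 b' k]
  obtain k' :: int where k': "M \<le> r + of_int k' * \<xi> i - r" "r + of_int k' * \<xi> i - r \<le> M + \<xi> i"
    using ex_shift[OF tr(1)] by blast
  note 2 = tail_step[OF transition_shift_target[OF transition_inverse[OF tr(2)] tr(1)] j0 tr(1) 1 k']
  have "tail j0 b (2 * (real (length (y # ts)) + 1) * (l + 2 * ln (M + W + 1)))
    (\<Union>(i, s, a, b, r)\<in>set (y # ts). column i r)"
    by (rule tail_mono[OF 2]) (use tr(3) y in \<open>auto simp: algebra_simps\<close>)
  then show ?case by blast
qed

text \<open>One last transition has its pole \<open>b1\<close> far to the right of
  \<open>r'\<close>. Taking this pole as the free end \<open>\<beta>\<close> makes the geodesic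
  vertical in the new coordinate, so that both of its ends are cusps.\<close>

lemma chain_geodesic:
  assumes tr: "transition j0 j0 s a b r" "ln (1 / a) \<le> l" and tl: "tail j0 r' \<Lambda> Z"
  obtains S A B P where "transition j0 j0 S A B P" "ln (1 / A) \<le> l + \<Lambda> + 2 * ln (M + W + 1)"
    "\<And>y. y \<in> Z \<Longrightarrow> \<exists>t>0. t \<le> h0 \<and> A / t \<le> h0 \<and> dist y (p j0 (Complex P t)) \<le> \<epsilon>"
proof -
  obtain k :: int where k: "M \<le> b + of_int k * \<xi> j0 - r'" "b + of_int k * \<xi> j0 - r' \<le> M + \<xi> j0"
    using ex_shift[OF j0] by blast
  define b1 where "b1 = b + of_int k * \<xi> j0"
  have tr1: "transition j0 j0 s a b1 r" unfolding b1_def by (rule transition_shift_target[OF tr(1) j0])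
  have b1: "M \<le> b1 - r'" "b1 - r' \<le> M + \<xi> j0" using k by (auto simp: b1_def)
  obtain S A B P where P: "transition j0 j0 S A B P" "\<bar>P - r'\<bar> \<le> 1 / 2" "ln (1 / A) \<le> \<Lambda>"
    and Z: "\<And>\<beta> y. r' + M - 1 \<le> \<beta> \<Longrightarrow> y \<in> Z \<Longrightarrow> \<exists>z. on_geodesic \<beta> P z \<and> \<bar>Re z - r'\<bar> \<le> 1 \<and> Im z \<le> H \<and>
        Im (hinv S A B P z) \<le> h0 \<and> dist y (p j0 z) \<le> \<epsilon>"
    using tl unfolding tail_def by blast
  define D where "D = b1 - P"
  define A' B' P' where "A' = a * A / D\<^sup>2" and "B' = B + S * A / D" and "P' = r - s * a / D"
  have D: "M - 1 / 2 \<le> D" "D \<le> M + W + 1" using P(2) b1 W[OF j0] unfolding D_def by linarith+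
  have D0: "0 < D" using D M_ge by simp
  have ne: "b1 \<noteq> P" using D0 by (simp add: D_def)
  have trP: "transition j0 j0 (- s * S) A' B' P'"
    using transition_comp[OF tr1 P(1) ne] by (simp add: A'_def B'_def P'_def D_def)
  show ?thesis
  proof (rule that[OF trP])
    have "ln (1 / A') \<le> ln (1 / a) + \<Lambda> + 2 * ln (M + W + 1)"
      unfolding A'_def using composite_ln transitionD(2)[OF tr1] transitionD(2)[OF P(1)] D0 D(2) P(3) by simp
    then show "ln (1 / A') \<le> l + \<Lambda> + 2 * ln (M + W + 1)" using tr(2) by simp
    fix y assume "y \<in> Z"
    moreover have "r' + M - 1 \<le> b1" using b1 by simp
    ultimately obtain z' where z': "on_geodesic b1 P z'" "\<bar>Re z' - r'\<bar> \<le> 1" "Im z' \<le> H"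
        "Im (hinv S A B P z') \<le> h0" "dist y (p j0 z') \<le> \<epsilon>"
      using Z by blast
    note pb = pull_back[OF tr1 j0 j0 b1(1) z'(1-3)]
    define t where "t = Im (hinv s a r b1 z')"
    have "Re (hinv s a r b1 z') = r + s * a / (P - b1)"
      using Re_hinv_on_geodesic[OF z'(1)] ne by metis
    also have "\<dots> = P'"
      by (simp add: P'_def D_def) (metis minus_diff_eq minus_divide_right uminus_add_conv_diff add.commute)
    finally have z: "hinv s a r b1 z' = Complex P' t" by (simp add: complex_eq_iff t_def)
    have t: "0 < t" "t \<le> h0" using pb by (auto simp: t_def)
    have "hinv (- s * S) A' B' P' (Complex P' t) = hinv S A B P z'"
      using hinv_hinv[OF transitionD(1)[OF tr1] transitionD(1)[OF P(1)] pb(1) transitionD(2)[OF tr1] ne, of A B r]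
        pb(2) z by (simp add: A'_def B'_def P'_def D_def)
    then have "Im (hinv (- s * S) A' B' P' (Complex P' t)) \<le> h0" using z'(4) by simp
    then have "A' / t \<le> h0" using t by (simp add: Im_hinv power2_eq_square)
    moreover have "p j0 (Complex P' t) = p j0 z'" using pb(3) z by simp
    ultimately show "\<exists>t>0. t \<le> h0 \<and> A' / t \<le> h0 \<and> dist y (p j0 (Complex P' t)) \<le> \<epsilon>"
      using t z'(5) by (intro exI[of _ t]) simp
  qed
qed

lemma chain_geodesic_list:
  assumes tr: "transition j0 j0 s0 a0 b0 r0" "ln (1 / a0) \<le> l"
    and ts: "\<And>i s a b r. (i, s, a, b, r) \<in> set ts \<Longrightarrow> i \<in> I \<and> transition i j0 s a b r \<and> ln (1 / a) \<le> l"
    and l: "0 \<le> l"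
  obtains S A B P where "transition j0 j0 S A B P"
    "ln (1 / A) \<le> (2 * real (length ts) + 3) * (l + 2 * ln (M + W + 1))"
    "\<And>i s a b r w. (i, s, a, b, r) \<in> set ts \<Longrightarrow> \<bar>Re w - r\<bar> \<le> \<delta> \<Longrightarrow> y0 \<le> Im w \<Longrightarrow> Im w \<le> H \<Longrightarrow>
      \<exists>t>0. t \<le> h0 \<and> A / t \<le> h0 \<and> dist (p i w) (p j0 (Complex P t)) \<le> \<epsilon>"
proof -
  obtain b where b: "tail j0 b (2 * (real (length ts) + 1) * (l + 2 * ln (M + W + 1)))
    (\<Union>(i, s, a, b, r)\<in>set ts. column i r)"
    using tail_list[OF j0 tr ts l] by blast
  obtain S A B P where P: "transition j0 j0 S A B P"
    "ln (1 / A) \<le> l + 2 * (real (length ts) + 1) * (l + 2 * ln (M + W + 1)) + 2 * ln (M + W + 1)"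
    "\<And>y. y \<in> (\<Union>(i, s, a, b, r)\<in>set ts. column i r) \<Longrightarrow>
      \<exists>t>0. t \<le> h0 \<and> A / t \<le> h0 \<and> dist y (p j0 (Complex P t)) \<le> \<epsilon>"
    using chain_geodesic[OF tr b] by blast
  show ?thesis
  proof (rule that[OF P(1)])
    show "ln (1 / A) \<le> (2 * real (length ts) + 3) * (l + 2 * ln (M + W + 1))"
      using P(2) by (simp add: algebra_simps)
    fix i s a b r w
    assume "(i, s, a, b, r) \<in> set ts" "\<bar>Re w - r\<bar> \<le> \<delta>" "y0 \<le> Im w" "Im w \<le> H"
    then show "\<exists>t>0. t \<le> h0 \<and> A / t \<le> h0 \<and> dist (p i w) (p j0 (Complex P t)) \<le> \<epsilon>"
      by (intro P(3)) (force simp: column_def)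
  qed
qed

end

end

section \<open>Orthogeodesics in the upper half-plane\<close>

context cusped_surface
begin

text \<open>A chart followed by an isometry is again a chart, so some chart inverts
  \<open>p i\<close> near \<open>z0\<close>, and velocities can be computed in the
  half-plane.\<close>

lemma chart_at:
  assumes i: "i \<in> I" and z0: "0 < Im z0"
  obtains U \<phi> r where "hyperbolic_chart X U \<phi>" "p i z0 \<in> U" "0 < r" "\<And>u. u \<in> ball z0 r \<Longrightarrow> \<phi> (p i u) = u"
proof -
  have "p i z0 \<in> X" using p_X[OF i] z0 by auto
  then obtain U \<phi> where U: "hyperbolic_chart X U \<phi>" "p i z0 \<in> U"
    using hyp unfolding hyperbolic_surface_def by blast
  have UX: "openin (top_of_set X) U" and im: "\<phi> ` U \<subseteq> above 0" "open (\<phi> ` U)"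
    and iso: "\<And>x y. x \<in> U \<Longrightarrow> y \<in> U \<Longrightarrow> hdist (\<phi> x) (\<phi> y) = dist x y"
    using U(1) by (auto simp: hyperbolic_chart_def upper_half_plane_def)
  obtain e where e: "0 < e" "ball (p i z0) e \<inter> X \<subseteq> U"
    using UX U(2) by (auto simp: openin_contains_ball)
  have "open (above 0 \<inter> p i -` ball (p i z0) e)"
    using continuous_on_local_isometry[OF p_iso[OF i] order.refl] open_above
    by (rule continuous_open_preimage) simp
  then obtain r1 where r1: "0 < r1" "ball z0 r1 \<subseteq> above 0 \<inter> p i -` ball (p i z0) e"
    using z0 e(1) openE[of _ z0] by (metis (no_types, lifting) IntI centre_in_ball mem_Collect_eq vimageI)
  obtain r2 where r2: "0 < r2" "\<And>u v. u \<in> ball z0 r2 \<Longrightarrow> v \<in> ball z0 r2 \<Longrightarrow> dist (p i u) (p i v) = hdist u v"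
    using local_isometry_onE[OF p_iso[OF i], of z0] z0 by (metis mem_Collect_eq)
  define r where "r = min r1 r2"
  have r: "0 < r" "ball z0 r \<subseteq> ball z0 r1" "ball z0 r \<subseteq> ball z0 r2" using r1 r2 by (auto simp: r_def)
  have pU: "p i u \<in> U" if "u \<in> ball z0 r" for u
    using that r(2) r1(2) e(2) p_X[OF i] by blast
  obtain m where m: "m \<in> hyp_iso" "\<And>u. u \<in> ball z0 r \<Longrightarrow> \<phi> (p i u) = m u"
  proof (rule hyp_rigidity[OF r(1), of z0 "\<lambda>u. \<phi> (p i u)"])
    show "ball z0 r \<subseteq> {z. 0 < Im z}" using r(2) r1(2) by blast
    show "0 < Im (\<phi> (p i u))" if "u \<in> ball z0 r" for u using pU[OF that] im(1) by blast
    show "hdist (\<phi> (p i u)) (\<phi> (p i v)) = hdist u v" if "u \<in> ball z0 r" "v \<in> ball z0 r" for u v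
      using iso[OF pU[OF that(1)] pU[OF that(2)]] r2(2)[OF subsetD[OF r(3) that(1)] subsetD[OF r(3) that(2)]]
      by simp
  qed blast
  obtain n where n: "n \<in> hyp_iso" "\<And>z. 0 < Im z \<Longrightarrow> n (m z) = z"
    using hyp_iso_inverse[OF m(1)] by metis
  have "hyperbolic_chart X U (\<lambda>x. n (\<phi> x))"
    unfolding hyperbolic_chart_def
  proof (intro conjI ballI)
    show "(\<lambda>x. n (\<phi> x)) ` U \<subseteq> upper_half_plane"
      using im(1) n(1) by (auto simp: upper_half_plane_def intro: hyp_iso_Im_pos)
    show "open ((\<lambda>x. n (\<phi> x)) ` U)"
      using open_hyp_iso_image[OF n(1) im(2,1)] by (simp add: image_image)
    show "hdist (n (\<phi> x)) (n (\<phi> y)) = dist x y" if "x \<in> U" "y \<in> U" for x y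
      using iso[OF that] im(1) that by (subst hdist_hyp_iso[OF n(1)]) auto
  qed (rule UX)
  moreover have "n (\<phi> (p i u)) = u" if "u \<in> ball z0 r" for u
  proof -
    have "u \<in> above 0" using that r(2) r1(2) by blast
    then show ?thesis using m(2)[OF that] n(2) by simp
  qed
  ultimately show ?thesis using U(2) r(1) that by blast
qed

text \<open>A region of area \<open>\<eta>\<close> begins at height
  \<open>h = \<xi> i / \<eta>\<close>, which may be below 1. A transition could identify two of its
  points only if \<open>a \<ge> h * h\<close>; as \<open>h > \<xi> i\<close>, this contradicts
  Shimizu's bound, and only translations remain.\<close>

lemma cusp_param_rescale:
  assumes i: "i \<in> I" and \<eta>: "0 < \<eta>" "\<eta> < 1"
  shows "cusp_param X \<eta> (\<lambda>z. p i (hsim 1 (\<xi> i / \<eta>) 0 z))"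
proof -
  define h where "h = \<xi> i / \<eta>"
  have \<xi>: "0 < \<xi> i" using \<xi>_pos[OF i] .
  have h: "0 < h" "\<xi> i < h" using \<xi> \<eta> by (auto simp: h_def field_simps)
  let ?m = "hsim 1 h 0"
  have m: "?m \<in> hyp_iso" using h by (simp add: hsim_in_hyp_iso)
  have inj: "(p i (?m z) = p i (?m w)) = (\<exists>k::int. z - w = of_int k * of_real \<eta>)"
    if z: "1 \<le> Im z" and w: "1 \<le> Im w" for z w
  proof
    assume eq: "p i (?m z) = p i (?m w)"
    have pos: "0 < Im (?m z)" "0 < Im (?m w)" using z w h by auto
    obtain n where n: "n \<in> hyp_iso" "n (?m z) = ?m w" "\<And>u. 0 < Im u \<Longrightarrow> p i u = p i (n u)"
      using lift[OF i i pos eq] by blast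
    from n(1) show "\<exists>k::int. z - w = of_int k * of_real \<eta>"
    proof (cases rule: hyp_iso_cases)
      case (sim s \<alpha> \<beta>)
      have trivial: "\<alpha> = 1" "s = 1" "\<exists>k::int. \<beta> = of_int k * \<xi> i"
        using similarity_trivial[OF i i sim(2,3)] n(3) sim(1) by blast+
      then obtain k :: int where "\<beta> = of_int k * \<xi> i" by blast
      then have "?m w = hsim 1 1 (of_int k * \<xi> i) (?m z)" using n(2) sim(1) trivial(1,2) by simp
      then have "h * (Re z - Re w) = - of_int k * \<xi> i" "Im w = Im z"
        using h(1) by (auto simp: complex_eq_iff algebra_simps)
      then have "\<xi> i * (Re z - Re w) = \<xi> i * (of_int (- k) * \<eta>)" "Im w = Im z"
        using \<eta> by (auto simp: h_def field_simps)
      then have "Re z - Re w = of_int (- k) * \<eta>" "Im w = Im z"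
        unfolding mult_left_cancel[OF less_imp_neq[OF \<xi>, symmetric]] by auto
      then have "z - w = of_int (- k) * of_real \<eta>" by (simp add: complex_eq_iff)
      then show ?thesis by blast
    next
      case (inv s a b r)
      have tr: "transition i i s a b r" using inv n(3) by (simp add: transition_def)
      define Z where "Z = Im (?m z)"
      have Z: "h \<le> Z" "h \<le> Im (?m w)" using z w h by (auto simp: Z_def)
      have "Im (?m w) = a * Z / ((Re (?m z) - r)\<^sup>2 + Z\<^sup>2)" unfolding n(2)[symmetric] inv(1) Z_def by (rule Im_hinv)
      also have "\<dots> \<le> a * Z / Z\<^sup>2" using Z h inv(3) by (intro divide_left_mono) (auto simp: sq_sum_pos)
      also have "\<dots> = a / Z" using Z h by (simp add: power2_eq_square)
      finally have "Im (?m w) * Z \<le> a" using Z h by (simp add: pos_le_divide_eq)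
      moreover have "h * h \<le> Im (?m w) * Z" using Z h by (intro mult_mono) auto
      moreover have "\<xi> i * \<xi> i < h * h" using h \<xi> by (intro mult_strict_mono) auto
      ultimately show ?thesis using transition_self_le[OF tr i] by (simp add: power2_eq_square)
    qed
  next
    assume "\<exists>k::int. z - w = of_int k * of_real \<eta>"
    then obtain k :: int where k: "z - w = of_int k * of_real \<eta>" by blast
    have "?m z = ?m w + of_int k * of_real (\<xi> i)"
    proof -
      have "Re z - Re w = of_int k * \<eta>" "Im z = Im w" using k by (auto simp: complex_eq_iff)
      then have "h * Re z = h * Re w + of_int k * \<xi> i" "Im z = Im w"
        using \<eta> by (auto simp: h_def field_simps)
      then show ?thesis by (simp add: complex_eq_iff)
    qed
    then show "p i (?m z) = p i (?m w)" using p_shift[OF i, of "?m w" k] w h by simp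
  qed
  have loc: "local_isometry_on (above 0) (\<lambda>z. p i (?m z))"
    by (rule local_isometry_on_above_comp[OF p_iso[OF i] m])
  show ?thesis
    unfolding cusp_param_def h_def[symmetric]
  proof (intro conjI allI impI)
    show "(\<lambda>z. p i (?m z)) ` {z. 1 \<le> Im z} \<subseteq> X"
    proof
      fix x assume "x \<in> (\<lambda>z. p i (?m z)) ` {z. 1 \<le> Im z}"
      then obtain z where "x = p i (?m z)" "1 \<le> Im z" by auto
      then show "x \<in> X" using p_X[OF i] h by auto
    qed
    fix z :: complex assume z: "1 \<le> Im z"
    then obtain r where "0 < r" "\<And>u v. u \<in> ball z r \<Longrightarrow> v \<in> ball z r \<Longrightarrow> dist (p i (?m u)) (p i (?m v)) = hdist u v"
      using local_isometry_onE[OF loc, of z] by (metis (no_types, lifting) less_le_trans mem_Collect_eq zero_less_one)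
    then show "\<exists>r>0. \<forall>u\<in>ball z r. \<forall>v\<in>ball z r. 1 \<le> Im u \<longrightarrow> 1 \<le> Im v \<longrightarrow>
        dist (p i (?m u)) (p i (?m v)) = hdist u v" by blast
  qed (rule inj)
qed

text \<open>The signs of \<open>\<sigma>\<close> serve the two ends of an arc, each seen in the
  coordinate of its cusp. In a chart that inverts \<open>p i\<close> the two velocities are vertical
  and horizontal.\<close>

lemma vertical_perpendicular:
  assumes i: "i \<in> I" and h: "0 < h" and \<gamma>: "\<And>t. \<gamma> t = p i (Complex x (c * exp (\<sigma> * t)))"
    and s: "c * exp (\<sigma> * s) = h" "\<sigma> \<noteq> 0"
  shows "perpendicular_at X \<gamma> J s (\<lambda>x. p i (hsim 1 h 0 (Complex x 1))) UNIV (x / h)"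
proof -
  let ?z = "Complex x h"
  obtain U \<phi> r where U: "hyperbolic_chart X U \<phi>" "p i ?z \<in> U" "0 < r" "\<And>u. u \<in> ball ?z r \<Longrightarrow> \<phi> (p i u) = u"
    using chart_at[OF i, of ?z] h by auto
  define f where "f t = Complex x (c * exp (\<sigma> * t))" for t
  define g where "g t = Complex (h * t) h" for t
  have f': "(f has_vector_derivative Complex 0 (\<sigma> * h)) (at s within J')" for J'
    unfolding f_def[abs_def] Complex_eq
    by (rule has_vector_derivative_eq_rhs, (rule derivative_intros refl | simp)+)
      (use s(1) in \<open>simp add: complex_eq_iff mult.assoc[symmetric] mult.commute\<close>)
  have g': "(g has_vector_derivative Complex h 0) (at (x / h))"
    unfolding g_def[abs_def] Complex_eq
    by (rule has_vector_derivative_eq_rhs, (rule derivative_intros refl | simp)+)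
  have fs: "f s = ?z" using s(1) by (simp add: f_def)
  have gx: "g (x / h) = ?z" using h by (simp add: g_def)
  have "continuous (at s within J) f" using f' by (rule has_vector_derivative_continuous)
  then obtain d where d: "0 < d" "\<And>t. t \<in> J \<Longrightarrow> dist t s < d \<Longrightarrow> dist (f t) (f s) < r"
    using U(3) unfolding continuous_within_eps_delta by blast
  have "continuous (at (x / h)) g" using g' by (rule has_vector_derivative_continuous)
  then obtain d' where d': "0 < d'" "\<And>t. dist t (x / h) < d' \<Longrightarrow> dist (g t) (g (x / h)) < r"
    using U(3) unfolding continuous_at_eps_delta by blast
  have \<gamma>f: "\<gamma> t = p i (f t)" for t by (simp add: \<gamma> f_def)
  have \<beta>g: "p i (hsim 1 h 0 (Complex t 1)) = p i (g t)" for t by (simp add: hsim_def g_def)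
  have "((\<phi> \<circ> \<gamma>) has_vector_derivative Complex 0 (\<sigma> * h)) (at s within J)"
  proof -
    have "((\<lambda>t. \<phi> (\<gamma> t)) has_vector_derivative Complex 0 (\<sigma> * h)) (at s within insert s J)"
    proof (rule has_vector_derivative_transform_within[of f _ _ _ d])
      show "(f has_vector_derivative Complex 0 (\<sigma> * h)) (at s within insert s J)"
        by (rule f')
      show "f t = \<phi> (\<gamma> t)" if "t \<in> insert s J" "dist t s < d" for t
        using that d(2)[of t] U(3,4) fs by (auto simp: \<gamma>f dist_commute)
    qed (use d in auto)
    then show ?thesis unfolding comp_def by (rule has_vector_derivative_within_subset) blast
  qed
  moreover have "((\<phi> \<circ> (\<lambda>x. p i (hsim 1 h 0 (Complex x 1)))) has_vector_derivative Complex h 0) (at (x / h) within UNIV)"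
    unfolding comp_def \<beta>g
  proof (rule has_vector_derivative_transform_within[OF g' d'(1)])
    show "g t = \<phi> (p i (g t))" if "dist t (x / h) < d'" for t
      using d'(2)[OF that] U(4) gx by (auto simp: dist_commute)
  qed simp
  moreover have "\<gamma> s = p i (hsim 1 h 0 (Complex (x / h) 1))" by (simp add: \<gamma>f fs \<beta>g gx)
  moreover have "\<gamma> s \<in> U" using U(2) by (simp add: \<gamma>f fs)
  ultimately show ?thesis
    unfolding perpendicular_at_def using U(1) s(2) h
    by (intro conjI exI[of _ U] exI[of _ \<phi>] exI[of _ "Complex 0 (\<sigma> * h)"] exI[of _ "Complex h 0"])
      (auto simp: inner_complex_def complex_eq_iff)
qed

text \<open>The line above \<open>P\<close> is followed from height \<open>h\<close> down to
  \<open>A / h\<close>, which the transition shows as height \<open>h\<close> above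
  \<open>B\<close>; hence the length \<open>ln (h\<^sup>2 / A)\<close>.\<close>

lemma orthogeodesic:
  assumes i: "i \<in> I" and \<eta>: "0 < \<eta>" "\<eta> < 1" and tr: "transition i i S A B P"
    and A: "A < (\<xi> i / \<eta>)\<^sup>2"
  defines "h \<equiv> \<xi> i / \<eta>"
  shows "doubly_truncated_orthogeodesic X \<eta> (ln (h\<^sup>2 / A)) (\<lambda>t. p i (Complex P (h * exp (- t))))"
proof -
  define L where "L = ln (h\<^sup>2 / A)"
  define \<gamma> where "\<gamma> t = p i (Complex P (h * exp (- t)))" for t
  have h: "0 < h" using \<xi>_pos[OF i] \<eta> by (simp add: h_def)
  have A0: "0 < A" using transitionD(2)[OF tr] .
  have L: "0 < L" using A A0 h by (simp add: L_def h_def[symmetric])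
  have expL: "exp L = h\<^sup>2 / A" using A0 h by (simp add: L_def)
  have "geodesic_arc X L \<gamma>"
    unfolding geodesic_arc_def
  proof (intro conjI ballI)
    show "\<gamma> ` {0..L} \<subseteq> X" using p_X[OF i] h by (auto simp: \<gamma>_def)
    fix t assume "t \<in> {0..L}"
    let ?f = "\<lambda>s. Complex P (h * exp (- s))"
    have pos: "0 < Im (?f t)" using h by simp
    obtain r where r: "0 < r" "\<And>u v. u \<in> ball (?f t) r \<Longrightarrow> v \<in> ball (?f t) r \<Longrightarrow> dist (p i u) (p i v) = hdist u v"
      using local_isometry_onE[OF p_iso[OF i], of "?f t"] pos by (metis mem_Collect_eq)
    have "isCont ?f t" unfolding Complex_eq by (intro continuous_intros)
    then obtain d where d: "0 < d" "\<And>s. dist s t < d \<Longrightarrow> dist (?f s) (?f t) < r"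
      using r(1) unfolding continuous_at_eps_delta by blast
    show "\<exists>\<delta>>0. \<forall>s\<in>{0..L} \<inter> ball t \<delta>. \<forall>s'\<in>{0..L} \<inter> ball t \<delta>. dist (\<gamma> s) (\<gamma> s') = \<bar>s - s'\<bar>"
    proof (intro exI[of _ d] conjI ballI)
      fix s s' assume ss: "s \<in> {0..L} \<inter> ball t d" "s' \<in> {0..L} \<inter> ball t d"
      then have "dist (\<gamma> s) (\<gamma> s') = hdist (?f s) (?f s')"
        unfolding \<gamma>_def using d(2)[of s] d(2)[of s'] by (intro r(2)) (auto simp: dist_commute)
      also have "\<dots> = \<bar>ln (h * exp (- s)) - ln (h * exp (- s'))\<bar>" using h by (intro hdist_vertical) auto
      also have "\<dots> = \<bar>s - s'\<bar>" using h by (simp add: ln_mult)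
      finally show "dist (\<gamma> s) (\<gamma> s') = \<bar>s - s'\<bar>" .
    qed (rule d(1))
  qed (rule L)
  moreover have "\<exists>\<psi> t. cusp_param X \<eta> \<psi> \<and> perpendicular_at X \<gamma> {0..L} s (\<lambda>x. \<psi> (Complex x 1)) UNIV t"
    if "s \<in> {0, L}" for s
  proof -
    have "\<exists>x. perpendicular_at X \<gamma> {0..L} s (\<lambda>x. p i (hsim 1 h 0 (Complex x 1))) UNIV x"
    proof (cases "s = 0")
      case True
      then show ?thesis
        using vertical_perpendicular[OF i h, of \<gamma> P h "-1" s "{0..L}"] by (auto simp: \<gamma>_def)
    next
      case False
      then have sL: "s = L" using that by simp
      have "\<gamma> t = p i (Complex B (A / h * exp (1 * t)))" for t
      proof -
        have "0 < h * exp (- t)" using h by simp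
        then have "p i (Complex P (h * exp (- t))) = p i (hinv S A B P (Complex P (h * exp (- t))))"
          by (intro transitionD(3)[OF tr]) simp
        also have "hinv S A B P (Complex P (h * exp (- t))) = Complex B (A / h * exp (1 * t))"
          using h by (simp add: complex_eq_iff Re_hinv Im_hinv power2_eq_square exp_minus field_simps)
        finally show ?thesis by (simp add: \<gamma>_def)
      qed
      moreover have "A / h * exp (1 * s) = h" using expL sL A0 h by (simp add: power2_eq_square)
      ultimately show ?thesis
        using vertical_perpendicular[OF i h, of \<gamma> B "A / h" 1 s "{0..L}"] by auto
    qed
    then show ?thesis using cusp_param_rescale[OF i \<eta>] unfolding h_def by blast
  qed
  ultimately show ?thesis
    unfolding doubly_truncated_orthogeodesic_def L_def \<gamma>_def by blast
qed

lemma curve_length_vertical: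
  assumes i: "i \<in> I" and h: "0 < h" and L: "0 \<le> L"
  shows "curve_length 0 L (\<lambda>t. p i (Complex x (h * exp (- t)))) \<le> ennreal L"
  unfolding curve_length_def
proof (rule SUP_least)
  let ?\<gamma> = "\<lambda>t. p i (Complex x (h * exp (- t)))"
  fix ts :: "real list" assume ts: "ts \<in> {ts. sorted ts \<and> set ts \<subseteq> {0..L}}"
  have dle: "dist (?\<gamma> s) (?\<gamma> s') \<le> s' - s" if "s \<le> s'" for s s'
  proof -
    have "dist (?\<gamma> s') (?\<gamma> s) \<le> ln (h * exp (- s)) - ln (h * exp (- s'))"
      by (rule dist_le_vertical[OF p_iso[OF i]]) (use h that in \<open>auto intro: less_le_trans[of 0 "h * exp (- s')"]\<close>)
    also have "\<dots> = s' - s" using h by (simp add: ln_mult)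
    finally show ?thesis by (simp add: dist_commute)
  qed
  have "(\<Sum>k<length ts - 1. ennreal (dist (?\<gamma> (ts ! k)) (?\<gamma> (ts ! Suc k))))
      = ennreal (\<Sum>k<length ts - 1. dist (?\<gamma> (ts ! k)) (?\<gamma> (ts ! Suc k)))"
    by (rule sum_ennreal) simp
  also have "\<dots> \<le> ennreal (\<Sum>k<length ts - 1. ts ! Suc k - ts ! k)"
    using ts by (intro ennreal_leI sum_mono dle) (auto intro!: sorted_nth_mono)
  also have "(\<Sum>k<length ts - 1. ts ! Suc k - ts ! k) = ts ! (length ts - 1) - ts ! 0"
    by (rule sum_lessThan_telescope)
  also have "\<dots> \<le> L"
  proof (cases "ts = []")
    case False
    then have "ts ! (length ts - 1) \<in> set ts" "ts ! 0 \<in> set ts" by auto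
    then have "ts ! (length ts - 1) \<in> {0..L}" "ts ! 0 \<in> {0..L}" using ts by blast+
    then show ?thesis by simp
  qed (use L in simp)
  finally show "(\<Sum>k<length ts - 1. ennreal (dist (?\<gamma> (ts ! k)) (?\<gamma> (ts ! Suc k)))) \<le> ennreal L"
    by (simp add: ennreal_leI)
qed

text \<open>The regions of the maps \<open>p i\<close> are among those removed, so density outside
  them suffices. It passes to the closure because \<open>infdist\<close> is continuous.\<close>

lemma truncated_surface_dense:
  assumes \<eta>: "0 < \<eta>" "\<eta> < 1"
    and dense: "\<And>y. y \<in> X \<Longrightarrow> (\<And>i w. i \<in> I \<Longrightarrow> 1 \<le> Im w \<Longrightarrow> y \<noteq> p i (hsim 1 (\<xi> i / \<eta>) 0 w)) \<Longrightarrow> \<exists>a\<in>A. dist y a \<le> \<epsilon>"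
  shows "dense_within \<epsilon> A (truncated_surface X \<eta>)"
  unfolding dense_within_def
proof
  let ?S = "X - \<Union>{C. cusp_region X \<eta> C}"
  have "infdist y A \<le> \<epsilon>" if y: "y \<in> ?S" for y
  proof -
    have "y \<noteq> p i (hsim 1 (\<xi> i / \<eta>) 0 w)" if "i \<in> I" "1 \<le> Im w" for i w
    proof
      assume eq: "y = p i (hsim 1 (\<xi> i / \<eta>) 0 w)"
      have "cusp_region X \<eta> ((\<lambda>z. p i (hsim 1 (\<xi> i / \<eta>) 0 z)) ` {z. 1 \<le> Im z})"
        unfolding cusp_region_def using cusp_param_rescale[OF that(1) \<eta>] \<eta>(1) by blast
      then show False using y eq that(2) by blast
    qed
    then obtain a where "a \<in> A" "dist y a \<le> \<epsilon>" using dense y by blast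
    then show ?thesis using infdist_le2 by blast
  qed
  then have "?S \<subseteq> {y. infdist y A \<le> \<epsilon>}" by blast
  moreover have "closed {y. infdist y A \<le> \<epsilon>}"
    by (intro closed_Collect_le continuous_intros)
  ultimately have "closure ?S \<subseteq> {y. infdist y A \<le> \<epsilon>}" by (rule closure_minimal)
  then show "infdist y A \<le> \<epsilon>" if "y \<in> truncated_surface X \<eta>" for y
    using that by (auto simp: truncated_surface_def)
qed

end

section \<open>The length bound\<close>

context cusped_surface
begin

text \<open>Grid points at spacing \<open>\<delta> / 2\<close> are each approximated within
  \<open>\<delta> / 2\<close>, so every \<open>x\<close> has a transition within
  \<open>\<delta>\<close>. The grid runs up to \<open>W\<close>, the common bound of the
  periods.\<close>

lemma net_of_transitions:
  assumes j0: "j0 \<in> I" and \<delta>: "0 < \<delta>" "\<delta> \<le> 1" and W: "\<And>i. i \<in> I \<Longrightarrow> \<xi> i \<le> W" "0 < W"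
    and c: "\<And>i x e. i \<in> I \<Longrightarrow> 0 < e \<Longrightarrow> e \<le> 1 \<Longrightarrow>
      \<exists>s a b r. transition i j0 s a b r \<and> \<bar>r - x\<bar> \<le> e \<and> c * e\<^sup>2 \<le> a"
  obtains ts where "real (length ts) \<le> real (card I) * (2 * W / \<delta> + 1)"
    "\<And>i s a b r. (i, s, a, b, r) \<in> set ts \<Longrightarrow> i \<in> I \<and> transition i j0 s a b r \<and> c * (\<delta> / 2)\<^sup>2 \<le> a"
    "\<And>i x. i \<in> I \<Longrightarrow> 0 \<le> x \<Longrightarrow> x \<le> \<xi> i \<Longrightarrow> \<exists>s a b r. (i, s, a, b, r) \<in> set ts \<and> \<bar>x - r\<bar> \<le> \<delta>"
proof -
  define G where "G i k t \<longleftrightarrow> (case t of (s, a, b, r) \<Rightarrow>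
     transition i j0 s a b r \<and> \<bar>r - real k * (\<delta> / 2)\<bar> \<le> \<delta> / 2 \<and> c * (\<delta> / 2)\<^sup>2 \<le> a)" for i k t
  have "\<exists>t. G i k t" if "i \<in> I" for i k
    using c[OF that, of "\<delta> / 2" "real k * (\<delta> / 2)"] \<delta> by (auto simp: G_def)
  then obtain f where f: "\<And>i k. i \<in> I \<Longrightarrow> G i k (f i k)" by metis
  define n where "n = nat \<lfloor>2 * W / \<delta>\<rfloor>"
  have n: "real n \<le> 2 * W / \<delta>" using W(2) \<delta>(1) by (simp add: n_def of_nat_floor)
  define T where "T = (\<lambda>(i, k). (i, f i k)) ` (I \<times> {..n})"
  have fT: "finite T" using fin by (simp add: T_def)
  have "card T \<le> card (I \<times> {..n})" unfolding T_def by (rule card_image_le) (use fin in simp)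
  then have cT: "card T \<le> card I * (n + 1)" by (simp add: card_cartesian_product)
  obtain ts where ts: "set ts = T" "distinct ts" using finite_distinct_list[OF fT] by blast
  show ?thesis
  proof (rule that[of ts])
    have "real (length ts) \<le> real (card I * (n + 1))"
      using cT ts(1) distinct_card[OF ts(2)] unfolding of_nat_le_iff by simp
    also have "\<dots> = real (card I) * (real n + 1)" by (simp add: distrib_left)
    also have "\<dots> \<le> real (card I) * (2 * W / \<delta> + 1)" using n by (intro mult_left_mono) auto
    finally show "real (length ts) \<le> real (card I) * (2 * W / \<delta> + 1)" .
  next
    fix i s a b r assume "(i, s, a, b, r) \<in> set ts"
    then obtain k where "i \<in> I" "f i k = (s, a, b, r)" by (auto simp: ts(1) T_def)
    then show "i \<in> I \<and> transition i j0 s a b r \<and> c * (\<delta> / 2)\<^sup>2 \<le> a"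
      using f[of i k] by (simp add: G_def)
  next
    fix i x assume i: "i \<in> I" and x: "0 \<le> x" "x \<le> \<xi> i"
    define k where "k = nat \<lfloor>x / (\<delta> / 2)\<rfloor>"
    have k: "real k = of_int \<lfloor>x / (\<delta> / 2)\<rfloor>" using x(1) \<delta>(1) by (simp add: k_def)
    have kx: "real k * (\<delta> / 2) \<le> x" "x < (real k + 1) * (\<delta> / 2)"
      unfolding k using floor_divide_lower[of "\<delta> / 2" x] floor_divide_upper[of "\<delta> / 2" x] \<delta>(1) by auto
    have "x / (\<delta> / 2) \<le> 2 * W / \<delta>"
      using W(1)[OF i] x(2) \<delta>(1) by (simp add: field_simps)
    then have "k \<le> n" unfolding k_def n_def by (intro nat_mono floor_mono)
    obtain s a b r where fk: "f i k = (s, a, b, r)" by (cases "f i k")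
    have "(i, s, a, b, r) \<in> set ts" using i \<open>k \<le> n\<close> fk by (force simp: ts(1) T_def)
    moreover have "\<bar>r - real k * (\<delta> / 2)\<bar> \<le> \<delta> / 2" using f[OF i, of k] fk by (simp add: G_def)
    then have "\<bar>x - r\<bar> \<le> \<delta>" using kx unfolding distrib_right mult_1 by linarith
    ultimately show "\<exists>s a b r. (i, s, a, b, r) \<in> set ts \<and> \<bar>x - r\<bar> \<le> \<delta>" by blast
  qed
qed

theorem short_dense_orthogeodesics:
  assumes j0: "j0 \<in> I"
  shows "\<exists>D>0. \<forall>\<eta> \<epsilon>::real. 0 < \<eta> \<longrightarrow> \<eta> \<le> 1 \<longrightarrow> 0 < \<epsilon> \<longrightarrow> \<epsilon> \<le> min (2 * ln (1 / \<eta>)) 2 \<longrightarrow>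
    (\<exists>L \<gamma>. doubly_truncated_orthogeodesic X \<eta> L \<gamma> \<and>
       dense_within \<epsilon> (\<gamma> ` {0..L}) (truncated_surface X \<eta>) \<and>
       curve_length 0 L \<gamma> \<le> ennreal (D * (1 / \<epsilon>) * (ln (1 / \<epsilon>) + ln (1 / \<eta>))))"
proof -
  obtain c where c: "0 < c" "\<And>i x e. i \<in> I \<Longrightarrow> 0 < e \<Longrightarrow> e \<le> 1 \<Longrightarrow>
    \<exists>s a b r. transition i j0 s a b r \<and> \<bar>r - x\<bar> \<le> e \<and> c * e\<^sup>2 \<le> a"
    using transition_dense[OF j0] by metis
  obtain y0 Y0 where y0: "0 < y0" "y0 \<le> 1" "1 \<le> Y0"
    "\<And>x. x \<in> thick \<Longrightarrow> \<exists>w. x = p j0 w \<and> y0 \<le> Im w \<and> Im w \<le> Y0 \<and> 0 \<le> Re w \<and> Re w \<le> \<xi> j0"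
    using thick_cover[OF j0] by metis
  obtain s1 a1 b1 r1 where tr1: "transition j0 j0 s1 a1 b1 r1" using ex_transition_self[OF j0] by metis
  define W where "W = (\<Sum>i\<in>I. \<xi> i)"
  have W: "\<xi> i \<le> W" if "i \<in> I" for i
    unfolding W_def using fin \<xi>_pos that by (intro member_le_sum) (auto intro: less_imp_le)
  \<comment> \<open>This is below the truncating height \<open>h0 / \<eta>\<close> for every
    \<open>\<eta> < 1\<close>: a point of the line with heights at most \<open>h0\<close> in both
    end coordinates lies on the truncated arc.\<close>
  define h0 where "h0 = \<xi> j0"
  have h0: "0 < h0" using \<xi>_pos[OF j0] by (simp add: h0_def)
  have W0: "0 < W" using W[OF j0] h0 by (simp add: h0_def)
  \<comment> \<open>\<open>Y0\<close> covers the thick part, and the truncated part of cusp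
    \<open>i\<close> ends at height \<open>\<xi> i / \<eta>\<close>; hence columns up to
    \<open>Hc / \<eta>\<close>.\<close>
  define Hc where "Hc = max Y0 W"
  have Hc: "1 \<le> Hc" "Y0 \<le> Hc" "W \<le> Hc" using y0 by (auto simp: Hc_def)
  \<comment> \<open>The 36 comes from \<open>c * (\<delta> / 2)\<^sup>2\<close> with
    \<open>\<delta> = \<epsilon> * y0 / 3\<close>; \<open>C1\<close> is the part of the cost of a
    transition that is independent of \<open>\<epsilon>\<close>.\<close>
  define C1 where "C1 = \<bar>ln (36 / (c * y0\<^sup>2))\<bar> + \<bar>ln (1 / a1)\<bar>"
  define C2 where "C2 = 2 * (2 + 2 / y0 + 2 / (y0 * h0) + W + 1) + 3 / y0 + 6 * Hc + 8 * Hc\<^sup>2 + 2 * Hc / h0"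
  have C2: "1 \<le> C2"
    unfolding C2_def using y0 h0 W0 Hc by (simp add: add_increasing add_increasing2)
  \<comment> \<open>A lower bound for \<open>ln (1 / \<epsilon>) + ln (1 / \<eta>)\<close>, by which
    additive constants become multiples of this sum.\<close>
  define s0 where "s0 = 1 - ln (2::real)"
  have s0: "0 < s0" using ln_2_less_1 by (simp add: s0_def)
  define C4 where "C4 = (C1 + 8 + 2 * ln C2) / s0 + 8"
  define C5 where "C5 = 2 * (real (card I) * (6 * W / y0 + 2)) + 6"
  define D where "D = 2 * ((2 * \<bar>ln h0\<bar> + 2) / s0 + 2) + C5 * C4"
  have C1: "0 \<le> C1" by (simp add: C1_def)
  have C4: "0 \<le> C4" unfolding C4_def using C1 C2 s0 by (intro add_nonneg_nonneg divide_nonneg_pos) auto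
  have C5: "0 \<le> C5" unfolding C5_def using W0 y0 by simp
  have D: "0 < D"
    unfolding D_def using C4 C5 s0 by (intro add_pos_nonneg mult_pos_pos add_nonneg_pos divide_nonneg_pos) auto
  show ?thesis
  proof (rule exI[of _ D], intro conjI allI impI)
    fix \<eta> \<epsilon> :: real assume \<eta>: "0 < \<eta>" "\<eta> \<le> 1" and \<epsilon>: "0 < \<epsilon>" "\<epsilon> \<le> min (2 * ln (1 / \<eta>)) 2"
    define x y where "x = ln (1 / \<epsilon>)" and "y = ln (1 / \<eta>)"
    have \<epsilon>2: "\<epsilon> \<le> 2" "\<epsilon> \<le> 2 * y" using \<epsilon> by (auto simp: y_def)
    have y: "0 < y" using \<epsilon>2 \<epsilon> by simp
    then have \<eta>1: "\<eta> < 1" using \<eta> by (cases "\<eta> = 1") (auto simp: y_def)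
    have x: "- 1 \<le> x" "1 - ln 2 - \<epsilon> / 2 \<le> x"
    proof -
      have "x = - ln \<epsilon>" using \<epsilon> by (simp add: x_def ln_div)
      moreover have "ln \<epsilon> \<le> ln 2" using \<epsilon> \<epsilon>2 by simp
      moreover have "ln (\<epsilon> / 2) \<le> \<epsilon> / 2 - 1" using \<epsilon> by (intro ln_le_minus_one) auto
      then have "ln \<epsilon> - ln 2 \<le> \<epsilon> / 2 - 1" using \<epsilon> by (simp add: ln_div)
      ultimately show "- 1 \<le> x" "1 - ln 2 - \<epsilon> / 2 \<le> x" using ln_2_less_1 by auto
    qed
    define S where "S = x + y"
    have S: "s0 \<le> S" using x \<epsilon>2 by (simp add: S_def s0_def)
    have S0: "0 < S" using S s0 by simp
    have one_le: "1 \<le> S / s0" using S s0 by simp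
    define H where "H = Hc / \<eta>"
    define \<delta> where "\<delta> = \<epsilon> * y0 / 3"
    \<comment> \<open>The sum of all required lower bounds, hence polynomial in
      \<open>1 / \<epsilon>\<close> and \<open>1 / \<eta>\<close>.\<close>
    define M where "M = 2 + 3 / (\<epsilon> * y0) + 6 * H / \<epsilon> + 4 * H\<^sup>2 + 2 / y0 + 2 / (y0 * h0) + H / h0"
    have H: "Hc \<le> H" unfolding H_def using Hc \<eta> by (simp add: pos_le_divide_eq mult_left_le)
    have H1: "1 \<le> H" using H Hc by simp
    have \<delta>: "0 < \<delta>" "\<delta> \<le> 1"
    proof -
      show "0 < \<delta>" using \<epsilon> y0 by (simp add: \<delta>_def)
      have "\<epsilon> * y0 \<le> 2 * 1" using \<epsilon> \<epsilon>2 y0 by (intro mult_mono) auto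
      then show "\<delta> \<le> 1" by (simp add: \<delta>_def)
    qed
    have nn: "0 \<le> 3 / (\<epsilon> * y0)" "0 \<le> 6 * H / \<epsilon>" "0 \<le> 4 * H\<^sup>2" "0 \<le> 2 / y0" "0 \<le> 2 / (y0 * h0)" "0 \<le> H / h0"
      using \<epsilon> y0 h0 H1 by auto
    have M: "3 / (\<epsilon> * y0) \<le> M - 2" "6 * H / \<epsilon> \<le> M - 2" "4 * H\<^sup>2 \<le> M - 2" "2 / y0 + 2 \<le> M"
        "2 / (y0 * h0) \<le> M" "H / h0 \<le> M - 2"
      unfolding M_def using nn by linarith+
    \<comment> \<open>Every summand of \<open>M\<close> is at most a constant times
      \<open>E\<close>, so \<open>ln M\<close> is at most a constant plus
      \<open>ln (1 / \<epsilon>) + 2 * ln (1 / \<eta>)\<close>.\<close>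
    define E where "E = 1 / (\<epsilon> * \<eta>\<^sup>2)"
    have \<eta>2: "0 < \<eta>\<^sup>2" "\<eta>\<^sup>2 \<le> \<eta>" "\<eta>\<^sup>2 \<le> 1" using \<eta> by (auto simp: power2_eq_square mult_le_one mult_left_le)
    have E: "1 \<le> 2 * E" "1 / \<epsilon> \<le> E" "1 / (\<epsilon> * \<eta>) \<le> E" "1 / \<eta>\<^sup>2 \<le> 2 * E" "1 / \<eta> \<le> 2 * E" "0 < E"
    proof -
      have le: "\<epsilon> * \<eta>\<^sup>2 \<le> \<epsilon> * \<eta>" "\<epsilon> * \<eta> \<le> \<epsilon> * 1" using \<epsilon> \<eta> \<eta>2 by (auto intro: mult_left_mono)
      show "0 < E" using \<epsilon> \<eta>2 by (simp add: E_def)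
      show 1: "1 / (\<epsilon> * \<eta>) \<le> E" unfolding E_def using le(1) \<epsilon>(1) \<eta>(1) by (intro divide_left_mono mult_pos_pos) auto
      have "1 / \<epsilon> \<le> 1 / (\<epsilon> * \<eta>)" using le \<epsilon> \<eta> by (intro divide_left_mono) auto
      then show 2: "1 / \<epsilon> \<le> E" using 1 by simp
      have "1 / 2 \<le> 1 / \<epsilon>" using \<epsilon> \<epsilon>2 by (intro divide_left_mono) auto
      then show "1 \<le> 2 * E" using 2 by simp
      have "1 / \<eta>\<^sup>2 * (1 / 2) \<le> 1 / \<eta>\<^sup>2 * (1 / \<epsilon>)"
        using \<open>1 / 2 \<le> 1 / \<epsilon>\<close> \<eta>2 by (intro mult_left_mono) auto
      then show 3: "1 / \<eta>\<^sup>2 \<le> 2 * E" by (simp add: E_def mult.commute)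
      have "1 / \<eta> \<le> 1 / \<eta>\<^sup>2" using \<eta>2 \<eta> by (intro divide_left_mono) auto
      then show "1 / \<eta> \<le> 2 * E" using 3 by simp
    qed
    have MW: "M + W + 1 \<le> C2 * E"
    proof -
      define q where "q = 2 + 2 / y0 + 2 / (y0 * h0) + W + 1"
      have C2E: "C2 * E = q * (2 * E) + 3 / y0 * E + 6 * Hc * E + 8 * Hc\<^sup>2 * E + 2 * Hc / h0 * E"
        unfolding C2_def q_def[symmetric] distrib_right by simp
      have Mq: "M + W + 1 = q + 3 / (\<epsilon> * y0) + 6 * H / \<epsilon> + 4 * H\<^sup>2 + H / h0"
        by (simp add: M_def q_def)
      have "q * 1 \<le> q * (2 * E)"
        using E(1) nn W0 unfolding q_def by (intro mult_left_mono add_nonneg_nonneg) auto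
      moreover have "3 / (\<epsilon> * y0) \<le> 3 / y0 * E"
        using mult_left_mono[OF E(2), of "3 / y0"] y0 by (simp add: mult.commute)
      moreover have "6 * H / \<epsilon> \<le> 6 * Hc * E"
        using mult_left_mono[OF E(3), of "6 * Hc"] Hc by (simp add: H_def mult.commute)
      moreover have "4 * H\<^sup>2 \<le> 8 * Hc\<^sup>2 * E"
        using mult_left_mono[OF E(4), of "4 * Hc\<^sup>2"] by (simp add: H_def power_divide)
      moreover have "H / h0 \<le> 2 * Hc / h0 * E"
        using mult_left_mono[OF E(5), of "Hc / h0"] Hc h0 by (simp add: H_def mult.commute mult.left_commute)
      ultimately show ?thesis unfolding Mq C2E by linarith
    qed
    have M0: "0 < M" using M(4) nn by linarith
    have lnM: "ln (M + W + 1) \<le> ln C2 + x + 2 * y"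
    proof -
      have "ln (M + W + 1) \<le> ln (C2 * E)" using MW M0 W0 by (intro ln_mono) auto
      also have "\<dots> = ln C2 + x + 2 * y"
        using C2 \<epsilon> \<eta> by (simp add: E_def x_def y_def ln_mult ln_div ln_realpow)
      finally show ?thesis .
    qed
    define l where "l = C1 + 2 * \<bar>x\<bar>"
    have l0: "0 \<le> l" using C1 by (simp add: l_def)
    have l1: "ln (1 / a1) \<le> l" by (simp add: l_def C1_def)
    have xS: "\<bar>x\<bar> \<le> S + 2" using x(1) y S0 by (simp add: S_def abs_le_iff)
    have yS: "y \<le> S + 1" using x(1) by (simp add: S_def)
    have cost: "l + 2 * ln (M + W + 1) \<le> C4 * S"
    proof -
      have "l + 2 * ln (M + W + 1) \<le> (C1 + 8 + 2 * ln C2) + 8 * S"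
        using lnM xS yS by (simp add: l_def S_def)
      also have "\<dots> \<le> (C1 + 8 + 2 * ln C2) * (S / s0) + 8 * S"
        using mult_left_mono[OF one_le, of "C1 + 8 + 2 * ln C2"] C1 C2 by simp
      also have "\<dots> = C4 * S" unfolding C4_def distrib_right[of _ 8] by simp
      finally show ?thesis .
    qed
    obtain ts where ts: "real (length ts) \<le> real (card I) * (2 * W / \<delta> + 1)"
      "\<And>i s a b r. (i, s, a, b, r) \<in> set ts \<Longrightarrow> i \<in> I \<and> transition i j0 s a b r \<and> c * (\<delta> / 2)\<^sup>2 \<le> a"
      "\<And>i x. i \<in> I \<Longrightarrow> 0 \<le> x \<Longrightarrow> x \<le> \<xi> i \<Longrightarrow> \<exists>s a b r. (i, s, a, b, r) \<in> set ts \<and> \<bar>x - r\<bar> \<le> \<delta>"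
      by (rule net_of_transitions[OF j0 \<delta> W W0 c(2)]) blast+
    have ts': "i \<in> I \<and> transition i j0 s a b r \<and> ln (1 / a) \<le> l" if "(i, s, a, b, r) \<in> set ts" for i s a b r
    proof -
      have a: "0 < a" "c * (\<delta> / 2)\<^sup>2 \<le> a" using ts(2)[OF that] transitionD(2) by auto
      have "ln (1 / a) \<le> ln (1 / (c * (\<delta> / 2)\<^sup>2))"
        using a c(1) \<delta> by (intro ln_mono divide_left_mono) auto
      also have "1 / (c * (\<delta> / 2)\<^sup>2) = 36 / (c * y0\<^sup>2) * (1 / \<epsilon>)\<^sup>2"
        by (simp add: \<delta>_def power_divide power_mult_distrib)
      also have "ln \<dots> = ln (36 / (c * y0\<^sup>2)) + 2 * x"
        using c(1) y0 \<epsilon> by (subst ln_mult) (simp_all add: x_def ln_realpow)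
      also have "\<dots> \<le> l" using abs_ge_self[of "ln (36 / (c * y0\<^sup>2))"] abs_ge_self[of x] abs_ge_zero[of "ln (1 / a1)"]
        unfolding l_def C1_def by linarith
      finally show ?thesis using ts(2)[OF that] by simp
    qed
    obtain Sg A B P where P: "transition j0 j0 Sg A B P"
      "ln (1 / A) \<le> (2 * real (length ts) + 3) * (l + 2 * ln (M + W + 1))"
      "\<And>i s a b r w. (i, s, a, b, r) \<in> set ts \<Longrightarrow> \<bar>Re w - r\<bar> \<le> \<delta> \<Longrightarrow> y0 \<le> Im w \<Longrightarrow> Im w \<le> H \<Longrightarrow>
        \<exists>t>0. t \<le> h0 \<and> A / t \<le> h0 \<and> dist (p i w) (p j0 (Complex P t)) \<le> \<epsilon>"
      by (rule chain_geodesic_list[OF j0 H1 y0(1,2) \<epsilon>(1) h0 less_imp_le[OF \<delta>(1)] _ M W tr1 l1 ts' l0])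
        (auto simp: \<delta>_def)
    define h where "h = \<xi> j0 / \<eta>"
    have h: "h0 < h" "0 < h" using \<eta> \<eta>1 h0 by (auto simp: h_def h0_def field_simps)
    have A: "0 < A" using transitionD(2)[OF P(1)] .
    define L where "L = ln (h\<^sup>2 / A)"
    define \<gamma> where "\<gamma> t = p j0 (Complex P (h * exp (- t)))" for t
    have near: "\<exists>t>0. t \<le> h0 \<and> A / t \<le> h0 \<and> dist (p i w) (p j0 (Complex P t)) \<le> \<epsilon>"
      if "i \<in> I" "0 \<le> Re w" "Re w \<le> \<xi> i" "y0 \<le> Im w" "Im w \<le> H" for i w
      using ts(3)[OF that(1-3)] P(3) that(4,5) by blast
    \<comment> \<open>Density at a single point already gives
      \<open>A \<le> h0\<^sup>2 < h\<^sup>2\<close>, so the arc has positive length.\<close>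
    obtain t0 where t0: "0 < t0" "t0 \<le> h0" "A / t0 \<le> h0"
      using near[OF j0, of "Complex 0 1"] \<xi>_pos[OF j0] y0 H1 by auto
    have "A \<le> h0 * t0" using t0 by (simp add: pos_divide_le_eq)
    also have "\<dots> \<le> h0 * h0" using t0 h0 by (intro mult_left_mono) auto
    also have "\<dots> < h * h" using h h0 by (intro mult_strict_mono) auto
    finally have Ah: "A < h\<^sup>2" by (simp add: power2_eq_square)
    have L0: "0 \<le> L" unfolding L_def using A Ah by (intro ln_ge_zero) (simp add: pos_le_divide_eq)
    have ortho: "doubly_truncated_orthogeodesic X \<eta> L \<gamma>"
      using orthogeodesic[OF j0 \<eta>(1) \<eta>1 P(1)] Ah unfolding L_def \<gamma>_def h_def by simp
    have on_arc: "p j0 (Complex P t) \<in> \<gamma> ` {0..L}" if t: "0 < t" "t \<le> h0" "A / t \<le> h0" for t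
    proof (intro image_eqI[of _ _ "ln (h / t)"])
      show "p j0 (Complex P t) = \<gamma> (ln (h / t))" using h t by (simp add: \<gamma>_def exp_minus)
      have "A / t \<le> h" using t h by simp
      then have "h / t \<le> h\<^sup>2 / A" using A t h by (simp add: field_simps power2_eq_square)
      then have "ln (h / t) \<le> L" unfolding L_def using h t A by (intro ln_mono) auto
      moreover have "0 \<le> ln (h / t)" using t h by (intro ln_ge_zero) (simp add: pos_le_divide_eq)
      ultimately show "ln (h / t) \<in> {0..L}" by simp
    qed
    have dense: "dense_within \<epsilon> (\<gamma> ` {0..L}) (truncated_surface X \<eta>)"
    proof (rule truncated_surface_dense[OF \<eta>(1) \<eta>1])
      fix v assume v: "v \<in> X" and out: "\<And>i w. i \<in> I \<Longrightarrow> 1 \<le> Im w \<Longrightarrow> v \<noteq> p i (hsim 1 (\<xi> i / \<eta>) 0 w)"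
      have "\<exists>i w. i \<in> I \<and> v = p i w \<and> 0 \<le> Re w \<and> Re w \<le> \<xi> i \<and> y0 \<le> Im w \<and> Im w \<le> H"
      proof (cases "v \<in> K")
        case True
        then have "v \<in> thick" by (simp add: thick_def)
        then show ?thesis using y0(4)[of v] j0 Hc(2) H by (meson order_trans)
      next
        case False
        then obtain i w where w: "i \<in> I" "1 \<le> Im w" "v = p i w" using K(3) v by blast
        obtain w' where w': "Im w' = Im w" "0 \<le> Re w'" "Re w' \<le> \<xi> i" "p i w' = p i w"
          using normalize[OF w(1), of w] w(2) by auto
        have \<xi>: "0 < \<xi> i" using \<xi>_pos[OF w(1)] .
        define u where "u = Complex (Re w * \<eta> / \<xi> i) (Im w * \<eta> / \<xi> i)"
        have "hsim 1 (\<xi> i / \<eta>) 0 u = w" using \<xi> \<eta> by (simp add: u_def complex_eq_iff)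
        then have "\<not> 1 \<le> Im u" using out[OF w(1), of u] w(3) by auto
        then have "Im w \<le> \<xi> i / \<eta>" using \<xi> \<eta> by (simp add: u_def field_simps)
        also have "\<dots> \<le> H" unfolding H_def using W[OF w(1)] Hc(3) \<eta> by (intro divide_right_mono) auto
        finally show ?thesis using w w' y0(2) by (intro exI[of _ i] exI[of _ w']) auto
      qed
      then obtain t where "0 < t" "t \<le> h0" "A / t \<le> h0" "dist v (p j0 (Complex P t)) \<le> \<epsilon>"
        using near by metis
      then show "\<exists>a\<in>\<gamma> ` {0..L}. dist v a \<le> \<epsilon>" using on_arc by blast
    qed
    \<comment> \<open>The length splits into \<open>2 * ln h\<close>, at most a multiple of
      \<open>S\<close>, and the chain: of the order of \<open>1 / \<epsilon>\<close> transitions,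
      each counted with cost at most \<open>C4 * S\<close>.\<close>
    have "L \<le> D * (1 / \<epsilon>) * S"
    proof -
      define Q where "Q = (2 * \<bar>ln h0\<bar> + 2) / s0 + 2"
      have half: "1 \<le> 2 / \<epsilon>" using \<epsilon> \<epsilon>2 by simp
      have "L = 2 * ln h + ln (1 / A)" unfolding L_def using h A by (simp add: ln_div ln_realpow)
      moreover have "ln h = ln h0 + y" using h0 \<eta> by (simp add: h_def h0_def y_def ln_div)
      moreover have "2 * (ln h0 + y) \<le> Q * S"
      proof -
        define q where "q = 2 * \<bar>ln h0\<bar> + 2"
        have "2 * (ln h0 + y) \<le> q * 1 + 2 * S" using yS by (simp add: q_def)
        also have "\<dots> \<le> q * (S / s0) + 2 * S"
          using mult_left_mono[OF one_le, of q] by (simp add: q_def)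
        also have "\<dots> = (q / s0 + 2) * S" unfolding distrib_right by simp
        finally show ?thesis by (simp add: q_def Q_def)
      qed
      moreover have "Q * S \<le> 2 * Q * (1 / \<epsilon>) * S"
      proof -
        have "0 \<le> Q * S" unfolding Q_def using s0 S0 by simp
        from mult_left_mono[OF half this] show ?thesis by (simp add: algebra_simps)
      qed
      moreover have "2 * real (length ts) + 3 \<le> C5 * (1 / \<epsilon>)"
      proof -
        have "2 * W / \<delta> + 1 \<le> 6 * W / y0 * (1 / \<epsilon>) + 2 / \<epsilon>"
          using half by (simp add: \<delta>_def mult.commute)
        also have "\<dots> = (6 * W / y0 + 2) * (1 / \<epsilon>)" by (simp add: algebra_simps)
        finally have "real (card I) * (2 * W / \<delta> + 1) \<le> real (card I) * ((6 * W / y0 + 2) * (1 / \<epsilon>))"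
          by (intro mult_left_mono) auto
        then have "2 * real (length ts) + 3 \<le> 2 * (real (card I) * ((6 * W / y0 + 2) * (1 / \<epsilon>))) + 3 * (2 / \<epsilon>)"
          using ts(1) half by linarith
        also have "\<dots> = C5 * (1 / \<epsilon>)" by (simp add: C5_def algebra_simps)
        finally show ?thesis .
      qed
      then have "(2 * real (length ts) + 3) * (l + 2 * ln (M + W + 1)) \<le> (C5 * (1 / \<epsilon>)) * (C4 * S)"
        using cost C5 \<epsilon> l0 M0 W0 M(4) y0 by (intro mult_mono add_nonneg_nonneg mult_nonneg_nonneg ln_ge_zero) (auto simp: add_increasing)
      moreover have "D * (1 / \<epsilon>) * S = 2 * Q * (1 / \<epsilon>) * S + (C5 * (1 / \<epsilon>)) * (C4 * S)"
        unfolding D_def Q_def[symmetric] by (simp add: algebra_simps)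
      ultimately show ?thesis using P(2) by argo
    qed
    then have "ennreal L \<le> ennreal (D * (1 / \<epsilon>) * (ln (1 / \<epsilon>) + ln (1 / \<eta>)))"
      by (intro ennreal_leI) (simp add: S_def x_def y_def)
    moreover have "\<gamma> = (\<lambda>t. p j0 (Complex P (h * exp (- t))))" by (simp add: fun_eq_iff \<gamma>_def)
    then have "curve_length 0 L \<gamma> \<le> ennreal L" using curve_length_vertical[OF j0 h(2) L0, of P] by simp
    ultimately have "curve_length 0 L \<gamma> \<le> ennreal (D * (1 / \<epsilon>) * (ln (1 / \<epsilon>) + ln (1 / \<eta>)))"
      by simp
    then show "\<exists>L \<gamma>. doubly_truncated_orthogeodesic X \<eta> L \<gamma> \<and>
       dense_within \<epsilon> (\<gamma> ` {0..L}) (truncated_surface X \<eta>) \<and>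
       curve_length 0 L \<gamma> \<le> ennreal (D * (1 / \<epsilon>) * (ln (1 / \<epsilon>) + ln (1 / \<eta>)))"
      using ortho dense by blast
  qed (rule D)
qed

end

text \<open>The given cusp regions index themselves, with their developing maps as \<open>p\<close>.
  A complete set is closed, which puts the compact closure \<open>K\<close> inside
  \<open>X\<close>.\<close>

lemma moduli_space_cusped_surface:
  fixes X :: "'a::metric_space set"
  assumes X: "X \<in> moduli_space g n" and n: "1 \<le> n"
  obtains I :: "'a set set" and \<xi> p K where "cusped_surface X I \<xi> p K" "I \<noteq> {}"
proof -
  have hyp: "hyperbolic_surface X" and compl: "complete X" and conn: "connected X" and cusps: "has_cusps X n"
    using X by (auto simp: moduli_space_def)
  obtain \<C> where \<C>: "finite \<C>" "card \<C> = n" "pairwise disjnt \<C>" "\<And>C. C \<in> \<C> \<Longrightarrow> \<exists>\<xi>. cusp_region X \<xi> C"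
      "compact (closure (X - \<Union>\<C>))"
    using cusps unfolding has_cusps_def by blast
  define dev where "dev C \<xi> p \<longleftrightarrow> 0 < \<xi> \<and> local_isometry_on (above 0) p \<and> p ` above 0 \<subseteq> X \<and>
    (\<forall>z. 0 < Im z \<longrightarrow> p (z + of_real \<xi>) = p z) \<and> C = p ` {z. 1 \<le> Im z} \<and>
    (\<forall>z w. 1 \<le> Im z \<longrightarrow> 1 \<le> Im w \<longrightarrow> p z = p w \<longrightarrow> (\<exists>k::int. z - w = of_int k * of_real \<xi>))"
    for C \<xi> p
  have "\<exists>\<xi> p. dev C \<xi> p" if C: "C \<in> \<C>" for C
  proof -
    obtain \<xi> \<psi> where \<psi>: "0 < \<xi>" "cusp_param X \<xi> \<psi>" "C = \<psi> ` {z. 1 \<le> Im z}"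
      using \<C>(4)[OF C] unfolding cusp_region_def by blast
    obtain p where p: "local_isometry_on (above 0) p" "p ` above 0 \<subseteq> X"
      "\<And>z. 1 \<le> Im z \<Longrightarrow> p z = \<psi> z" "\<And>z. 0 < Im z \<Longrightarrow> p (z + of_real \<xi>) = p z"
      using developing_map[OF hyp compl \<psi>(1,2)] by metis
    have "C = p ` {z. 1 \<le> Im z}" unfolding \<psi>(3) using p(3) by (intro image_cong) auto
    moreover have "\<exists>k::int. z - w = of_int k * of_real \<xi>" if "1 \<le> Im z" "1 \<le> Im w" "p z = p w" for z w
      using cusp_param_eq_iff[OF \<psi>(2) that(1,2)] p(3) that by simp
    ultimately have "dev C \<xi> p" using \<psi>(1) p unfolding dev_def by blast
    then show ?thesis by blast
  qed
  then obtain \<xi> p where dev: "\<And>C. C \<in> \<C> \<Longrightarrow> dev C (\<xi> C) (p C)" by metis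
  have image_C: "C = p C ` {z. 1 \<le> Im z}" if "C \<in> \<C>" for C
    using dev[OF that] unfolding dev_def by (elim conjE)
  define K where "K = closure (X - \<Union>\<C>)"
  have "closed X" using compl by (rule complete_imp_closed)
  then have KX: "K \<subseteq> X" unfolding K_def by (simp add: closure_minimal)
  have "cusped_surface X \<C> \<xi> p K"
  proof
    show "\<And>C. C \<in> \<C> \<Longrightarrow> 0 < \<xi> C" using dev by (simp add: dev_def)
    show "\<And>C. C \<in> \<C> \<Longrightarrow> local_isometry_on (above 0) (p C)" using dev by (simp add: dev_def)
    show "\<And>C. C \<in> \<C> \<Longrightarrow> p C ` above 0 \<subseteq> X" using dev unfolding dev_def by blast
    show "\<And>C z. C \<in> \<C> \<Longrightarrow> 0 < Im z \<Longrightarrow> p C (z + of_real (\<xi> C)) = p C z" using dev by (simp add: dev_def)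
    show "\<And>C z w. C \<in> \<C> \<Longrightarrow> 1 \<le> Im z \<Longrightarrow> 1 \<le> Im w \<Longrightarrow> p C z = p C w \<Longrightarrow>
      \<exists>k::int. z - w = of_int k * of_real (\<xi> C)" using dev unfolding dev_def by blast
    show "C = C'" if "C \<in> \<C>" "C' \<in> \<C>" "1 \<le> Im z" "1 \<le> Im w" "p C z = p C' w" for C C' z w
    proof (rule ccontr)
      assume "C \<noteq> C'"
      then have "C \<inter> C' = {}" using \<C>(3) that(1,2) by (auto simp: pairwise_def disjnt_def)
      moreover have "p C z \<in> C" using image_C[OF that(1)] that(3) by blast
      moreover have "p C' w \<in> C'" using image_C[OF that(2)] that(4) by blast
      ultimately show False using that(5) by auto
    qed
    show "compact K" unfolding K_def by (rule \<C>(5))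
    show "X \<subseteq> K \<union> (\<Union>i\<in>\<C>. p i ` {z. 1 \<le> Im z})"
    proof
      fix x assume x: "x \<in> X"
      show "x \<in> K \<union> (\<Union>i\<in>\<C>. p i ` {z. 1 \<le> Im z})"
      proof (cases "x \<in> \<Union>\<C>")
        case True
        then obtain C where C: "C \<in> \<C>" "x \<in> C" by blast
        then have "x \<in> p C ` {z. 1 \<le> Im z}" using image_C by blast
        then show ?thesis using C(1) by (intro UnI2 UN_I)
      next
        case False
        then have "x \<in> X - \<Union>\<C>" using x by blast
        then have "x \<in> K" unfolding K_def by (rule subsetD[OF closure_subset])
        then show ?thesis by (rule UnI1)
      qed
    qed
  qed (use hyp conn \<C>(1) KX in auto)
  moreover have "\<C> \<noteq> {}" using \<C>(2) n by auto
  ultimately show ?thesis by (rule that)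
qed

theorem theoremB:
  fixes X :: "'a::metric_space set" and g n :: nat
  assumes "2 * g + n \<ge> 3"
    and "X \<in> moduli_space g n"
    and "n \<ge> 1"
  shows "\<exists>D>0. \<forall>\<xi> \<epsilon>::real. 0 < \<xi> \<longrightarrow> \<xi> \<le> 1 \<longrightarrow> 0 < \<epsilon> \<longrightarrow> \<epsilon> \<le> min (2 * ln (1 / \<xi>)) 2 \<longrightarrow>
    (\<exists>L \<gamma>. doubly_truncated_orthogeodesic X \<xi> L \<gamma> \<and>
       dense_within \<epsilon> (\<gamma> ` {0..L}) (truncated_surface X \<xi>) \<and>
       curve_length 0 L \<gamma> \<le> ennreal (D * (1 / \<epsilon>) * (ln (1 / \<epsilon>) + ln (1 / \<xi>))))"
proof -
  obtain I :: "'a set set" and a p K where cs: "cusped_surface X I a p K" "I \<noteq> {}"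
    using moduli_space_cusped_surface[OF assms(2,3)] by metis
  then obtain i where "i \<in> I" by blast
  then show ?thesis by (rule cusped_surface.short_dense_orthogeodesics[OF cs(1)])
qed

end
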